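(* Let $\alpha\in(0,\pi)$, let $\nu$ be a compactly supported probability measure on $\mathbb{R}$ symmetric about $0$, let $(\sigma_N)$ and $(t_N)$ be sequences of positive reals, and for each $N$ let $(\mathbf{Z},\mathbf{X})$ be sampled from $\mathrm{GLMM}_N(\alpha,\nu,\sigma_N)$. Assume there is $\rho\in(0,1]$ such that $\sup_{I}\nu(I)/|I|^{\rho}<\infty$, the supremum being over all bounded intervals $I\subset\mathbb{R}$ of length $|I|>0$. Fix $\varepsilon>0$. Then: (i) If $\sigma_N\sqrt{\log N}\ll t_N\ll (N\log N)^{-1/\rho}$, then the Spectral Method with input parameters $t_N$ and $\varepsilon$, applied to $\mathbf{X}$, achieves exact recovery. (ii) If $\sigma_N\ll t_N\ll 1$, then the Spectral Method with input parameters $t_N$ and $\varepsilon$, applied to $\mathbf{X}$, achieves almost exact recovery.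
   Context: Model: let $L_1,L_2\subset\mathbb{R}^2$ be lines through the origin intersecting at angle $\alpha$, and let $\mathbf{v}_1,\mathbf{v}_2$ be unit vectors spanning $L_1,L_2$. $(\mathbf{Z},\mathbf{X})\sim\mathrm{GLMM}_N(\alpha,\nu,\sigma)$ means: $\mathbf{Z}=(Z_1,\dots,Z_N)$ with $Z_i$ uniform on $\{1,2\}$, and $\mathbf{X}=(\mathbf{X}_1,\dots,\mathbf{X}_N)$ with $\mathbf{X}_i=V_i\mathbf{v}_{Z_i}+\sigma\mathbf{Y}_i\in\mathbb{R}^2$, where $V_i\sim\nu$, $\mathbf{Y}_i\sim N(0,I_2)$, and all $Z_i,V_i,\mathbf{Y}_i$ are mutually independent. TLS residual: for three points in $\mathbb{R}^2$, $\sigma_{\mathrm{TLS}}\ge0$ is defined by $\sigma_{\mathrm{TLS}}^2(\mathbf{x}_1,\mathbf{x}_2,\mathbf{x}_3)=\min_{\mathcal{L}}\sum_{i=1}^3 d(\mathbf{x}_i,\mathcal{L})^2$, the minimum being over all lines $\mathcal{L}\subset\mathbb{R}^2$ and $d$ denoting Euclidean (perpendicular) distance. The TLS hypergraph with threshold $t>0$ has vertex set $[N]=\{1,\dots,N\}$ and hyperedge set $E(H)=\{\{i,j,k\}\in\binom{[N]}{3}:\sigma_{\mathrm{TLS}}(\mathbf{X}_i,\mathbf{X}_j,\mathbf{X}_k)\le t\}$. Spectral Method with parameters $t>0$, $\varepsilon>0$: (1) construct the TLS hypergraph $H$ of $\mathbf{X}$ with threshold $t$; (2) form the symmetric $N\times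 N$ matrix $\mathbf{W}$ with $W_{ij}=$ number of hyperedges of $H$ containing both $i$ and $j$ for $i\ne j$, and $W_{ii}=0$; (3) let $\mathbf{U}\in\mathbb{R}^{N\times2}$ have as columns orthonormal eigenvectors of $\mathbf{W}$ for its two largest eigenvalues $\lambda_1\ge\lambda_2$ (eigenvalues ordered $\lambda_1\ge\dots\ge\lambda_N$); (4) run $(1+\varepsilon)$-approximate $K$-means with $K=2$ on the rows of $\mathbf{U}$, i.e. any procedure producing $(\hat{\mathcal{Z}},\hat{\mathcal{X}})$ with $\hat{\mathcal{Z}}\in\mathbb{Z}_{N,2}$, $\hat{\mathcal{X}}\in\mathbb{R}^{2\times2}$ and $\|\hat{\mathcal{Z}}\hat{\mathcal{X}}-\mathbf{U}\|_F^2\le(1+\varepsilon)\min_{\mathcal{Z}\in\mathbb{Z}_{N,2},\,\mathcal{X}\in\mathbb{R}^{2\times2}}\|\mathcal{Z}\mathcal{X}-\mathbf{U}\|_F^2$, where $\mathbb{Z}_{N,2}$ is the set of $N\times2$ matrices with entries in $\{0,1\}$ and exactly one nonzero entry in each row; output $\hat{\mathbf{Z}}=(\hat Z_1,\dots,\hat Z_N)$ with $\hat Z_i=k$ iff $\hat{\mathcal{Z}}_{ik}=1$. $\mathrm{Ham}(\mathbf{z},\mathbf{w})=\sum_{i=1}^N1(z_i\ne w_i)$, $\mathrm{Ham}^*(\mathbf{z},\mathbf{w})=\min\{\mathrm{Ham}(\mathbf{z},\mathbf{w}),N-\mathrm{Ham}(\mathbf{z},\mathbf{w})\}$. Exact recovery: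 $\lim_{N\to\infty}\mathbb{E}[\mathrm{Ham}^*(\hat{\mathbf{Z}},\mathbf{Z})]=0$. Almost exact recovery: $\lim_{N\to\infty}N^{-1}\mathbb{E}[\mathrm{Ham}^*(\hat{\mathbf{Z}},\mathbf{Z})]=0$. For positive sequences, $a_N\ll b_N$ means $a_N/b_N\to0$ as $N\to\infty$. *)

theory Defs
  imports "HOL-Probability.Probability" "Jordan_Normal_Form.Char_Poly"
begin

no_notation Matrix.scalar_prod (infix "\<bullet>" 70)
no_notation Matrix.vec_index (infixl "$" 100)

(* The plane is the type real^2 of HOL-Analysis; matrices whose size depends on N are
   the dimension-carrying matrices of Jordan_Normal_Form.
   Everything is indexed from 0: the samples are 0, ..., N - 1 and the labels are 0 and 1,
   so that labels and vertices are directly column and row indices of matrices. *)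

type_synonym plane = "real^2"

definition much_less :: "(nat \<Rightarrow> real) \<Rightarrow> (nat \<Rightarrow> real) \<Rightarrow> bool"  (infix "\<lless>" 50) where
  "a \<lless> b \<longleftrightarrow> (\<lambda>N. a N / b N) \<longlonglongrightarrow> 0"


section \<open>The Gaussian line mixture model\<close>

definition meet_at_angle :: "plane set \<Rightarrow> plane set \<Rightarrow> real \<Rightarrow> bool" where
  "meet_at_angle L1 L2 \<alpha> \<longleftrightarrow>
     (\<exists>u1 u2. norm u1 = 1 \<and> norm u2 = 1 \<and> L1 = span {u1} \<and> L2 = span {u2} \<and> u1 \<bullet> u2 = cos \<alpha>)"

definition std_gauss_plane :: "plane measure" where
  "std_gauss_plane = density lborel (\<lambda>y. \<Prod>j\<in>UNIV. std_normal_density (y $ j))"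

definition label_space :: "nat \<Rightarrow> (nat \<Rightarrow> nat) measure" where
  "label_space N = (\<Pi>\<^sub>M i\<in>{..<N}. count_space UNIV)"

definition sample_space :: "nat \<Rightarrow> (nat \<Rightarrow> plane) measure" where
  "sample_space N = (\<Pi>\<^sub>M i\<in>{..<N}. borel)"

(* The joint law of (Z, X), where v 0 and v 1 are the unit vectors spanning the two lines. *)
definition GLMM :: "nat \<Rightarrow> (nat \<Rightarrow> plane) \<Rightarrow> real measure \<Rightarrow> real
    \<Rightarrow> ((nat \<Rightarrow> nat) \<times> (nat \<Rightarrow> plane)) measure" where
  "GLMM N v \<nu> \<sigma> =
     distr ((\<Pi>\<^sub>M i\<in>{..<N}. measure_pmf (pmf_of_set {0, 1})) \<Otimes>\<^sub>M
            ((\<Pi>\<^sub>M i\<in>{..<N}. \<nu>) \<Otimes>\<^sub>M (\<Pi>\<^sub>M i\<in>{..<N}. std_gauss_plane)))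
       (label_space N \<Otimes>\<^sub>M sample_space N)
       (\<lambda>(z, V, Y). (z, \<lambda>i\<in>{..<N}. V i *\<^sub>R v (z i) + \<sigma> *\<^sub>R Y i))"

definition sampled_from_GLMM :: "'a measure \<Rightarrow> nat \<Rightarrow> (nat \<Rightarrow> plane) \<Rightarrow> real measure \<Rightarrow> real
    \<Rightarrow> ('a \<Rightarrow> nat \<Rightarrow> nat) \<Rightarrow> ('a \<Rightarrow> nat \<Rightarrow> plane) \<Rightarrow> bool" where
  "sampled_from_GLMM M N v \<nu> \<sigma> Z X \<longleftrightarrow>
     Z \<in> M \<rightarrow>\<^sub>M label_space N \<and> X \<in> M \<rightarrow>\<^sub>M sample_space N \<and>
     distr M (label_space N \<Otimes>\<^sub>M sample_space N) (\<lambda>\<omega>. (Z \<omega>, X \<omega>)) = GLMM N v \<nu> \<sigma>"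

definition compactly_supported :: "real measure \<Rightarrow> bool" where
  "compactly_supported \<nu> \<longleftrightarrow> (\<exists>K. compact K \<and> emeasure \<nu> (- K) = 0)"

definition symmetric_about_0 :: "real measure \<Rightarrow> bool" where
  "symmetric_about_0 \<nu> \<longleftrightarrow> distr \<nu> borel uminus = \<nu>"

(* Intervals may be open, closed or half-open; their length is their Lebesgue measure. *)
definition interval_ratios :: "real measure \<Rightarrow> real \<Rightarrow> real set" where
  "interval_ratios \<nu> \<rho> =
     {measure \<nu> I / (measure lborel I) powr \<rho> | I.
        is_interval I \<and> bounded I \<and> measure lborel I > 0}"


section \<open>The TLS hypergraph\<close>

definition is_line :: "plane set \<Rightarrow> bool" where
  "is_line L \<longleftrightarrow> affine L \<and> aff_dim L = 1"

(* The infimum is attained, so it is the minimum over all lines. *)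
definition sigma_TLS :: "plane \<Rightarrow> plane \<Rightarrow> plane \<Rightarrow> real" where
  "sigma_TLS x1 x2 x3 =
     sqrt (INF L\<in>{L. is_line L}. (infdist x1 L)\<^sup>2 + (infdist x2 L)\<^sup>2 + (infdist x3 L)\<^sup>2)"

definition TLS_hyperedges :: "nat \<Rightarrow> real \<Rightarrow> (nat \<Rightarrow> plane) \<Rightarrow> nat set set" where
  "TLS_hyperedges N t x =
     {{i, j, k} | i j k. {i, j, k} \<subseteq> {..<N} \<and> distinct [i, j, k] \<and> sigma_TLS (x i) (x j) (x k) \<le> t}"

definition weight_mat :: "nat \<Rightarrow> nat set set \<Rightarrow> real mat" where
  "weight_mat N E =
     mat N N (\<lambda>(i, j). if i = j then 0 else real (card {e \<in> E. i \<in> e \<and> j \<in> e}))"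


section \<open>The spectral method\<close>

(* es lists the eigenvalues in decreasing order, with multiplicity; meaningful for N \<ge> 2. *)
definition top2_eigenvectors :: "nat \<Rightarrow> real mat \<Rightarrow> real mat \<Rightarrow> bool" where
  "top2_eigenvectors N W U \<longleftrightarrow>
     U \<in> carrier_mat N 2 \<and> U\<^sup>T * U = 1\<^sub>m 2 \<and>
     (\<exists>es. length es = N \<and> sorted_wrt (\<ge>) es \<and> char_poly W = (\<Prod>e\<leftarrow>es. [:- e, 1:]) \<and>
           eigenvector W (col U 0) (es ! 0) \<and> eigenvector W (col U 1) (es ! 1))"

definition membership_mats :: "nat \<Rightarrow> real mat set" where
  "membership_mats N =
     {A \<in> carrier_mat N 2. (\<forall>i<N. \<forall>k<2. A $$ (i, k) \<in> {0, 1}) \<and>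
                           (\<forall>i<N. \<exists>!k. k < 2 \<and> A $$ (i, k) \<noteq> 0)}"

definition frob_norm_sq :: "real mat \<Rightarrow> real" where
  "frob_norm_sq A = (\<Sum>i<dim_row A. \<Sum>j<dim_col A. (A $$ (i, j))\<^sup>2)"

(* The infimum is attained: there are finitely many choices of A, and for each of them
   this is a least squares problem in B. *)
definition approx_2_means :: "nat \<Rightarrow> real \<Rightarrow> real mat \<Rightarrow> real mat \<Rightarrow> real mat \<Rightarrow> bool" where
  "approx_2_means N \<epsilon> U Ahat Bhat \<longleftrightarrow>
     Ahat \<in> membership_mats N \<and> Bhat \<in> carrier_mat 2 2 \<and>
     frob_norm_sq (Ahat * Bhat - U)
       \<le> (1 + \<epsilon>) * (INF (A, B)\<in>membership_mats N \<times> carrier_mat 2 2. frob_norm_sq (A * B - U))"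

(* zhat is a possible output; the method leaves the choice of the eigenvectors and of the
   approximate 2-means solution open. *)
definition spectral_output :: "nat \<Rightarrow> real \<Rightarrow> real \<Rightarrow> (nat \<Rightarrow> plane) \<Rightarrow> (nat \<Rightarrow> nat) \<Rightarrow> bool" where
  "spectral_output N t \<epsilon> x zhat \<longleftrightarrow>
     (\<exists>U Ahat Bhat. top2_eigenvectors N (weight_mat N (TLS_hyperedges N t x)) U \<and>
        approx_2_means N \<epsilon> U Ahat Bhat \<and>
        (\<forall>i<N. zhat i < 2 \<and> (\<forall>k<2. zhat i = k \<longleftrightarrow> Ahat $$ (i, k) = 1)))"


section \<open>Recovery\<close>

definition Ham :: "nat \<Rightarrow> (nat \<Rightarrow> nat) \<Rightarrow> (nat \<Rightarrow> nat) \<Rightarrow> nat" where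
  "Ham N z w = card {i. i < N \<and> z i \<noteq> w i}"

definition Ham_star :: "nat \<Rightarrow> (nat \<Rightarrow> nat) \<Rightarrow> (nat \<Rightarrow> nat) \<Rightarrow> nat" where
  "Ham_star N z w = min (Ham N z w) (N - Ham N z w)"

definition exact_recovery ::
    "(nat \<Rightarrow> 'a measure) \<Rightarrow> (nat \<Rightarrow> 'a \<Rightarrow> nat \<Rightarrow> nat) \<Rightarrow> (nat \<Rightarrow> 'a \<Rightarrow> nat \<Rightarrow> nat) \<Rightarrow> bool" where
  "exact_recovery M Zhat Z \<longleftrightarrow>
     (\<lambda>N. \<integral>\<omega>. real (Ham_star N (Zhat N \<omega>) (Z N \<omega>)) \<partial>M N) \<longlonglongrightarrow> 0"

definition almost_exact_recovery ::
    "(nat \<Rightarrow> 'a measure) \<Rightarrow> (nat \<Rightarrow> 'a \<Rightarrow> nat \<Rightarrow> nat) \<Rightarrow> (nat \<Rightarrow> 'a \<Rightarrow> nat \<Rightarrow> nat) \<Rightarrow> bool" where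
  "almost_exact_recovery M Zhat Z \<longleftrightarrow>
     (\<lambda>N. (\<integral>\<omega>. real (Ham_star N (Zhat N \<omega>) (Z N \<omega>)) \<partial>M N) / real N) \<longlonglongrightarrow> 0"

end

theory Submission
  imports Defs "Jordan_Normal_Form.Schur_Decomposition"
begin

text \<open>
  The error of the method is governed by one probability. Call a triple of samples misjudged if its
  being a hyperedge disagrees with its having a common label. If no triple is misjudged, the weight
  between two distinct samples of the same class is the size of that class minus 2, and all other
  weights vanish; for classes with at least three members, the eigenvectors of this two-block matrix
  for positive eigenvalues are constant on the classes and so reveal the labels.

  The deterministic half of the proof (\<open>spectral_output_error\<close>) compares the true weight matrix with
  the two-block matrix. Let F be the square of the Frobenius norm of the difference. It is at most N
  times the number of misjudged ordered triples. If both classes have at least N/4 members, then the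
  second eigenvalue is of order \<open>N^2\<close> unless F is already of order \<open>N^4\<close>
  (\<open>second_eigenvalue_ge\<close>, \<open>quad_form_ideal_perturbed_ge\<close>); an eigenvector for the eigenvalue \<open>\<mu>\<close> is
  within squared distance \<open>F/\<mu>^2\<close> of its class averages (\<open>eigenvector_resid_bound\<close>); and as the two
  rows of class averages are at squared distance at least 2/N when the residuals are small, an
  approximate 2-means solution mislabels only \<open>O(F/N^3)\<close> samples (\<open>kmeans_error\<close>). So the error is at most a constant times the
  number of misjudged triples divided by \<open>N^2\<close>, and in expectation it is \<open>O(N p)\<close>, where p bounds the
  probability that a given triple is misjudged, plus an exponentially small term for the event that a
  class has fewer than N/4 members (\<open>expected_error_bound\<close>).

  The probabilistic half bounds p (\<open>emeasure_GLMM_misjudged\<close>). Noise vectors longer than \<open>t/2\<close> have a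
  Gaussian tail probability in \<open>t/\<sigma>\<close>. Without them a triple within a class is never misjudged, and
  three samples with positions a, b on one line and c on the other can be misjudged only if
  \<open>|c| |a - b|\<close> is at most a constant times t: a line that passes near both a and b has little freedom
  to turn away when a and b are far apart, and then it meets the other line close to the origin only.
  Splitting the range of \<open>|c|\<close> into J dyadic shells and using the bound on the mass of intervals twice
  gives probability \<open>O(J t^\<rho> + 2^(- J \<rho>))\<close>.

  For almost exact recovery p must tend to 0; this holds for J fixed as N grows, up to a remainder
  that is small for large J. For exact recovery \<open>N p\<close> must tend to 0, and J of order \<open>log N\<close> turns
  the requirement into \<open>N log N t^\<rho> \<rightarrow> 0\<close>, which is the upper assumption on the threshold, while the
  lower assumption makes the Gaussian tail smaller than any power of N.
\<close>

(* The dot and the dollar sign are to denote inner product and components in the plane. *)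
no_notation Matrix.scalar_prod (infix "\<bullet>" 70)
no_notation Matrix.vec_index (infixl "$" 100)

section \<open>Lines in the plane and the TLS residual\<close>

text \<open>
  In the plane the affine sets of dimension 1 are the hyperplanes, so every line has a unit normal;
  distances to it can then be estimated from below by a single inner product.
\<close>

lemma line_normal_form:
  assumes "is_line L"
  obtains n h where "norm n = 1" and "L = {x::plane. n \<bullet> x = h}"
proof -
  have L: "affine L" "aff_dim L = 1"
    using assms by (auto simp: is_line_def)
  then have "aff_dim L = DIM(plane) - 1" by simp
  then obtain a b where a: "a \<noteq> 0" and "affine hull L = {x. a \<bullet> x = b}"
    using aff_dim_eq_hyperplane[of L] by blast
  moreover have "affine hull L = L" using L(1) by (rule affine_hull_eq[THEN iffD2])
  ultimately have L_eq: "L = {x. a \<bullet> x = b}" by simp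
  have "L = {x. (a /\<^sub>R norm a) \<bullet> x = b / norm a}"
    using a unfolding L_eq by (auto simp: field_simps)
  moreover have "norm (a /\<^sub>R norm a) = 1" using a by simp
  ultimately show thesis using that by blast
qed

lemma is_line_span:
  assumes "norm v = 1"
  shows "is_line (span {v})"
proof -
  have "v \<noteq> 0" using assms by auto
  then show ?thesis
    unfolding is_line_def
    by (simp add: subspace_imp_affine aff_dim_subspace dim_eq_card_independent)
qed

lemma normal_form_le_infdist:
  fixes x n :: plane
  assumes "norm n = 1" and "L = {x. n \<bullet> x = h}"
  shows "\<bar>n \<bullet> x - h\<bar> \<le> infdist x L"
proof -
  have "h *\<^sub>R n \<in> L"
    using assms by (simp add: dot_square_norm)
  then have "L \<noteq> {}" by auto
  have "\<bar>n \<bullet> x - h\<bar> \<le> dist x y" if "y \<in> L" for y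
  proof -
    have "n \<bullet> x - h = n \<bullet> (x - y)" using that assms by (simp add: inner_diff_right)
    also have "\<bar>\<dots>\<bar> \<le> norm n * norm (x - y)" by (rule Cauchy_Schwarz_ineq2)
    finally show ?thesis using assms by (simp add: dist_norm)
  qed
  then show ?thesis
    using \<open>L \<noteq> {}\<close> by (simp add: infdist_notempty cINF_greatest)
qed

lemma is_line_ex: "{L. is_line L} \<noteq> {}"
  using is_line_span[OF norm_axis_1] by auto

lemma residual_bdd_below:
  "bdd_below ((\<lambda>L. (infdist x1 L)\<^sup>2 + (infdist x2 L)\<^sup>2 + (infdist x3 L)\<^sup>2) ` A)"
  by (rule bdd_belowI2[of _ 0]) simp

lemma sigma_TLS_le:
  assumes "is_line L"
  shows "sigma_TLS x1 x2 x3 \<le> sqrt ((infdist x1 L)\<^sup>2 + (infdist x2 L)\<^sup>2 + (infdist x3 L)\<^sup>2)"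
  unfolding sigma_TLS_def
  by (intro real_sqrt_le_mono cINF_lower residual_bdd_below) (use assms in auto)

lemma residual_inf_less_iff:
  "(INF L\<in>{L. is_line L}. (infdist x1 L)\<^sup>2 + (infdist x2 L)\<^sup>2 + (infdist x3 L)\<^sup>2) < c \<longleftrightarrow>
     (\<exists>L. is_line L \<and> (infdist x1 L)\<^sup>2 + (infdist x2 L)\<^sup>2 + (infdist x3 L)\<^sup>2 < c)"
  by (subst cINF_less_iff[OF is_line_ex residual_bdd_below]) auto

text \<open>
  Weakening the residual to the largest of the three distances loses only a constant factor, and
  the strict inequality avoids showing that the infimum over all lines is attained.
\<close>

lemma sigma_TLS_lessE:
  assumes "sigma_TLS x1 x2 x3 < s"
  obtains n h where "norm n = 1"
    and "\<bar>n \<bullet> x1 - h\<bar> < s" and "\<bar>n \<bullet> x2 - h\<bar> < s" and "\<bar>n \<bullet> x3 - h\<bar> < s"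
proof -
  let ?I = "INF L\<in>{L. is_line L}. (infdist x1 L)\<^sup>2 + (infdist x2 L)\<^sup>2 + (infdist x3 L)\<^sup>2"
  have "?I \<ge> 0" by (rule cINF_greatest[OF is_line_ex]) simp
  have s: "sqrt ?I < s" using assms by (simp add: sigma_TLS_def)
  moreover have "sqrt ?I \<ge> 0" using \<open>?I \<ge> 0\<close> by simp
  ultimately have "s > 0" by linarith
  have "(sqrt ?I)\<^sup>2 < s\<^sup>2"
    using s \<open>sqrt ?I \<ge> 0\<close> by (intro power_strict_mono) auto
  then have "?I < s\<^sup>2" using \<open>?I \<ge> 0\<close> by simp
  then obtain L where L: "is_line L"
    and sum: "(infdist x1 L)\<^sup>2 + (infdist x2 L)\<^sup>2 + (infdist x3 L)\<^sup>2 < s\<^sup>2"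
    unfolding residual_inf_less_iff by blast
  obtain n h where nh: "norm n = 1" "L = {x. n \<bullet> x = h}"
    using line_normal_form[OF L] .
  have less: "\<bar>n \<bullet> x - h\<bar> < s" if "(infdist x L)\<^sup>2 < s\<^sup>2" for x
    using normal_form_le_infdist[OF nh, of x] power_less_imp_less_base[OF that] \<open>s > 0\<close> by linarith
  show thesis
    by (rule that[OF nh(1)]; rule less)
      (use sum zero_le_power2[of "infdist x1 L"] zero_le_power2[of "infdist x2 L"]
        zero_le_power2[of "infdist x3 L"] in linarith)+
qed

text \<open>
  An infimum of uncountably many functions, but strict sublevel sets of an infimum are unions of
  strict sublevel sets, and these are open because each residual is continuous in the three points.
\<close>

lemma measurable_sigma_TLS [measurable]:
  assumes [measurable]: "f \<in> borel_measurable M" "g \<in> borel_measurable M" "h \<in> borel_measurable M"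
  shows "(\<lambda>\<omega>. sigma_TLS (f \<omega>) (g \<omega>) (h \<omega>)) \<in> borel_measurable M"
proof -
  let ?R = "\<lambda>L (x1::plane, x2::plane, x3::plane).
    (infdist x1 L)\<^sup>2 + (infdist x2 L)\<^sup>2 + (infdist x3 L)\<^sup>2"
  have cont: "continuous_on UNIV (?R L)" for L
    unfolding case_prod_unfold
    by (intro continuous_intros)
  have "(\<lambda>p. INF L\<in>{L. is_line L}. ?R L p) \<in> borel_measurable borel"
  proof (rule borel_measurableI_less)
    fix c
    have "{p \<in> space borel. (INF L\<in>{L. is_line L}. ?R L p) < c}
        = (\<Union>L\<in>{L. is_line L}. {p. ?R L p < c})"
      by (auto simp: residual_inf_less_iff)
    moreover have "open (\<Union>L\<in>{L. is_line L}. {p. ?R L p < c})"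
      using cont by (intro open_UN ballI open_Collect_less continuous_on_const) auto
    ultimately show "{p \<in> space borel. (INF L\<in>{L. is_line L}. ?R L p) < c} \<in> sets borel"
      by simp
  qed
  from measurable_compose[OF _ this, of "\<lambda>\<omega>. (f \<omega>, g \<omega>, h \<omega>)" M]
  have "(\<lambda>\<omega>. INF L\<in>{L. is_line L}. ?R L (f \<omega>, g \<omega>, h \<omega>)) \<in> borel_measurable M"
    by (simp add: borel_prod[symmetric])
  then show ?thesis unfolding sigma_TLS_def by simp
qed

text \<open>
  For unit vectors this is, up to sign, the sine of the angle between them.
\<close>

definition cross_det :: "plane \<Rightarrow> plane \<Rightarrow> real" where
  "cross_det v w = v $ 1 * w $ 2 - v $ 2 * w $ 1"

lemma inner_plane: "(x::plane) \<bullet> y = x $ 1 * y $ 1 + x $ 2 * y $ 2"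
  by (simp add: inner_vec_def UNIV_2)

lemma cross_det_sq: "(cross_det v w)\<^sup>2 = (norm v)\<^sup>2 * (norm w)\<^sup>2 - (v \<bullet> w)\<^sup>2"
  unfolding power2_norm_eq_inner inner_plane cross_det_def
  by (simp add: power2_eq_square algebra_simps)

lemma cross_det_nonzero:
  assumes "0 < \<alpha>" "\<alpha> < pi" "meet_at_angle (span {v}) (span {w}) \<alpha>" "norm v = 1" "norm w = 1"
  shows "cross_det v w \<noteq> 0"
proof -
  obtain u1 u2 where u: "norm u1 = 1" "norm u2 = 1" "span {v} = span {u1}" "span {w} = span {u2}"
    "u1 \<bullet> u2 = cos \<alpha>"
    using assms(3) unfolding meet_at_angle_def by blast
  obtain a where a: "v = a *\<^sub>R u1"
    using u(3) span_base[of v "{v}"] by (auto simp: span_singleton)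
  obtain b where b: "w = b *\<^sub>R u2"
    using u(4) span_base[of w "{w}"] by (auto simp: span_singleton)
  have "\<bar>a\<bar> = 1" "\<bar>b\<bar> = 1" using a b u assms by auto
  then have ab: "a\<^sup>2 = 1" "b\<^sup>2 = 1" by (metis power2_abs power_one)+
  have "(v \<bullet> w)\<^sup>2 = a\<^sup>2 * b\<^sup>2 * (cos \<alpha>)\<^sup>2"
    using u(5) by (simp add: a b power_mult_distrib)
  then have "(cross_det v w)\<^sup>2 = (sin \<alpha>)\<^sup>2"
    using assms ab by (simp add: cross_det_sq sin_squared_eq)
  moreover have "sin \<alpha> > 0" using assms by (simp add: sin_gt_zero)
  ultimately show ?thesis by auto
qed

text \<open>
  A unit normal cannot be almost orthogonal to two independent directions at once. Quantitatively,
  the determinant times n is a combination of the two vectors, each rotated by a right angle, with the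
  two inner products as coefficients.
\<close>

lemma cross_det_le_projections:
  assumes "norm n = 1" "norm v = 1" "norm w = 1"
  shows "\<bar>cross_det v w\<bar> \<le> \<bar>n \<bullet> v\<bar> + \<bar>n \<bullet> w\<bar>"
proof -
  define R where "R x = (vector [x $ 2, - x $ 1] :: plane)" for x :: plane
  have R: "norm (R x) = norm x" for x
    by (simp add: R_def norm_eq_sqrt_inner inner_plane algebra_simps)
  have "cross_det v w *\<^sub>R n = (n \<bullet> v) *\<^sub>R R w - (n \<bullet> w) *\<^sub>R R v"
    unfolding Finite_Cartesian_Product.vec_eq_iff forall_2 by (simp add: cross_det_def inner_plane R_def field_simps)
  then have "\<bar>cross_det v w\<bar> * norm n = norm ((n \<bullet> v) *\<^sub>R R w - (n \<bullet> w) *\<^sub>R R v)"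
    by (metis norm_scaleR)
  also have "\<dots> \<le> norm ((n \<bullet> v) *\<^sub>R R w) + norm ((n \<bullet> w) *\<^sub>R R v)"
    by (rule norm_triangle_ineq4)
  finally show ?thesis using assms by (simp add: R)
qed

text \<open>
  A line that comes within distance s of the points a v and b v satisfies |a - b| |n . v| \<le> 2 s for
  its normal n; hence its offset h is at most s + K |n . v|, and closeness to c w forces
  |c| |n . w| \<le> 2 s + K |n . v|. At least one of the two inner products is bounded below, so |a - b| or
  |c| must be small; multiplying the estimates covers both cases at once.
\<close>

lemma near_common_line_imp_product_small:
  assumes n: "norm n = 1" "norm v = 1" "norm w = 1"
    and K: "\<bar>a\<bar> \<le> K" "\<bar>b\<bar> \<le> K" "\<bar>c\<bar> \<le> K"
    and near: "\<bar>n \<bullet> (a *\<^sub>R v) - h\<bar> \<le> s" "\<bar>n \<bullet> (b *\<^sub>R v) - h\<bar> \<le> s" "\<bar>n \<bullet> (c *\<^sub>R w) - h\<bar> \<le> s"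
  shows "\<bar>cross_det v w\<bar> * (\<bar>c\<bar> * \<bar>a - b\<bar>) \<le> 8 * K * s"
proof -
  define p q where "p = \<bar>n \<bullet> v\<bar>" and "q = \<bar>n \<bullet> w\<bar>"
  have s0: "s \<ge> 0" using near(1) by linarith
  have K0: "K \<ge> 0" using K(1) by linarith
  have ab: "\<bar>a - b\<bar> * p \<le> 2 * s"
  proof -
    have "\<bar>a - b\<bar> * p = \<bar>a * (n \<bullet> v) - b * (n \<bullet> v)\<bar>"
      by (simp add: p_def abs_mult[symmetric] algebra_simps)
    then show ?thesis using near(1,2) by simp
  qed
  have "\<bar>h\<bar> \<le> s + \<bar>a\<bar> * p"
    using near(1) by (simp add: p_def abs_mult[symmetric])
  moreover have "\<bar>a\<bar> * p \<le> K * p"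
    using K(1) by (simp add: p_def mult_right_mono)
  moreover have "\<bar>c\<bar> * q \<le> s + \<bar>h\<bar>"
    using near(3) by (simp add: q_def abs_mult[symmetric])
  ultimately have cq: "\<bar>c\<bar> * q \<le> 2 * s + K * p" by linarith
  have "\<bar>cross_det v w\<bar> * (\<bar>c\<bar> * \<bar>a - b\<bar>) \<le> (p + q) * (\<bar>c\<bar> * \<bar>a - b\<bar>)"
    using cross_det_le_projections[OF n] by (intro mult_right_mono) (auto simp: p_def q_def)
  also have "\<dots> = \<bar>c\<bar> * (\<bar>a - b\<bar> * p) + (\<bar>c\<bar> * q) * \<bar>a - b\<bar>"
    by (simp add: algebra_simps)
  also have "\<dots> \<le> K * (2 * s) + (2 * s + K * p) * \<bar>a - b\<bar>"
    using mult_mono[OF K(3) ab] mult_right_mono[OF cq, of "\<bar>a - b\<bar>"] K0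
    by (intro add_mono) (auto simp: p_def)
  also have "\<dots> = K * (2 * s) + 2 * s * \<bar>a - b\<bar> + K * (\<bar>a - b\<bar> * p)"
    by (simp add: algebra_simps)
  also have "\<dots> \<le> K * (2 * s) + 2 * s * (2 * K) + K * (2 * s)"
  proof -
    have "2 * s * \<bar>a - b\<bar> \<le> 2 * s * (2 * K)" using K s0 by (intro mult_left_mono) auto
    moreover have "K * (\<bar>a - b\<bar> * p) \<le> K * (2 * s)" using K ab by (intro mult_left_mono) auto
    ultimately show ?thesis by linarith
  qed
  finally show ?thesis by (simp add: algebra_simps)
qed

definition misjudged :: "real \<Rightarrow> (nat \<Rightarrow> nat) \<Rightarrow> (nat \<Rightarrow> plane) \<Rightarrow> nat \<Rightarrow> nat \<Rightarrow> nat \<Rightarrow> bool" where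
  "misjudged t z x i j k \<longleftrightarrow>
     \<not> (sigma_TLS (x i) (x j) (x k) \<le> t \<longleftrightarrow> z i = z j \<and> z j = z k)"

lemma small_noise_imp_class_triple_judged:
  assumes t: "0 < t" and v: "norm v = 1"
    and noise: "norm (x1 - a *\<^sub>R v) \<le> t / 2" "norm (x2 - b *\<^sub>R v) \<le> t / 2" "norm (x3 - c *\<^sub>R v) \<le> t / 2"
  shows "sigma_TLS x1 x2 x3 \<le> t"
proof -
  have near: "(infdist x (span {v}))\<^sup>2 \<le> (t / 2)\<^sup>2" if "norm (x - a *\<^sub>R v) \<le> t / 2" for x a
  proof -
    have "infdist x (span {v}) \<le> dist x (a *\<^sub>R v)"
      by (rule infdist_le) (auto simp: span_singleton)
    then show ?thesis using that by (intro power_mono) (auto simp: dist_norm infdist_nonneg)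
  qed
  \<comment> \<open>the line of the class itself is a competitor in the infimum\<close>
  have "(infdist x1 (span {v}))\<^sup>2 + (infdist x2 (span {v}))\<^sup>2 + (infdist x3 (span {v}))\<^sup>2
      \<le> (t / 2)\<^sup>2 + (t / 2)\<^sup>2 + (t / 2)\<^sup>2"
    using noise by (intro add_mono near)
  also have "\<dots> \<le> t\<^sup>2" using t by (simp add: power2_eq_square field_simps)
  finally have "sqrt ((infdist x1 (span {v}))\<^sup>2 + (infdist x2 (span {v}))\<^sup>2 + (infdist x3 (span {v}))\<^sup>2) \<le> t"
    using t by (simp add: real_le_lsqrt)
  then show ?thesis using sigma_TLS_le[OF is_line_span[OF v]] order_trans by blast
qed

text \<open>
  Two of three labels always agree, so a mixed triple consists of two positions on one line and one
  position on the other, in one of three arrangements. A residual of at most t and noise of at most t/2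
  place the noiseless points within 3 t of a common line, whence the constant 24 = 8 * 3.
\<close>

lemma misjudged_cover:
  fixes v :: "nat \<Rightarrow> plane"
  assumes t: "0 < t" and v: "norm (v 0) = 1" "norm (v 1) = 1" and d: "cross_det (v 0) (v 1) \<noteq> 0"
    and z: "z i < 2" "z j < 2" "z k < 2"
    and K: "\<bar>V i\<bar> \<le> K" "\<bar>V j\<bar> \<le> K" "\<bar>V k\<bar> \<le> K"
    and noise: "norm (x i - V i *\<^sub>R v (z i)) \<le> t / 2" "norm (x j - V j *\<^sub>R v (z j)) \<le> t / 2"
      "norm (x k - V k *\<^sub>R v (z k)) \<le> t / 2"
    and mis: "misjudged t z x i j k"
  defines "s \<equiv> 24 * K * t / \<bar>cross_det (v 0) (v 1)\<bar>"
  shows "\<bar>V i\<bar> * \<bar>V j - V k\<bar> \<le> s \<or> \<bar>V j\<bar> * \<bar>V i - V k\<bar> \<le> s \<or> \<bar>V k\<bar> * \<bar>V i - V j\<bar> \<le> s"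
proof -
  have z01: "z m = 0 \<or> z m = 1" if "z m < 2" for m using that by auto
  have unit: "norm (v (z m)) = 1" if "z m < 2" for m
    using that v z01 by metis
  have not_same: "\<not> (z i = z j \<and> z j = z k)"
  proof
    assume same: "z i = z j \<and> z j = z k"
    then have "sigma_TLS (x i) (x j) (x k) \<le> t"
      using noise by (intro small_noise_imp_class_triple_judged[OF t unit[OF z(1)]]) auto
    with same mis show False by (simp add: misjudged_def)
  qed
  with mis have "sigma_TLS (x i) (x j) (x k) < 2 * t"
    using t by (auto simp: misjudged_def)
  then obtain n h where n: "norm n = 1" and near: "\<bar>n \<bullet> x i - h\<bar> < 2 * t" "\<bar>n \<bullet> x j - h\<bar> < 2 * t"
      "\<bar>n \<bullet> x k - h\<bar> < 2 * t"
    by (rule sigma_TLS_lessE)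
  have near': "\<bar>n \<bullet> (V m *\<^sub>R v (z m)) - h\<bar> \<le> 3 * t"
    if "\<bar>n \<bullet> x m - h\<bar> < 2 * t" "norm (x m - V m *\<^sub>R v (z m)) \<le> t / 2" for m
  proof -
    have "\<bar>n \<bullet> (x m - V m *\<^sub>R v (z m))\<bar> \<le> norm n * norm (x m - V m *\<^sub>R v (z m))"
      by (rule Cauchy_Schwarz_ineq2)
    then have "\<bar>n \<bullet> x m - n \<bullet> (V m *\<^sub>R v (z m))\<bar> \<le> t / 2"
      using that n by (simp add: inner_diff_right)
    then show ?thesis using that(1) t by linarith
  qed
  have main: "\<bar>V c\<bar> * \<bar>V a - V b\<bar> \<le> s"
    if abc: "{a, b, c} = {i, j, k}" "z a = z b" "z b \<noteq> z c" for a b c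
  proof -
    have in_abc: "a \<in> {i, j, k}" "b \<in> {i, j, k}" "c \<in> {i, j, k}" using abc by auto
    have zm: "z m < 2" and Km: "\<bar>V m\<bar> \<le> K" and nm: "\<bar>n \<bullet> (V m *\<^sub>R v (z m)) - h\<bar> \<le> 3 * t"
      if "m \<in> {i, j, k}" for m
      using that z K near'[OF near(1) noise(1)] near'[OF near(2) noise(2)] near'[OF near(3) noise(3)]
      by auto
    have "\<bar>cross_det (v (z a)) (v (z c))\<bar> * (\<bar>V c\<bar> * \<bar>V a - V b\<bar>) \<le> 8 * K * (3 * t)"
      using in_abc abc(2) nm[of b]
      by (intro near_common_line_imp_product_small[where n = n and h = h] n unit zm Km nm) auto
    moreover have "\<bar>cross_det (v (z a)) (v (z c))\<bar> = \<bar>cross_det (v 0) (v 1)\<bar>"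
    proof -
      have "z a = 0 \<and> z c = 1 \<or> z a = 1 \<and> z c = 0"
        using z01[OF zm[OF in_abc(1)]] z01[OF zm[OF in_abc(3)]] abc by auto
      then show ?thesis by (auto simp: cross_det_def algebra_simps)
    qed
    ultimately show ?thesis
      unfolding s_def using d by (simp add: field_simps)
  qed
  have "z j = z k \<and> z k \<noteq> z i \<or> z i = z k \<and> z k \<noteq> z j \<or> z i = z j \<and> z j \<noteq> z k"
    using not_same z by arith
  moreover have "{j, k, i} = {i, j, k}" "{i, k, j} = {i, j, k}" by blast+
  ultimately show ?thesis
    using main[of j k i] main[of i k j] main[of i j k] by blast
qed

section \<open>A lower bound on the second eigenvalue\<close>

definition quad_form :: "nat \<Rightarrow> (nat \<Rightarrow> nat \<Rightarrow> real) \<Rightarrow> (nat \<Rightarrow> real) \<Rightarrow> real" where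
  "quad_form n a x = (\<Sum>i<n. \<Sum>j<n. a i j * x i * x j)"

lemma quad_form_scale: "quad_form n a (\<lambda>i. c * x i) = c\<^sup>2 * quad_form n a x"
  by (simp add: quad_form_def sum_distrib_left power2_eq_square mult_ac)

lemma quad_form_cong: "(\<And>i. i < n \<Longrightarrow> x i = y i) \<Longrightarrow> quad_form n a x = quad_form n a y"
  by (simp add: quad_form_def)

text \<open>
  Vectors of length n are functions on the naturals that vanish from n on; coordinatewise they stay
  in a compact interval, so the product topology supplies compactness without a type of dimension n.
\<close>

lemma compact_unit_sphere_orthogonal:
  fixes p :: "nat \<Rightarrow> real"
  shows "compact {x. (\<forall>i\<ge>n. x i = 0) \<and> (\<Sum>i<n. (x i)\<^sup>2) = 1 \<and> (\<Sum>i<n. x i * p i) = 0}"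
    (is "compact ?S")
proof -
  let ?B = "\<lambda>i. if i < n then {-1..1} else {0::real}"
  have "compactin (product_topology (\<lambda>i. euclidean) UNIV) (PiE UNIV ?B)"
    by (subst compactin_PiE) auto
  then have "compact (PiE UNIV ?B)"
    by (simp only: euclidean_product_topology compactin_euclidean_iff)
  moreover have "closed {x :: nat \<Rightarrow> real. (\<Sum>i<n. (x i)\<^sup>2) = 1}" "closed {x. (\<Sum>i<n. x i * p i) = 0}"
    by (intro closed_Collect_eq continuous_intros continuous_on_product_coordinates)+
  ultimately have "compact (PiE UNIV ?B \<inter> ({x. (\<Sum>i<n. (x i)\<^sup>2) = 1} \<inter> {x. (\<Sum>i<n. x i * p i) = 0}))"
    by (intro compact_Int_closed closed_Int)
  moreover have "?S = PiE UNIV ?B \<inter> ({x. (\<Sum>i<n. (x i)\<^sup>2) = 1} \<inter> {x. (\<Sum>i<n. x i * p i) = 0})"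
  proof (intro equalityI subsetI)
    fix x assume x: "x \<in> ?S"
    have "\<bar>x i\<bar> \<le> 1" if "i < n" for i
    proof -
      have "(x i)\<^sup>2 \<le> (\<Sum>i<n. (x i)\<^sup>2)"
        using that by (intro member_le_sum) auto
      then show ?thesis using x by (simp add: abs_square_le_1)
    qed
    then have "\<And>i. i < n \<Longrightarrow> -1 \<le> x i \<and> x i \<le> 1" by (auto simp: abs_le_iff)
    then show "x \<in> PiE UNIV ?B \<inter> ({x. (\<Sum>i<n. (x i)\<^sup>2) = 1} \<inter> {x. (\<Sum>i<n. x i * p i) = 0})"
      using x by auto
  next
    fix x assume "x \<in> PiE UNIV ?B \<inter> ({x. (\<Sum>i<n. (x i)\<^sup>2) = 1} \<inter> {x. (\<Sum>i<n. x i * p i) = 0})"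
    then have "x i \<in> ?B i" and "(\<Sum>i<n. (x i)\<^sup>2) = 1 \<and> (\<Sum>i<n. x i * p i) = 0" for i
      by (blast dest: PiE_mem)+
    moreover from this(1) have "x i = 0" if "i \<ge> n" for i
      using that by (metis not_le singletonD)
    ultimately show "x \<in> ?S" by simp
  qed
  ultimately show ?thesis by simp
qed

lemma quad_form_max_orthogonal:
  fixes p :: "nat \<Rightarrow> real"
  assumes f: "i0 < n" "f i0 \<noteq> 0" "(\<Sum>i<n. f i * p i) = 0"
  obtains w where "(\<Sum>i<n. (w i)\<^sup>2) = 1" and "(\<Sum>i<n. w i * p i) = 0"
    and "\<And>y. (\<Sum>i<n. y i * p i) = 0 \<Longrightarrow> quad_form n a y \<le> quad_form n a w * (\<Sum>i<n. (y i)\<^sup>2)"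
proof -
  let ?S = "{x. (\<forall>i\<ge>n. x i = 0) \<and> (\<Sum>i<n. (x i)\<^sup>2) = 1 \<and> (\<Sum>i<n. x i * p i) = 0}"
  define nrm where "nrm y = (\<lambda>i. if i < n then (1 / sqrt (\<Sum>i<n. (y i)\<^sup>2)) * y i else 0)" for y :: "nat \<Rightarrow> real"
  have nrm: "nrm y \<in> ?S" "quad_form n a y = (\<Sum>i<n. (y i)\<^sup>2) * quad_form n a (nrm y)"
    if "(\<Sum>i<n. y i * p i) = 0" "(\<Sum>i<n. (y i)\<^sup>2) > 0" for y
  proof -
    let ?N = "\<Sum>i<n. (y i)\<^sup>2"
    have "(\<Sum>i<n. (nrm y i)\<^sup>2) = (\<Sum>i<n. (y i)\<^sup>2 / ?N)"
      using that(2) by (intro sum.cong refl) (auto simp: nrm_def power_divide)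
    also have "\<dots> = 1" using that(2) by (simp add: sum_divide_distrib[symmetric])
    finally have 1: "(\<Sum>i<n. (nrm y i)\<^sup>2) = 1" .
    have "(\<Sum>i<n. nrm y i * p i) = (\<Sum>i<n. (1 / sqrt ?N) * (y i * p i))"
      by (intro sum.cong refl) (auto simp: nrm_def)
    also have "\<dots> = 0" using that(1) by (simp only: sum_distrib_left[symmetric] mult_zero_right)
    finally show "nrm y \<in> ?S" using 1 by (simp add: nrm_def)
    have "quad_form n a (nrm y) = quad_form n a (\<lambda>i. (1 / sqrt ?N) * y i)"
      by (rule quad_form_cong) (simp add: nrm_def)
    also have "\<dots> = (1 / sqrt ?N)\<^sup>2 * quad_form n a y" by (rule quad_form_scale)
    finally show "quad_form n a y = ?N * quad_form n a (nrm y)"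
      using that(2) by (simp add: power_divide)
  qed
  have "0 < (f i0)\<^sup>2" using f by simp
  also have "\<dots> \<le> (\<Sum>i<n. (f i)\<^sup>2)" using f by (intro member_le_sum) auto
  finally have "?S \<noteq> {}" using nrm(1)[OF f(3)] by blast
  moreover have "continuous_on ?S (quad_form n a)"
    unfolding quad_form_def
    by (intro continuous_intros continuous_on_subset[OF continuous_on_product_coordinates]) auto
  ultimately have "\<exists>w\<in>?S. \<forall>y\<in>?S. quad_form n a y \<le> quad_form n a w"
    by (rule continuous_attains_sup[OF compact_unit_sphere_orthogonal])
  then obtain w where w: "w \<in> ?S" and max: "\<forall>y\<in>?S. quad_form n a y \<le> quad_form n a w" ..
  have le: "quad_form n a y \<le> quad_form n a w * (\<Sum>i<n. (y i)\<^sup>2)" if y: "(\<Sum>i<n. y i * p i) = 0" for y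
  proof (cases "(\<Sum>i<n. (y i)\<^sup>2) = 0")
    case True
    then have "\<forall>i<n. y i = 0" by (subst (asm) sum_nonneg_eq_0_iff) auto
    then show ?thesis by (simp add: quad_form_def)
  next
    case False
    then have pos: "(\<Sum>i<n. (y i)\<^sup>2) > 0" by (simp add: sum_nonneg order.not_eq_order_implies_strict)
    show ?thesis
      unfolding nrm(2)[OF y pos] using bspec[OF max nrm(1)[OF y pos]] pos by (simp add: mult.commute)
  qed
  show thesis using w le by (intro that) auto
qed

text \<open>
  Maximising the quadratic form orthogonally to an eigenvector p yields another eigenvector. Symmetry
  keeps the image of w orthogonal to p, so the candidate error h = a w - \<mu> w is an admissible direction;
  stationarity in that direction says that its norm is 0.
\<close>

lemma constrained_max_is_eigenvector:
  fixes a :: "nat \<Rightarrow> nat \<Rightarrow> real"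
  assumes sym: "\<And>i j. i < n \<Longrightarrow> j < n \<Longrightarrow> a i j = a j i"
    and p: "\<And>i. i < n \<Longrightarrow> (\<Sum>j<n. a i j * p j) = e * p i"
    and w: "(\<Sum>i<n. (w i)\<^sup>2) = 1" "(\<Sum>i<n. w i * p i) = 0"
    and max: "\<And>y. (\<Sum>i<n. y i * p i) = 0 \<Longrightarrow> quad_form n a y \<le> quad_form n a w * (\<Sum>i<n. (y i)\<^sup>2)"
    and i: "i < n"
  shows "(\<Sum>j<n. a i j * w j) = quad_form n a w * w i"
proof -
  define \<mu> where "\<mu> = quad_form n a w"
  define h where "h i = (\<Sum>j<n. a i j * w j) - \<mu> * w i" for i
  define G where "G = (\<Sum>i<n. (h i)\<^sup>2)"
  have aw: "(\<Sum>j<n. a i j * w j) = h i + \<mu> * w i" for i by (simp add: h_def)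
  have bil: "(\<Sum>i<n. \<Sum>j<n. a i j * x i * y j) = (\<Sum>i<n. x i * (\<Sum>j<n. a i j * y j))" for x y
    by (simp add: sum_distrib_left mult_ac)
  have bil_sym: "(\<Sum>i<n. \<Sum>j<n. a i j * x i * y j) = (\<Sum>i<n. \<Sum>j<n. a i j * y i * x j)" for x y
  proof -
    have "(\<Sum>i<n. \<Sum>j<n. a i j * x i * y j) = (\<Sum>j<n. \<Sum>i<n. a i j * x i * y j)" by (rule sum.swap)
    also have "\<dots> = (\<Sum>i<n. \<Sum>j<n. a i j * y i * x j)"
      using sym by (intro sum.cong refl) (simp add: mult_ac)
    finally show ?thesis .
  qed
  have hp: "(\<Sum>i<n. h i * p i) = 0"
  proof -
    have "(\<Sum>i<n. p i * (\<Sum>j<n. a i j * w j)) = (\<Sum>i<n. w i * (\<Sum>j<n. a i j * p j))"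
      unfolding bil[symmetric] by (rule bil_sym)
    also have "\<dots> = (\<Sum>i<n. w i * (e * p i))" using p by simp
    also have "\<dots> = e * (\<Sum>i<n. w i * p i)" by (simp add: sum_distrib_left mult_ac)
    finally have "(\<Sum>i<n. p i * (\<Sum>j<n. a i j * w j)) = 0" using w by simp
    moreover have "(\<Sum>i<n. h i * p i) = (\<Sum>i<n. p i * (\<Sum>j<n. a i j * w j)) - \<mu> * (\<Sum>i<n. w i * p i)"
      by (simp add: h_def algebra_simps sum_subtractf sum_distrib_left)
    ultimately show ?thesis using w by simp
  qed
  have hw: "(\<Sum>i<n. h i * w i) = 0"
  proof -
    have "\<mu> = (\<Sum>i<n. w i * (\<Sum>j<n. a i j * w j))" unfolding \<mu>_def quad_form_def bil ..
    also have "\<dots> = (\<Sum>i<n. h i * w i + \<mu> * (w i)\<^sup>2)"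
      unfolding aw by (simp add: power2_eq_square algebra_simps)
    also have "\<dots> = (\<Sum>i<n. h i * w i) + \<mu> * (\<Sum>i<n. (w i)\<^sup>2)"
      by (simp add: sum.distrib sum_distrib_left)
    finally show ?thesis using w by simp
  qed
  have hG: "(\<Sum>i<n. \<Sum>j<n. a i j * h i * w j) = G"
  proof -
    have "(\<Sum>i<n. \<Sum>j<n. a i j * h i * w j) = (\<Sum>i<n. (h i)\<^sup>2 + \<mu> * (h i * w i))"
      unfolding bil aw by (simp add: power2_eq_square algebra_simps)
    also have "\<dots> = G + \<mu> * (\<Sum>i<n. h i * w i)"
      by (simp add: sum.distrib sum_distrib_left G_def)
    finally show ?thesis using hw by simp
  qed
  \<comment> \<open>first variation of the quadratic form at w in the direction h\<close>
  have var: "2 * s * G \<le> s\<^sup>2 * (\<mu> * G - quad_form n a h)" for s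
  proof -
    have "(\<Sum>i<n. (w i + s * h i) * p i) = (\<Sum>i<n. w i * p i) + s * (\<Sum>i<n. h i * p i)"
      by (simp add: algebra_simps sum.distrib sum_distrib_left)
    then have "quad_form n a (\<lambda>i. w i + s * h i) \<le> \<mu> * (\<Sum>i<n. (w i + s * h i)\<^sup>2)"
      unfolding \<mu>_def using w hp by (intro max) simp
    also have "(\<Sum>i<n. (w i + s * h i)\<^sup>2) = (\<Sum>i<n. (w i)\<^sup>2) + 2 * s * (\<Sum>i<n. h i * w i) + s\<^sup>2 * G"
      by (simp add: G_def power2_sum sum.distrib sum_distrib_left power_mult_distrib mult_ac)
    also have "quad_form n a (\<lambda>i. w i + s * h i) =
        (\<Sum>i<n. \<Sum>j<n. a i j * w i * w j) + s * (\<Sum>i<n. \<Sum>j<n. a i j * w i * h j)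
        + s * (\<Sum>i<n. \<Sum>j<n. a i j * h i * w j) + s\<^sup>2 * (\<Sum>i<n. \<Sum>j<n. a i j * h i * h j)"
      by (simp add: quad_form_def algebra_simps sum.distrib sum_distrib_left power2_eq_square)
    also have "(\<Sum>i<n. \<Sum>j<n. a i j * w i * h j) = G" using bil_sym hG by metis
    finally have "\<mu> + s * G + s * G + s\<^sup>2 * quad_form n a h \<le> \<mu> * (1 + s\<^sup>2 * G)"
      unfolding quad_form_def[symmetric] \<mu>_def[symmetric] hG hw w(1) by simp
    then show ?thesis by (simp add: algebra_simps)
  qed
  have "G = 0"
  proof (rule ccontr)
    assume "G \<noteq> 0"
    moreover have "G \<ge> 0" by (simp add: G_def sum_nonneg)
    ultimately have G: "G > 0" by simp
    define D where "D = \<mu> * G - quad_form n a h"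
    \<comment> \<open>a step so short that the linear gain dominates the quadratic loss\<close>
    define s where "s = G / (\<bar>D\<bar> + 1)"
    have s: "s > 0" using G by (simp add: s_def)
    have "s * (2 * G) \<le> s * (s * D)" using var[of s] by (simp add: D_def power2_eq_square mult_ac)
    then have "2 * G \<le> s * D" using s by simp
    also have "\<dots> \<le> s * (\<bar>D\<bar> + 1)" using s by (intro mult_left_mono) auto
    also have "\<dots> = G" by (simp add: s_def)
    finally show False using G by simp
  qed
  then have "h i = 0" using i by (auto simp: G_def sum_nonneg_eq_0_iff)
  then show ?thesis by (simp add: h_def \<mu>_def)
qed

text \<open>
  The triangular form lists the eigenvalues with multiplicity, which eigenvectors alone do not. Let W
  P = P B with B upper triangular and let p be the first column of P. If w is an eigenvector, then its
  coordinate vector y = w P is a left eigenvector of B, and its first nonzero entry sits at an index k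
  whose diagonal entry is the eigenvalue. Orthogonality to p makes the entry at 0 vanish, so that k is
  at least 1. This argument covers a repeated largest eigenvalue as well.
\<close>

lemma schur_first_vector:
  fixes W :: "real mat"
  assumes W: "W \<in> carrier_mat n n" and n: "n \<ge> 2"
    and sym: "\<And>i j. i < n \<Longrightarrow> j < n \<Longrightarrow> W $$ (i, j) = W $$ (j, i)"
    and cp: "char_poly W = (\<Prod>e\<leftarrow>es. [:- e, 1:])" and len: "length es = n"
    and sorted: "sorted_wrt (\<ge>) es"
  obtains p where "\<And>i. i < n \<Longrightarrow> (\<Sum>j<n. W $$ (i, j) * p j) = es ! 0 * p i"
    and "\<And>w \<mu> i0. \<lbrakk>i0 < n; w i0 \<noteq> 0; (\<Sum>i<n. w i * p i) = 0;
            \<And>i. i < n \<Longrightarrow> (\<Sum>j<n. W $$ (i, j) * w j) = \<mu> * w i\<rbrakk> \<Longrightarrow> \<mu> \<le> es ! 1"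
proof -
  obtain B P Q where dec: "schur_decomposition W es = (B, P, Q)" by (cases "schur_decomposition W es") auto
  from schur_decomposition[OF W cp dec]
  have sim: "similar_mat_wit W B P Q" and ut: "upper_triangular B" and diag: "diag_mat B = es" by auto
  note D = similar_mat_witD2[OF W sim]
  have PQ: "P * Q = 1\<^sub>m n" and WPBQ: "W = P * B * Q" and QP: "Q * P = 1\<^sub>m n"
    and B: "B \<in> carrier_mat n n" and P: "P \<in> carrier_mat n n" and Q: "Q \<in> carrier_mat n n"
    using D by auto
  have "W * P = P * B * (Q * P)" unfolding WPBQ using B P Q by (simp add: assoc_mult_mat[of _ n n _ n _ n])
  then have WP: "W * P = P * B" unfolding QP using P B by simp
  have Bdiag: "B $$ (k, k) = es ! k" if "k < n" for k
    using that B diag[symmetric] by (simp add: diag_mat_def)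
  have WP_entry: "(\<Sum>j<n. W $$ (i, j) * P $$ (j, k)) = (\<Sum>m<n. P $$ (i, m) * B $$ (m, k))"
    if "i < n" "k < n" for i k
  proof -
    have "(W * P) $$ (i, k) = (P * B) $$ (i, k)" by (simp add: WP)
    then show ?thesis using that W P B
      by (simp add: scalar_prod_def lessThan_atLeast0)
  qed
  have PQ_entry: "(\<Sum>k<n. P $$ (i, k) * Q $$ (k, j)) = (if i = j then 1 else 0)" if "i < n" "j < n" for i j
  proof -
    have "(P * Q) $$ (i, j) = 1\<^sub>m n $$ (i, j)" by (simp add: PQ)
    then show ?thesis using that P Q
      by (simp add: scalar_prod_def lessThan_atLeast0)
  qed
  have Btri: "B $$ (m, k) = 0" if "k < m" "m < n" for m k
    using ut B that by (auto simp: upper_triangular_def)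
  define p where "p = (\<lambda>j. P $$ (j, 0))"
  show thesis
  proof (rule that)
    fix i assume i: "i < n"
    have "(\<Sum>j<n. W $$ (i, j) * p j) = (\<Sum>m<n. P $$ (i, m) * B $$ (m, 0))"
      using WP_entry[OF i, of 0] n by (simp add: p_def)
    also have "\<dots> = (\<Sum>m\<in>{0}. P $$ (i, m) * B $$ (m, 0))"
      using n Btri by (intro sum.mono_neutral_right) auto
    also have "\<dots> = es ! 0 * p i" using n by (simp add: p_def Bdiag)
    finally show "(\<Sum>j<n. W $$ (i, j) * p j) = es ! 0 * p i" .
  next
    fix w \<mu> i0
    assume i0: "i0 < n" "w i0 \<noteq> 0" and orth: "(\<Sum>i<n. w i * p i) = 0"
      and ev: "\<And>i. i < n \<Longrightarrow> (\<Sum>j<n. W $$ (i, j) * w j) = \<mu> * w i"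
    define y where "y k = (\<Sum>i<n. w i * P $$ (i, k))" for k
    have yB: "\<mu> * y k = (\<Sum>m<n. y m * B $$ (m, k))" if k: "k < n" for k
    proof -
      have "\<mu> * y k = (\<Sum>i<n. (\<Sum>j<n. W $$ (i, j) * w j) * P $$ (i, k))"
        using ev by (simp add: y_def sum_distrib_left mult_ac)
      also have "\<dots> = (\<Sum>i<n. \<Sum>j<n. w j * (W $$ (i, j) * P $$ (i, k)))"
        by (simp add: sum_distrib_left sum_distrib_right mult_ac)
      also have "\<dots> = (\<Sum>j<n. \<Sum>i<n. w j * (W $$ (i, j) * P $$ (i, k)))" by (rule sum.swap)
      also have "\<dots> = (\<Sum>j<n. w j * (\<Sum>i<n. W $$ (j, i) * P $$ (i, k)))"
        using sym by (simp add: sum_distrib_left)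
      also have "\<dots> = (\<Sum>j<n. w j * (\<Sum>m<n. P $$ (j, m) * B $$ (m, k)))"
        using WP_entry k by simp
      also have "\<dots> = (\<Sum>j<n. \<Sum>m<n. w j * P $$ (j, m) * B $$ (m, k))"
        by (simp add: sum_distrib_left mult_ac)
      also have "\<dots> = (\<Sum>m<n. \<Sum>j<n. w j * P $$ (j, m) * B $$ (m, k))" by (rule sum.swap)
      also have "\<dots> = (\<Sum>m<n. y m * B $$ (m, k))"
        by (simp add: y_def sum_distrib_right)
      finally show ?thesis .
    qed
    have "\<exists>k<n. y k \<noteq> 0"
    proof (rule ccontr)
      assume "\<not> ?thesis"
      then have y0: "y k = 0" if "k < n" for k using that by auto
      have "w i0 = (\<Sum>i<n. w i * (if i = i0 then 1 else 0))"
        using i0 by (simp add: if_distrib cong: if_cong)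
      also have "\<dots> = (\<Sum>i<n. w i * (\<Sum>k<n. P $$ (i, k) * Q $$ (k, i0)))"
        using PQ_entry i0 by simp
      also have "\<dots> = (\<Sum>i<n. \<Sum>k<n. w i * P $$ (i, k) * Q $$ (k, i0))"
        by (simp add: sum_distrib_left mult_ac)
      also have "\<dots> = (\<Sum>k<n. \<Sum>i<n. w i * P $$ (i, k) * Q $$ (k, i0))" by (rule sum.swap)
      also have "\<dots> = (\<Sum>k<n. y k * Q $$ (k, i0))"
        by (simp add: y_def sum_distrib_right)
      also have "\<dots> = 0" using y0 by simp
      finally show False using i0 by simp
    qed
    then obtain k where k: "k < n" "y k \<noteq> 0" and least: "\<And>m. m < k \<Longrightarrow> y m = 0"
      using exists_least_iff[of "\<lambda>k. k < n \<and> y k \<noteq> 0"] by auto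
    have "\<mu> * y k = (\<Sum>m\<in>{k}. y m * B $$ (m, k))"
      unfolding yB[OF k(1)]
    proof (intro sum.mono_neutral_right ballI)
      fix m assume "m \<in> {..<n} - {k}"
      then show "y m * B $$ (m, k) = 0" using least[of m] Btri[of k m] by (cases "m < k") auto
    qed (use k in auto)
    then have \<mu>: "\<mu> = es ! k" using k Bdiag by simp
    have "y 0 = 0" using orth by (simp add: y_def p_def)
    then have "k \<ge> 1" using k by (cases k) auto
    then show "\<mu> \<le> es ! 1"
      unfolding \<mu> using sorted_wrt_nth_less[OF sorted, of 1 k] k len by (cases "k = 1") auto
  qed
qed

text \<open>
  One half of the Courant-Fischer principle: a plane spanned by f and g contains a nonzero vector
  orthogonal to the first Schur vector, so the maximum of the quadratic form on the orthogonal
  complement is at least \<mu>, and that maximum is one of the later eigenvalues.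
\<close>

lemma second_eigenvalue_ge:
  fixes W :: "real mat"
  assumes W: "W \<in> carrier_mat n n" and n: "n \<ge> 2"
    and sym: "\<And>i j. i < n \<Longrightarrow> j < n \<Longrightarrow> W $$ (i, j) = W $$ (j, i)"
    and cp: "char_poly W = (\<Prod>e\<leftarrow>es. [:- e, 1:])" and len: "length es = n"
    and sorted: "sorted_wrt (\<ge>) es"
    and indep: "\<And>a b. (\<And>i. i < n \<Longrightarrow> a * f i + b * g i = 0) \<Longrightarrow> a = 0 \<and> b = 0"
    and ge: "\<And>a b. \<mu> * (\<Sum>i<n. (a * f i + b * g i)\<^sup>2)
               \<le> quad_form n (\<lambda>i j. W $$ (i, j)) (\<lambda>i. a * f i + b * g i)"
  shows "\<mu> \<le> es ! 1"
proof -
  obtain p where p: "\<And>i. i < n \<Longrightarrow> (\<Sum>j<n. W $$ (i, j) * p j) = es ! 0 * p i"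
    and bound: "\<And>w \<mu> i0. \<lbrakk>i0 < n; w i0 \<noteq> 0; (\<Sum>i<n. w i * p i) = 0;
            \<And>i. i < n \<Longrightarrow> (\<Sum>j<n. W $$ (i, j) * w j) = \<mu> * w i\<rbrakk> \<Longrightarrow> \<mu> \<le> es ! 1"
    using schur_first_vector[OF W n sym cp len sorted] by blast
  define A B where "A = (\<Sum>i<n. f i * p i)" and "B = (\<Sum>i<n. g i * p i)"
  obtain a b where ab: "\<not> (a = 0 \<and> b = 0)" "a * A + b * B = 0"
  proof (cases "A = 0 \<and> B = 0")
    case True then show thesis using that[of 1 0] by auto
  next
    case False then show thesis using that[of "- B" A] by auto
  qed
  define x where "x i = a * f i + b * g i" for i
  have "(\<Sum>i<n. x i * p i) = a * A + b * B"
    by (simp add: x_def A_def B_def algebra_simps sum.distrib sum_distrib_left)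
  then have xp: "(\<Sum>i<n. x i * p i) = 0" using ab by simp
  obtain i0 where i0: "i0 < n" "x i0 \<noteq> 0" using indep[of a b] ab(1) by (auto simp: x_def)
  have "0 < (x i0)\<^sup>2" using i0 by simp
  also have "\<dots> \<le> (\<Sum>i<n. (x i)\<^sup>2)" using i0 by (intro member_le_sum) auto
  finally have xpos: "0 < (\<Sum>i<n. (x i)\<^sup>2)" .
  let ?q = "quad_form n (\<lambda>i j. W $$ (i, j))"
  obtain w where w: "(\<Sum>i<n. (w i)\<^sup>2) = 1" "(\<Sum>i<n. w i * p i) = 0"
    and max: "\<And>y. (\<Sum>i<n. y i * p i) = 0 \<Longrightarrow> ?q y \<le> ?q w * (\<Sum>i<n. (y i)\<^sup>2)"
    using quad_form_max_orthogonal[of i0 n x p "\<lambda>i j. W $$ (i, j)"] i0 xp by blast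
  have ev: "(\<Sum>j<n. W $$ (i, j) * w j) = ?q w * w i" if "i < n" for i
    using constrained_max_is_eigenvector[of n "\<lambda>i j. W $$ (i, j)" p "es ! 0" w i] sym p w max that by simp
  have "\<exists>i<n. w i \<noteq> 0"
  proof (rule ccontr)
    assume "\<not> ?thesis"
    then have "(\<Sum>i<n. (w i)\<^sup>2) = 0" by (intro sum.neutral) auto
    then show False using w(1) by simp
  qed
  then obtain i1 where i1: "i1 < n" "w i1 \<noteq> 0" by blast
  have "?q w \<le> es ! 1" by (rule bound[OF i1 w(2) ev])
  moreover have "\<mu> * (\<Sum>i<n. (x i)\<^sup>2) \<le> ?q w * (\<Sum>i<n. (x i)\<^sup>2)"
    using ge[of a b] max[OF xp] by (simp add: x_def)
  then have "\<mu> \<le> ?q w" using xpos by simp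
  ultimately show ?thesis by simp
qed

section \<open>Perturbation of the two-block weight matrix\<close>

definition label_class :: "nat \<Rightarrow> (nat \<Rightarrow> nat) \<Rightarrow> nat \<Rightarrow> nat set" where
  "label_class n z k = {i. i < n \<and> z i = k}"

abbreviation class_size :: "nat \<Rightarrow> (nat \<Rightarrow> nat) \<Rightarrow> nat \<Rightarrow> real" where
  "class_size n z k \<equiv> real (card (label_class n z k))"

definition class_avg :: "nat \<Rightarrow> (nat \<Rightarrow> nat) \<Rightarrow> (nat \<Rightarrow> real) \<Rightarrow> nat \<Rightarrow> real" where
  "class_avg n z u k = (\<Sum>i\<in>label_class n z k. u i) / class_size n z k"

definition resid :: "nat \<Rightarrow> (nat \<Rightarrow> nat) \<Rightarrow> (nat \<Rightarrow> real) \<Rightarrow> nat \<Rightarrow> real" where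
  "resid n z u i = u i - class_avg n z u (z i)"

text \<open>
  The weight matrix of a hypergraph whose hyperedges are exactly the triples within a class. The
  diagonal is kept at 0 as for true weights: filling it in would create a difference of Frobenius norm
  of order N^(3/2), which is as large as the error that exact recovery can tolerate.
\<close>

definition ideal_weight :: "nat \<Rightarrow> (nat \<Rightarrow> nat) \<Rightarrow> nat \<Rightarrow> nat \<Rightarrow> real" where
  "ideal_weight n z i j = (if i \<noteq> j \<and> z i = z j then class_size n z (z i) - 2 else 0)"

lemma finite_label_class [simp]: "finite (label_class n z k)"
  by (simp add: label_class_def)

lemma sum_by_class:
  fixes f :: "nat \<Rightarrow> real"
  assumes "\<And>i. i < n \<Longrightarrow> z i < 2"
  shows "(\<Sum>i<n. f i) = (\<Sum>i\<in>label_class n z 0. f i) + (\<Sum>i\<in>label_class n z 1. f i)"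
proof -
  have "{..<n} = label_class n z 0 \<union> label_class n z 1" "label_class n z 0 \<inter> label_class n z 1 = {}"
    using assms by (fastforce simp: label_class_def)+
  then show ?thesis by (simp add: sum.union_disjoint)
qed

lemma class_size_sum:
  assumes "\<And>i. i < n \<Longrightarrow> z i < 2"
  shows "class_size n z 0 + class_size n z 1 = real n"
  using sum_by_class[OF assms, where f = "\<lambda>_. 1"] by simp

lemma sum_class_const: "(\<Sum>i\<in>label_class n z k. g (z i)) = class_size n z k * (g k :: real)"
  by (subst sum.cong[where h = "\<lambda>_. g k" and B = "label_class n z k"]) (auto simp: label_class_def)

lemma sum_class_eq_avg: "class_size n z k \<noteq> 0 \<Longrightarrow> (\<Sum>i\<in>label_class n z k. u i) = class_size n z k * class_avg n z u k"
  by (simp add: class_avg_def)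

lemma ideal_weight_apply:
  assumes i: "i < n" and pos: "class_size n z (z i) \<noteq> 0"
  shows "(\<Sum>j<n. ideal_weight n z i j * u j)
    = (class_size n z (z i) - 2) * (class_size n z (z i) * class_avg n z u (z i) - u i)"
proof -
  let ?C = "label_class n z (z i)"
  have "(\<Sum>j<n. ideal_weight n z i j * u j) = (\<Sum>j\<in>?C - {i}. ideal_weight n z i j * u j)"
    by (rule sum.mono_neutral_right) (auto simp: ideal_weight_def label_class_def)
  also have "\<dots> = (\<Sum>j\<in>?C - {i}. (class_size n z (z i) - 2) * u j)"
    by (rule sum.cong) (auto simp: ideal_weight_def label_class_def)
  also have "\<dots> = (class_size n z (z i) - 2) * (\<Sum>j\<in>?C - {i}. u j)" by (simp add: sum_distrib_left)
  also have "(\<Sum>j\<in>?C - {i}. u j) = (\<Sum>j\<in>?C. u j) - u i"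
    using i by (subst sum_diff1) (auto simp: label_class_def)
  finally show ?thesis by (simp add: sum_class_eq_avg[OF pos])
qed

lemma sum_resid_class:
  assumes "class_size n z k \<noteq> 0"
  shows "(\<Sum>i\<in>label_class n z k. resid n z u i) = 0"
proof -
  have "(\<Sum>i\<in>label_class n z k. resid n z u i) = (\<Sum>i\<in>label_class n z k. u i) - (\<Sum>i\<in>label_class n z k. class_avg n z u (z i))"
    by (simp add: resid_def sum_subtractf)
  then show ?thesis by (simp only: sum_class_const sum_class_eq_avg[OF assms])
qed

lemma sum_resid_times_class_const:
  assumes z: "\<And>i. i < n \<Longrightarrow> z i < 2" and ne: "class_size n z 0 \<noteq> 0" "class_size n z 1 \<noteq> 0"
  shows "(\<Sum>i<n. resid n z u i * g (z i)) = 0"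
proof -
  have "(\<Sum>i\<in>label_class n z k. resid n z u i * g (z i)) = (\<Sum>i\<in>label_class n z k. resid n z u i) * g k" for k
    by (simp add: sum_distrib_right label_class_def)
  then show ?thesis
    using sum_resid_class[OF ne(1)] sum_resid_class[OF ne(2)] by (simp add: sum_by_class[OF z])
qed

lemma sum_sq_decomp:
  assumes z: "\<And>i. i < n \<Longrightarrow> z i < 2" and ne: "class_size n z 0 \<noteq> 0" "class_size n z 1 \<noteq> 0"
  shows "(\<Sum>i<n. (u i)\<^sup>2) = (\<Sum>i<n. (resid n z u i)\<^sup>2)
     + class_size n z 0 * (class_avg n z u 0)\<^sup>2 + class_size n z 1 * (class_avg n z u 1)\<^sup>2"
proof -
  have "(\<Sum>i<n. (u i)\<^sup>2) = (\<Sum>i<n. (resid n z u i)\<^sup>2 + 2 * (resid n z u i * class_avg n z u (z i))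
      + (class_avg n z u (z i))\<^sup>2)"
    by (rule sum.cong) (auto simp: resid_def power2_eq_square algebra_simps)
  also have "\<dots> = (\<Sum>i<n. (resid n z u i)\<^sup>2) + 2 * (\<Sum>i<n. resid n z u i * class_avg n z u (z i))
      + (\<Sum>i<n. (class_avg n z u (z i))\<^sup>2)"
    by (simp add: sum.distrib sum_distrib_left)
  also have "(\<Sum>i<n. (class_avg n z u (z i))\<^sup>2)
      = class_size n z 0 * (class_avg n z u 0)\<^sup>2 + class_size n z 1 * (class_avg n z u 1)\<^sup>2"
    by (simp only: sum_by_class[OF z] sum_class_const[where g = "\<lambda>k. (class_avg n z u k)\<^sup>2"])
  finally show ?thesis by (simp add: sum_resid_times_class_const[OF z ne])
qed

text \<open>
  The Cauchy-Schwarz inequality over pairs of indices: the Frobenius norm dominates the operator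
  norm.
\<close>

lemma perturbation_bilinear_bound:
  "(\<Sum>i<n. \<Sum>j<n. e i j * x i * y j)\<^sup>2 \<le> (\<Sum>i<n. \<Sum>j<n. (e i j)\<^sup>2) * ((\<Sum>i<n. (x i)\<^sup>2) * (\<Sum>j<n. (y j)\<^sup>2))"
  for e :: "nat \<Rightarrow> nat \<Rightarrow> real"
proof -
  let ?I = "{..<n} \<times> {..<n}"
  have "(\<Sum>(i, j)\<in>?I. e i j * (x i * y j))\<^sup>2
      \<le> (\<Sum>(i, j)\<in>?I. (e i j)\<^sup>2) * (\<Sum>(i, j)\<in>?I. (x i * y j)\<^sup>2)"
    using Cauchy_Schwarz_ineq_sum[of "\<lambda>(i, j). e i j" "\<lambda>(i, j). x i * y j" ?I]
    by (simp add: case_prod_unfold)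
  then show ?thesis
    by (simp add: sum.cartesian_product[symmetric] power_mult_distrib sum_product mult.assoc)
qed

lemma perturbation_apply_bound:
  "(\<Sum>i<n. (\<Sum>j<n. e i j * u j)\<^sup>2) \<le> (\<Sum>i<n. \<Sum>j<n. (e i j)\<^sup>2) * (\<Sum>j<n. (u j)\<^sup>2)"
  for e :: "nat \<Rightarrow> nat \<Rightarrow> real"
  by (simp only: sum_distrib_right) (intro sum_mono, simp only: sum_distrib_right[symmetric],
      rule Cauchy_Schwarz_ineq_sum)

text \<open>
  On vectors that are constant on the classes the two-block matrix acts on class k as multiplication
  by (n - 1) (n - 2), where n is the size of the class.
\<close>

lemma quad_form_ideal_perturbed_ge:
  assumes z: "\<And>i. i < n \<Longrightarrow> z i < 2" and s: "\<And>k. k < 2 \<Longrightarrow> s \<le> class_size n z k" and s2: "s \<ge> 2"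
    and w: "\<And>i j. i < n \<Longrightarrow> j < n \<Longrightarrow> w i j = ideal_weight n z i j + e i j"
    and f: "\<And>i. f i = g (z i)"
  shows "((s - 1) * (s - 2) - sqrt (\<Sum>i<n. \<Sum>j<n. (e i j)\<^sup>2)) * (\<Sum>i<n. (f i)\<^sup>2) \<le> quad_form n w f"
proof -
  let ?F = "\<Sum>i<n. \<Sum>j<n. (e i j)\<^sup>2" and ?S = "\<Sum>i<n. (f i)\<^sup>2"
  have ne: "class_size n z k \<noteq> 0" if "k < 2" for k using s[OF that] s2 by auto
  have "quad_form n w f = (\<Sum>i<n. \<Sum>j<n. ideal_weight n z i j * f i * f j + e i j * f i * f j)"
    unfolding quad_form_def using w by (simp add: algebra_simps)
  also have "\<dots> = (\<Sum>i<n. f i * (\<Sum>j<n. ideal_weight n z i j * f j)) + (\<Sum>i<n. \<Sum>j<n. e i j * f i * f j)"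
    by (simp add: sum.distrib sum_distrib_left mult_ac)
  finally have q: "quad_form n w f = (\<Sum>i<n. f i * (\<Sum>j<n. ideal_weight n z i j * f j))
      + (\<Sum>i<n. \<Sum>j<n. e i j * f i * f j)" .
  have "(s - 1) * (s - 2) * ?S = (\<Sum>i<n. (s - 1) * (s - 2) * (f i)\<^sup>2)" by (simp add: sum_distrib_left)
  also have "\<dots> \<le> (\<Sum>i<n. f i * (\<Sum>j<n. ideal_weight n z i j * f j))"
  proof (rule sum_mono)
    fix i assume "i \<in> {..<n}"
    then have i: "i < n" by simp
    let ?c = "class_size n z (z i)"
    have c: "s \<le> ?c" using s z i by blast
    have avg: "class_avg n z f (z i) = f i"
      using ne[OF z[OF i]] by (simp add: class_avg_def f sum_class_const)
    have "(s - 1) * (s - 2) * (f i)\<^sup>2 \<le> (?c - 1) * (?c - 2) * (f i)\<^sup>2"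
      using c s2 by (intro mult_right_mono mult_mono) auto
    also have "\<dots> = f i * (\<Sum>j<n. ideal_weight n z i j * f j)"
      unfolding ideal_weight_apply[OF i ne[OF z[OF i]], of f] avg
      by (simp add: power2_eq_square algebra_simps)
    finally show "(s - 1) * (s - 2) * (f i)\<^sup>2 \<le> f i * (\<Sum>j<n. ideal_weight n z i j * f j)" .
  qed
  finally have 1: "(s - 1) * (s - 2) * ?S \<le> (\<Sum>i<n. f i * (\<Sum>j<n. ideal_weight n z i j * f j))" .
  have "(\<Sum>i<n. \<Sum>j<n. e i j * f i * f j)\<^sup>2 \<le> ?F * (?S * ?S)" by (rule perturbation_bilinear_bound)
  also have "\<dots> = (sqrt ?F * ?S)\<^sup>2" by (simp add: power2_eq_square sum_nonneg)
  finally have "\<bar>\<Sum>i<n. \<Sum>j<n. e i j * f i * f j\<bar> \<le> \<bar>sqrt ?F * ?S\<bar>"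
    by (simp add: abs_le_square_iff)
  also have "\<bar>sqrt ?F * ?S\<bar> = sqrt ?F * ?S" by (simp add: sum_nonneg)
  finally have "- (sqrt ?F * ?S) \<le> (\<Sum>i<n. \<Sum>j<n. e i j * f i * f j)" by linarith
  with 1 show ?thesis unfolding q by (simp add: algebra_simps)
qed

text \<open>
  A substitute for the Davis-Kahan theorem. On the residual, which has mean 0 in each class, the
  two-block matrix acts as a nonpositive multiple of the identity on each class. Testing the eigenvalue
  equation against the residual r therefore leaves \<mu> |r|^2 \<le> r . (e u), and Cauchy-Schwarz bounds the
  right-hand side by |r| times the Frobenius norm of e.
\<close>

lemma eigenvector_resid_bound:
  assumes z: "\<And>i. i < n \<Longrightarrow> z i < 2" and s: "\<And>k. k < 2 \<Longrightarrow> 2 \<le> class_size n z k"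
    and w: "\<And>i j. i < n \<Longrightarrow> j < n \<Longrightarrow> w i j = ideal_weight n z i j + e i j"
    and eig: "\<And>i. i < n \<Longrightarrow> (\<Sum>j<n. w i j * u j) = \<mu> * u i" and \<mu>: "\<mu> > 0"
    and u: "(\<Sum>i<n. (u i)\<^sup>2) = 1"
  shows "\<mu>\<^sup>2 * (\<Sum>i<n. (resid n z u i)\<^sup>2) \<le> (\<Sum>i<n. \<Sum>j<n. (e i j)\<^sup>2)"
proof -
  have ne: "class_size n z k \<noteq> 0" if "k < 2" for k using s[OF that] by auto
  let ?r = "resid n z u" and ?h = "\<lambda>i. \<Sum>j<n. e i j * u j"
  define R where "R = (\<Sum>i<n. (?r i)\<^sup>2)"
  have R0: "R \<ge> 0" by (simp add: R_def sum_nonneg)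
  have pt: "?r i * ?h i = (\<mu> + class_size n z (z i) - 2) * (?r i)\<^sup>2
      + ?r i * ((\<mu> - (class_size n z (z i) - 2) * (class_size n z (z i) - 1)) * class_avg n z u (z i))" if i: "i < n" for i
  proof -
    have "\<mu> * u i = (\<Sum>j<n. ideal_weight n z i j * u j + e i j * u j)"
      using w i by (simp add: eig[OF i, symmetric] distrib_right)
    also have "\<dots> = (\<Sum>j<n. ideal_weight n z i j * u j) + ?h i" by (simp add: sum.distrib)
    finally have "?h i = \<mu> * u i - (class_size n z (z i) - 2) * (class_size n z (z i) * class_avg n z u (z i) - u i)"
      using ideal_weight_apply[OF i ne[OF z[OF i]], of u] by simp
    moreover have "u i = ?r i + class_avg n z u (z i)" by (simp add: resid_def)
    ultimately have "?h i = \<mu> * (?r i + class_avg n z u (z i))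
        - (class_size n z (z i) - 2) * (class_size n z (z i) * class_avg n z u (z i) - (?r i + class_avg n z u (z i)))"
      by (rule subst[where P = "\<lambda>x. ?h i = \<mu> * x - (class_size n z (z i) - 2) * (class_size n z (z i) * class_avg n z u (z i) - x)", rotated])
    then show ?thesis by (simp only:) (simp add: algebra_simps power2_eq_square)
  qed
  have "\<mu> * R = (\<Sum>i<n. \<mu> * (?r i)\<^sup>2)" by (simp add: R_def sum_distrib_left)
  also have "\<dots> \<le> (\<Sum>i<n. (\<mu> + class_size n z (z i) - 2) * (?r i)\<^sup>2)"
    using s z by (intro sum_mono mult_right_mono) auto
  also have "\<dots> = (\<Sum>i<n. ?r i * ?h i)"
  proof -
    have "(\<Sum>i<n. ?r i * ((\<mu> - (class_size n z (z i) - 2) * (class_size n z (z i) - 1)) * class_avg n z u (z i))) = 0"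
      by (rule sum_resid_times_class_const[OF z ne[of 0] ne[of 1],
            where g = "\<lambda>k. (\<mu> - (class_size n z k - 2) * (class_size n z k - 1)) * class_avg n z u k"]) auto
    then show ?thesis using pt by (simp add: sum.distrib)
  qed
  finally have "\<mu> * R \<le> (\<Sum>i<n. ?r i * ?h i)" .
  then have "(\<mu> * R)\<^sup>2 \<le> (\<Sum>i<n. ?r i * ?h i)\<^sup>2"
    using \<mu> R0 by (intro power_mono) auto
  also have "\<dots> \<le> R * (\<Sum>i<n. (?h i)\<^sup>2)" unfolding R_def by (rule Cauchy_Schwarz_ineq_sum)
  also have "\<dots> \<le> R * ((\<Sum>i<n. \<Sum>j<n. (e i j)\<^sup>2) * (\<Sum>j<n. (u j)\<^sup>2))"
    using R0 by (intro mult_left_mono perturbation_apply_bound)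
  finally have "R * (\<mu>\<^sup>2 * R) \<le> R * (\<Sum>i<n. \<Sum>j<n. (e i j)\<^sup>2)"
    by (simp only: u power_mult_distrib) (simp add: power2_eq_square mult_ac)
  then show ?thesis
    using R0 by (cases "R = 0") (auto simp: R_def[symmetric] sum_nonneg)
qed

section \<open>Separated centres and approximate 2-means\<close>

text \<open>
  Bessel's inequality for the all-ones vector.
\<close>

lemma bessel_ones:
  fixes u0 u1 :: "nat \<Rightarrow> real"
  assumes "(\<Sum>i<n. (u0 i)\<^sup>2) = 1" "(\<Sum>i<n. (u1 i)\<^sup>2) = 1" "(\<Sum>i<n. u0 i * u1 i) = 0"
  shows "(\<Sum>i<n. u0 i)\<^sup>2 + (\<Sum>i<n. u1 i)\<^sup>2 \<le> n"
proof -
  define a b where "a = (\<Sum>i<n. u0 i)" and "b = (\<Sum>i<n. u1 i)"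
  have "0 \<le> (\<Sum>i<n. (1 - a * u0 i - b * u1 i)\<^sup>2)" by (simp add: sum_nonneg)
  also have "\<dots> = (\<Sum>i<n. 1 - 2 * a * u0 i - 2 * b * u1 i + a\<^sup>2 * (u0 i)\<^sup>2 + b\<^sup>2 * (u1 i)\<^sup>2
      + 2 * a * b * (u0 i * u1 i))"
    by (rule sum.cong) (auto simp: power2_eq_square algebra_simps)
  also have "\<dots> = n - 2 * a * a - 2 * b * b + a\<^sup>2 + b\<^sup>2"
    using assms by (simp add: sum.distrib sum_subtractf a_def b_def flip: sum_distrib_left)
  finally show ?thesis by (simp add: a_def b_def power2_eq_square)
qed

text \<open>
  The vectors constant on the classes have an orthogonal basis consisting of the all-ones vector and of
  the vector with entries 1/a on the first class and -1/b on the second, where a and b are the class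
  sizes. Two unit vectors have total squared norm 2; at most 1 of it lies along the ones by Bessel and at
  most 1/2 in the residuals, so at least 1/2 remains for the second basis vector, whose inner products
  with the columns are the coordinates of the difference of the centres.
\<close>

lemma centers_separated:
  assumes z: "\<And>i. i < n \<Longrightarrow> z i < 2" and ne: "class_size n z 0 \<noteq> 0" "class_size n z 1 \<noteq> 0"
    and u: "(\<Sum>i<n. (u 0 i)\<^sup>2) = 1" "(\<Sum>i<n. (u 1 i)\<^sup>2) = 1" "(\<Sum>i<n. u 0 i * u (1::nat) i) = 0"
    and \<delta>: "(\<Sum>c<2. \<Sum>i<n. (resid n z (u c) i)\<^sup>2) \<le> 1 / 2"
  shows "2 / n \<le> (\<Sum>c<2. (class_avg n z (u c) 0 - class_avg n z (u c) 1)\<^sup>2)"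
proof -
  let ?a = "class_size n z 0" and ?b = "class_size n z 1"
  let ?m = "\<lambda>c. class_avg n z (u c)"
  have ab: "?a + ?b = real n" by (rule class_size_sum[OF z])
  have pos: "?a > 0" "?b > 0" using ne by auto
  have two: "(\<Sum>c<2. f c) = f 0 + f 1" for f :: "nat \<Rightarrow> real"
    by (simp add: numeral_2_eq_2)
  define r where "r c = (\<Sum>i<n. (resid n z (u c) i)\<^sup>2)" for c
  have dec: "real n * (\<Sum>i<n. (u c i)\<^sup>2)
      = real n * r c + (\<Sum>i<n. u c i)\<^sup>2 + ?a * ?b * (?m c 0 - ?m c 1)\<^sup>2" for c
  proof -
    have "(\<Sum>i<n. u c i) = ?a * ?m c 0 + ?b * ?m c 1"
      by (simp only: sum_by_class[OF z] sum_class_eq_avg[OF ne(1)] sum_class_eq_avg[OF ne(2)])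
    moreover have "(\<Sum>i<n. (u c i)\<^sup>2) = r c + ?a * (?m c 0)\<^sup>2 + ?b * (?m c 1)\<^sup>2"
      unfolding r_def by (rule sum_sq_decomp[OF z ne])
    ultimately show ?thesis
      unfolding ab[symmetric] by (simp only:) (simp add: power2_eq_square algebra_simps)
  qed
  let ?D = "\<Sum>c<2. (?m c 0 - ?m c 1)\<^sup>2"
  have "2 * real n = real n * (r 0 + r 1) + ((\<Sum>i<n. u 0 i)\<^sup>2 + (\<Sum>i<n. u 1 i)\<^sup>2) + ?a * ?b * ?D"
    using dec[of 0] dec[of 1] u by (simp add: two algebra_simps)
  moreover have "real n * (r 0 + r 1) \<le> real n * (1 / 2)"
    using \<delta> by (intro mult_left_mono) (auto simp: two r_def)
  moreover have "(\<Sum>i<n. u 0 i)\<^sup>2 + (\<Sum>i<n. u 1 i)\<^sup>2 \<le> n" by (rule bessel_ones[OF u])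
  ultimately have 1: "real n / 2 \<le> ?a * ?b * ?D" by linarith
  have "4 * (?a * ?b) \<le> (real n)\<^sup>2"
    using zero_le_power2[of "?a - ?b"] unfolding ab[symmetric] by (simp add: power2_eq_square algebra_simps)
  moreover have "?D \<ge> 0" by (simp add: sum_nonneg)
  ultimately have "4 * (?a * ?b) * ?D \<le> (real n)\<^sup>2 * ?D" by (rule mult_right_mono)
  with 1 have "2 * real n \<le> real n * (real n * ?D)" by (simp add: power2_eq_square)
  then show ?thesis using pos ab by (simp add: field_simps)
qed

lemma Ham_star_le_half: "2 * Ham_star n y z \<le> n"
  by (auto simp: Ham_star_def)

text \<open>
  The fitted centres are on average close to the class averages. A sample whose fitted centre is
  closer to its own average than half the distance of the two averages is good, and good samples of
  different classes get different labels. Either each class has a good sample, and then the labels of all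
  good samples are right up to a swap, or one class is entirely bad; as a class has at least n/4 members
  and the error never exceeds n/2, the error is at most twice the number of bad samples in all cases.
\<close>

lemma kmeans_error:
  fixes u :: "nat \<Rightarrow> nat \<Rightarrow> real" and b :: "nat \<Rightarrow> nat \<Rightarrow> real"
  assumes z: "\<And>i. i < n \<Longrightarrow> z i < 2" and bal: "\<And>k. k < 2 \<Longrightarrow> real n / 4 \<le> class_size n z k" and n: "n > 0"
    and u: "(\<Sum>i<n. (u 0 i)\<^sup>2) = 1" "(\<Sum>i<n. (u 1 i)\<^sup>2) = 1" "(\<Sum>i<n. u 0 i * u 1 i) = 0"
    and zh: "\<And>i. i < n \<Longrightarrow> y i < 2"
    and fit: "(\<Sum>i<n. \<Sum>c<2. (b (y i) c - u c i)\<^sup>2)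
        \<le> (1 + \<epsilon>) * (\<Sum>c<2. \<Sum>i<n. (resid n z (u c) i)\<^sup>2)" and \<epsilon>: "\<epsilon> > 0"
  shows "real (Ham_star n y z) \<le> (16 + 8 * \<epsilon>) * real n * (\<Sum>c<2. \<Sum>i<n. (resid n z (u c) i)\<^sup>2)"
proof -
  define \<delta> where "\<delta> = (\<Sum>c<2. \<Sum>i<n. (resid n z (u c) i)\<^sup>2)"
  have \<delta>0: "\<delta> \<ge> 0" by (simp add: \<delta>_def sum_nonneg)
  have half: "real (Ham_star n y z) \<le> real n / 2"
    using Ham_star_le_half[of n y z] by linarith
  show ?thesis
  proof (cases "\<delta> \<le> 1 / 2")
    case False
    \<comment> \<open>the bound is trivial here, as at most half of the samples are in error\<close>
    have "real n / 2 \<le> real n * \<delta>" using False mult_left_mono[of "1 / 2" \<delta> "real n"] by simp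
    also have "\<dots> \<le> (16 + 8 * \<epsilon>) * (real n * \<delta>)"
      using \<delta>0 \<epsilon> mult_right_mono[of 1 "16 + 8 * \<epsilon>" "real n * \<delta>"] by simp
    finally show ?thesis using half unfolding \<delta>_def[symmetric] by (simp add: mult.assoc)
  next
    case True
    let ?m = "\<lambda>c. class_avg n z (u c)"
    define D where "D = (\<Sum>c<2. (?m c 0 - ?m c 1)\<^sup>2)"
    have ne: "class_size n z 0 \<noteq> 0" "class_size n z 1 \<noteq> 0" using bal[of 0] bal[of 1] n by auto
    have D: "2 / n \<le> D" unfolding D_def
      using centers_separated[OF z ne u] True by (simp add: \<delta>_def)
    define gap where "gap i = (\<Sum>c<2. (b (y i) c - ?m c (z i))\<^sup>2)" for i
    have gap0: "gap i \<ge> 0" for i by (simp add: gap_def sum_nonneg)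
    have sq2: "(p - q)\<^sup>2 \<le> 2 * (p - r)\<^sup>2 + 2 * (q - r)\<^sup>2" for p q r :: real
      using zero_le_power2[of "(p - r) + (q - r)"] by (simp add: power2_eq_square algebra_simps)
    have "(\<Sum>i<n. gap i) \<le> (\<Sum>i<n. 2 * (\<Sum>c<2. (b (y i) c - u c i)\<^sup>2) + 2 * (\<Sum>c<2. (resid n z (u c) i)\<^sup>2))"
    proof (rule sum_mono)
      fix i
      have "gap i \<le> (\<Sum>c<2. 2 * (b (y i) c - u c i)\<^sup>2 + 2 * (resid n z (u c) i)\<^sup>2)"
        unfolding gap_def
      proof (rule sum_mono)
        fix c
        show "(b (y i) c - ?m c (z i))\<^sup>2 \<le> 2 * (b (y i) c - u c i)\<^sup>2 + 2 * (resid n z (u c) i)\<^sup>2"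
          using sq2[of "b (y i) c" "?m c (z i)" "u c i"] by (simp add: resid_def power2_commute)
      qed
      then show "gap i \<le> 2 * (\<Sum>c<2. (b (y i) c - u c i)\<^sup>2) + 2 * (\<Sum>c<2. (resid n z (u c) i)\<^sup>2)"
        by (simp add: sum.distrib sum_distrib_left)
    qed
    also have "\<dots> = 2 * (\<Sum>i<n. \<Sum>c<2. (b (y i) c - u c i)\<^sup>2) + 2 * (\<Sum>i<n. \<Sum>c<2. (resid n z (u c) i)\<^sup>2)"
      by (simp only: sum.distrib sum_distrib_left)
    also have "(\<Sum>i<n. \<Sum>c<2. (resid n z (u c) i)\<^sup>2) = \<delta>" unfolding \<delta>_def by (rule sum.swap)
    also have "2 * (\<Sum>i<n. \<Sum>c<2. (b (y i) c - u c i)\<^sup>2) + 2 * \<delta> \<le> 2 * ((1 + \<epsilon>) * \<delta>) + 2 * \<delta>"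
      using fit by (simp add: \<delta>_def)
    finally have gap_sum: "(\<Sum>i<n. gap i) \<le> (4 + 2 * \<epsilon>) * \<delta>" by (simp add: algebra_simps)
    \<comment> \<open>half the distance of the averages, squared, is D / 4\<close>
    define bad where "bad = {i. i < n \<and> D / 4 \<le> gap i}"
    have fin: "finite bad" by (simp add: bad_def)
    have "real (card bad) * (D / 4) = (\<Sum>i\<in>bad. D / 4)" by simp
    also have "\<dots> \<le> (\<Sum>i\<in>bad. gap i)" by (rule sum_mono) (simp add: bad_def)
    also have "\<dots> \<le> (\<Sum>i<n. gap i)" by (rule sum_mono2) (auto simp: bad_def gap0)
    finally have "real (card bad) * (D / 4) \<le> (4 + 2 * \<epsilon>) * \<delta>" using gap_sum by linarith
    moreover have "real (card bad) * (2 / n / 4) \<le> real (card bad) * (D / 4)"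
      using D by (intro mult_left_mono divide_right_mono) auto
    ultimately have "real (card bad) * (2 / n / 4) \<le> (4 + 2 * \<epsilon>) * \<delta>" by linarith
    then have card_bad: "real (card bad) \<le> (8 + 4 * \<epsilon>) * real n * \<delta>"
      using n by (simp add: field_simps)
    have distinct_labels: "y i \<noteq> y j"
      if ij: "i < n" "j < n" "i \<notin> bad" "j \<notin> bad" "z i = 0" "z j = 1" for i j
    proof
      assume eq: "y i = y j"
      have "D \<le> (\<Sum>c<2. 2 * (b (y i) c - ?m c (z i))\<^sup>2 + 2 * (b (y j) c - ?m c (z j))\<^sup>2)"
        unfolding D_def
      proof (rule sum_mono)
        fix c
        show "(?m c 0 - ?m c 1)\<^sup>2 \<le> 2 * (b (y i) c - ?m c (z i))\<^sup>2 + 2 * (b (y j) c - ?m c (z j))\<^sup>2"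
          using sq2[of "?m c 0" "?m c 1" "b (y j) c"] ij eq by (simp add: power2_commute)
      qed
      also have "\<dots> = 2 * gap i + 2 * gap j" by (simp add: gap_def sum.distrib sum_distrib_left)
      also have "\<dots> < D" using ij by (auto simp: bad_def)
      finally show False by simp
    qed
    have "Ham_star n y z \<le> 2 * card bad"
    proof (cases "\<exists>i j. i \<in> label_class n z 0 - bad \<and> j \<in> label_class n z 1 - bad")
      case False
      then have "label_class n z 0 \<subseteq> bad \<or> label_class n z 1 \<subseteq> bad" by auto
      then have "card (label_class n z 0) \<le> card bad \<or> card (label_class n z 1) \<le> card bad"
        using card_mono[OF fin] by blast
      then have "real n / 4 \<le> real (card bad)"
        using bal[of 0] bal[of 1] by auto
      then show ?thesis using half by linarith
    next
      case True
      then obtain i0 j0 where ij: "i0 < n" "i0 \<notin> bad" "z i0 = 0" "j0 < n" "j0 \<notin> bad" "z j0 = 1"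
        by (auto simp: label_class_def)
      have lab: "y i0 \<noteq> y j0" "y i0 < 2" "y j0 < 2"
        using distinct_labels ij zh by auto
      have good: "y i = (if z i = 0 then y i0 else y j0)" if i: "i < n" "i \<notin> bad" for i
      proof (cases "z i = 0")
        case True
        then have "y i \<noteq> y j0" using distinct_labels i ij by blast
        then show ?thesis using True lab zh[OF i(1)] by auto
      next
        case False
        then have "z i = 1" using z[OF i(1)] by auto
        then have "y i0 \<noteq> y i" using distinct_labels i ij by blast
        then show ?thesis using False lab zh[OF i(1)] by auto
      qed
      show ?thesis
      proof (cases "y i0 = 0")
        case True
        then have "y j0 = 1" using lab by auto
        have "y i = z i" if i: "i < n" "i \<notin> bad" for i
        proof (cases "z i = 0")
          case False
          then have "z i = 1" using z[OF i(1)] by auto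
          then show ?thesis using good[OF i] \<open>y j0 = 1\<close> by simp
        qed (use good[OF i] True in simp)
        then have "{i. i < n \<and> y i \<noteq> z i} \<subseteq> bad" by auto
        then have "Ham n y z \<le> card bad" unfolding Ham_def by (rule card_mono[OF fin])
        then show ?thesis by (simp add: Ham_star_def)
      next
        case False
        then have y01: "y i0 = 1" "y j0 = 0" using lab by auto
        have "y i \<noteq> z i" if i: "i < n" "i \<notin> bad" for i
        proof (cases "z i = 0")
          case True
          then show ?thesis using good[OF i] y01 by simp
        next
          case False
          then show ?thesis using good[OF i] y01 by simp
        qed
        then have "{..<n} - bad \<subseteq> {i. i < n \<and> y i \<noteq> z i}" by auto
        then have "card ({..<n} - bad) \<le> Ham n y z" unfolding Ham_def by (intro card_mono) auto
        moreover have "n - card bad \<le> card ({..<n} - bad)"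
          using diff_card_le_card_Diff[OF fin, of "{..<n}"] by simp
        ultimately show ?thesis by (simp add: Ham_star_def)
      qed
    qed
    then have "real (Ham_star n y z) \<le> 2 * real (card bad)" by linarith
    then show ?thesis using card_bad unfolding \<delta>_def[symmetric] by (simp add: algebra_simps)
  qed
qed

section \<open>From misjudged triples to mislabelled samples\<close>

lemma sigma_TLS_commute:
  "sigma_TLS x2 x1 x3 = sigma_TLS x1 x2 x3" "sigma_TLS x1 x3 x2 = sigma_TLS x1 x2 x3"
  unfolding sigma_TLS_def by (simp_all add: add_ac)

lemma TLS_hyperedge_iff:
  assumes "distinct [i, j, k]"
  shows "{i, j, k} \<in> TLS_hyperedges n t x \<longleftrightarrow> {i, j, k} \<subseteq> {..<n} \<and> sigma_TLS (x i) (x j) (x k) \<le> t"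
proof
  assume "{i, j, k} \<in> TLS_hyperedges n t x"
  then obtain a b c where abc: "{i, j, k} = {a, b, c}" "{a, b, c} \<subseteq> {..<n}"
      "distinct [a, b, c]" "sigma_TLS (x a) (x b) (x c) \<le> t"
    unfolding TLS_hyperedges_def by blast
  have "a \<in> {i, j, k}" "b \<in> {i, j, k}" "c \<in> {i, j, k}" using abc(1) by auto
  then have "sigma_TLS (x a) (x b) (x c) = sigma_TLS (x i) (x j) (x k)"
    using abc(3) by (auto simp: sigma_TLS_commute)
  then show "{i, j, k} \<subseteq> {..<n} \<and> sigma_TLS (x i) (x j) (x k) \<le> t" using abc by simp
next
  assume "{i, j, k} \<subseteq> {..<n} \<and> sigma_TLS (x i) (x j) (x k) \<le> t"
  then show "{i, j, k} \<in> TLS_hyperedges n t x" using assms unfolding TLS_hyperedges_def by blast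
qed

lemma weight_mat_TLS_entry:
  assumes ij: "i < n" "j < n" "i \<noteq> j"
  shows "weight_mat n (TLS_hyperedges n t x) $$ (i, j)
    = (\<Sum>k<n. of_bool (k \<noteq> i \<and> k \<noteq> j \<and> sigma_TLS (x i) (x j) (x k) \<le> t))"
proof -
  let ?K = "{k. k < n \<and> k \<noteq> i \<and> k \<noteq> j \<and> sigma_TLS (x i) (x j) (x k) \<le> t}"
  have "{e \<in> TLS_hyperedges n t x. i \<in> e \<and> j \<in> e} = (\<lambda>k. {i, j, k}) ` ?K" (is "?L = ?R")
  proof (intro equalityI subsetI)
    fix e assume e: "e \<in> ?L"
    then obtain a b c where abc: "e = {a, b, c}" "distinct [a, b, c]"
      unfolding TLS_hyperedges_def by blast
    have "\<exists>k. e = {i, j, k} \<and> k \<noteq> i \<and> k \<noteq> j"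
      using e abc ij(3) by auto
    then obtain k where k: "e = {i, j, k}" "k \<noteq> i" "k \<noteq> j" by blast
    then have "distinct [i, j, k]" using ij by simp
    then have "k \<in> ?K" using e k TLS_hyperedge_iff[of i j k n t x] by auto
    then show "e \<in> ?R" using k by blast
  next
    fix e assume "e \<in> ?R"
    then obtain k where "e = {i, j, k}" "k \<in> ?K" by blast
    then show "e \<in> ?L" using ij TLS_hyperedge_iff[of i j k n t x] by auto
  qed
  moreover have "inj_on (\<lambda>k. {i, j, k}) ?K"
  proof (rule inj_onI)
    fix k l assume "k \<in> ?K" "l \<in> ?K" "{i, j, k} = {i, j, l}"
    then show "k = l" by blast
  qed
  ultimately have "card {e \<in> TLS_hyperedges n t x. i \<in> e \<and> j \<in> e} = card ?K"
    by (simp add: card_image)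
  moreover have "(\<Sum>k<n. of_bool (k \<noteq> i \<and> k \<noteq> j \<and> sigma_TLS (x i) (x j) (x k) \<le> t)) = real (card ?K)"
    by (simp add: sum_of_bool_eq Int_def conj_commute)
  ultimately show ?thesis using ij by (simp add: weight_mat_def)
qed

lemma weight_mat_sym:
  assumes "i < n" "j < n"
  shows "weight_mat n E $$ (i, j) = weight_mat n E $$ (j, i)"
  using assms by (simp add: weight_mat_def conj_commute)

lemma ideal_weight_entry:
  assumes ij: "i < n" "j < n" "i \<noteq> j"
  shows "ideal_weight n z i j = (\<Sum>k<n. of_bool (k \<noteq> i \<and> k \<noteq> j \<and> z i = z j \<and> z j = z k))"
proof (cases "z i = z j")
  case True
  have "(\<Sum>k<n. of_bool (k \<noteq> i \<and> k \<noteq> j \<and> z i = z j \<and> z j = z k)) = real (card (label_class n z (z i) - {i, j}))"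
    using True by (simp add: sum_of_bool_eq) (rule arg_cong[where f = card], auto simp: label_class_def)
  moreover have "{i, j} \<subseteq> label_class n z (z i)" using ij True by (auto simp: label_class_def)
  then have "card (label_class n z (z i) - {i, j}) = card (label_class n z (z i)) - 2" "2 \<le> card (label_class n z (z i))"
    using ij card_mono[of "label_class n z (z i)" "{i, j}"] by (auto simp: card_Diff_subset)
  ultimately show ?thesis using True ij by (simp add: ideal_weight_def of_nat_diff)
qed (simp add: ideal_weight_def)

text \<open>
  Counted over ordered triples, so each misjudged set of three samples contributes six times.
\<close>

definition misjudged_count :: "nat \<Rightarrow> real \<Rightarrow> (nat \<Rightarrow> nat) \<Rightarrow> (nat \<Rightarrow> plane) \<Rightarrow> real" where
  "misjudged_count n t z x =
     (\<Sum>i<n. \<Sum>j<n. \<Sum>k<n. of_bool (distinct [i, j, k] \<and> misjudged t z x i j k))"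

text \<open>
  A pair of samples changes its weight by at most the number of misjudged triples that contain it, and
  this number is at most n, so the square of the change is at most n times the number.
\<close>

lemma weight_perturbation_bound:
  "(\<Sum>i<n. \<Sum>j<n. (weight_mat n (TLS_hyperedges n t x) $$ (i, j) - ideal_weight n z i j)\<^sup>2)
     \<le> real n * misjudged_count n t z x"
proof -
  let ?e = "\<lambda>i j. weight_mat n (TLS_hyperedges n t x) $$ (i, j) - ideal_weight n z i j"
  let ?c = "\<lambda>i j. \<Sum>k<n. of_bool (distinct [i, j, k] \<and> misjudged t z x i j k) :: real"
  have "(?e i j)\<^sup>2 \<le> real n * ?c i j" if ij: "i < n" "j < n" for i j
  proof (cases "i = j")
    case True
    then show ?thesis using ij by (simp add: weight_mat_def ideal_weight_def)
  next
    case False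
    have "\<bar>?e i j\<bar> = \<bar>\<Sum>k<n. of_bool (k \<noteq> i \<and> k \<noteq> j \<and> sigma_TLS (x i) (x j) (x k) \<le> t)
        - of_bool (k \<noteq> i \<and> k \<noteq> j \<and> z i = z j \<and> z j = z k)\<bar>"
      by (simp only: weight_mat_TLS_entry[OF ij False] ideal_weight_entry[OF ij False] sum_subtractf)
    also have "\<dots> \<le> (\<Sum>k<n. \<bar>of_bool (k \<noteq> i \<and> k \<noteq> j \<and> sigma_TLS (x i) (x j) (x k) \<le> t)
        - of_bool (k \<noteq> i \<and> k \<noteq> j \<and> z i = z j \<and> z j = z k)\<bar>)" by (rule sum_abs)
    also have "\<dots> = ?c i j"
      using False by (intro sum.cong refl) (auto simp: misjudged_def)
    finally have le: "\<bar>?e i j\<bar> \<le> ?c i j" .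
    have "?c i j \<le> (\<Sum>k<n. 1)" by (intro sum_mono) simp
    then have "?c i j \<le> real n" by simp
    have "(?e i j)\<^sup>2 = \<bar>?e i j\<bar> * \<bar>?e i j\<bar>" by (simp add: power2_eq_square)
    also have "\<dots> \<le> real n * ?c i j"
      using le \<open>?c i j \<le> real n\<close> by (intro mult_mono) auto
    finally show ?thesis .
  qed
  then have "(\<Sum>i<n. \<Sum>j<n. (?e i j)\<^sup>2) \<le> (\<Sum>i<n. \<Sum>j<n. real n * ?c i j)"
    by (intro sum_mono) simp
  then show ?thesis by (simp only: misjudged_count_def sum_distrib_left)
qed

lemma lessThan_2_eq: "{..<2} = {0, 1::nat}" by auto

text \<open>
  The class averages with the true labels are a competitor in the minimisation.
\<close>

lemma approx_2_means_fit:
  assumes z: "\<And>i. i < n \<Longrightarrow> z i < 2" and U: "U \<in> carrier_mat n 2"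
    and km: "approx_2_means n \<epsilon> U Ahat Bhat" and \<epsilon>: "\<epsilon> > 0"
    and y: "\<forall>i<n. y i < 2 \<and> (\<forall>k<2. y i = k \<longleftrightarrow> Ahat $$ (i, k) = 1)"
  shows "(\<Sum>i<n. \<Sum>c<2. (Bhat $$ (y i, c) - U $$ (i, c))\<^sup>2)
    \<le> (1 + \<epsilon>) * (\<Sum>c<2. \<Sum>i<n. (resid n z (\<lambda>i. U $$ (i, c)) i)\<^sup>2)"
proof -
  have A: "Ahat \<in> membership_mats n" and B: "Bhat \<in> carrier_mat 2 2"
    and opt: "frob_norm_sq (Ahat * Bhat - U)
       \<le> (1 + \<epsilon>) * (INF (A, B)\<in>membership_mats n \<times> carrier_mat 2 2. frob_norm_sq (A * B - U))"
    using km by (auto simp: approx_2_means_def)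
  have frob: "frob_norm_sq (A * B - U) = (\<Sum>i<n. \<Sum>c<2. (B $$ (w i, c) - U $$ (i, c))\<^sup>2)"
    if A: "A \<in> carrier_mat n 2" and B: "B \<in> carrier_mat 2 2" and w: "\<And>i. i < n \<Longrightarrow> w i < 2"
      and ent: "\<And>i k. i < n \<Longrightarrow> k < 2 \<Longrightarrow> A $$ (i, k) = (if w i = k then 1 else 0)" for A B w
  proof -
    have "(A * B) $$ (i, c) = B $$ (w i, c)" if ic: "i < n" "c < 2" for i c
    proof -
      have "(A * B) $$ (i, c) = (\<Sum>k<2. A $$ (i, k) * B $$ (k, c))"
        using A B ic by (simp add: scalar_prod_def lessThan_atLeast0)
      also have "\<dots> = (\<Sum>k<2. if w i = k then B $$ (k, c) else 0)"
        using ent ic by (intro sum.cong) auto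
      also have "\<dots> = B $$ (w i, c)" using w[OF ic(1)] by simp
      finally show ?thesis .
    qed
    then show ?thesis using A B U by (simp add: frob_norm_sq_def)
  qed
  have A': "Ahat \<in> carrier_mat n 2" and A01: "\<And>i k. i < n \<Longrightarrow> k < 2 \<Longrightarrow> Ahat $$ (i, k) \<in> {0, 1}"
    using A by (auto simp: membership_mats_def)
  have 1: "frob_norm_sq (Ahat * Bhat - U) = (\<Sum>i<n. \<Sum>c<2. (Bhat $$ (y i, c) - U $$ (i, c))\<^sup>2)"
  proof (rule frob[OF A' B])
    show "y i < 2" if "i < n" for i using y that by blast
    show "Ahat $$ (i, k) = (if y i = k then 1 else 0)" if "i < n" "k < 2" for i k
      using A01[OF that] y that by auto
  qed
  define A0 where "A0 = mat n 2 (\<lambda>(i, k). if z i = k then 1 else (0::real))"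
  define B0 where "B0 = mat 2 2 (\<lambda>(k, c). class_avg n z (\<lambda>i. U $$ (i, c)) k)"
  have A0: "A0 \<in> membership_mats n"
    unfolding membership_mats_def
  proof (intro CollectI conjI allI impI)
    fix i assume i: "i < n"
    show "\<exists>!k. k < 2 \<and> A0 $$ (i, k) \<noteq> 0"
      using z[OF i] i by (intro ex1I[of _ "z i"]) (auto simp: A0_def split: if_splits)
  qed (auto simp: A0_def)
  have B0: "B0 \<in> carrier_mat 2 2" by (simp add: B0_def)
  have "frob_norm_sq (A0 * B0 - U) = (\<Sum>i<n. \<Sum>c<2. (B0 $$ (z i, c) - U $$ (i, c))\<^sup>2)"
    by (rule frob[OF _ B0 z]) (auto simp: A0_def)
  also have "\<dots> = (\<Sum>i<n. \<Sum>c<2. (resid n z (\<lambda>i. U $$ (i, c)) i)\<^sup>2)"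
    using z by (intro sum.cong refl) (auto simp: B0_def resid_def power2_commute)
  also have "\<dots> = (\<Sum>c<2. \<Sum>i<n. (resid n z (\<lambda>i. U $$ (i, c)) i)\<^sup>2)" by (rule sum.swap)
  finally have 2: "frob_norm_sq (A0 * B0 - U) = (\<Sum>c<2. \<Sum>i<n. (resid n z (\<lambda>i. U $$ (i, c)) i)\<^sup>2)" .
  have "(INF (A, B)\<in>membership_mats n \<times> carrier_mat 2 2. frob_norm_sq (A * B - U))
      \<le> (case (A0, B0) of (A, B) \<Rightarrow> frob_norm_sq (A * B - U))"
  proof (rule cINF_lower)
    show "bdd_below ((\<lambda>(A, B). frob_norm_sq (A * B - U)) ` (membership_mats n \<times> carrier_mat 2 2))"
      by (rule bdd_belowI2[of _ 0]) (auto simp: frob_norm_sq_def sum_nonneg)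
    show "(A0, B0) \<in> membership_mats n \<times> carrier_mat 2 2" using A0 B0 by simp
  qed
  then have "(1 + \<epsilon>) * (INF (A, B)\<in>membership_mats n \<times> carrier_mat 2 2. frob_norm_sq (A * B - U))
      \<le> (1 + \<epsilon>) * frob_norm_sq (A0 * B0 - U)"
    using \<epsilon> by (intro mult_left_mono) auto
  then show ?thesis using opt unfolding 1 2 by linarith
qed

text \<open>
  If the Frobenius norm of the perturbation exceeds n^2/128, the bound is trivial. Otherwise class sizes
  of at least n/4 \<ge> 4 give the two-block matrix a second eigenvalue of at least n^2/64, half of which
  survives the perturbation; the two columns then have residuals of total squared norm at most
  2 * 128^2 F / n^4, and the 2-means estimate applies.
\<close>

lemma spectral_output_error:
  assumes z: "\<And>i. i < n \<Longrightarrow> z i < 2" and bal: "\<And>k. k < 2 \<Longrightarrow> real n / 4 \<le> class_size n z k"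
    and n: "n \<ge> 16" and \<epsilon>: "\<epsilon> > 0" and out: "spectral_output n t \<epsilon> x y"
  shows "real (Ham_star n y z) \<le> (32 + 16 * \<epsilon>) * 128\<^sup>2 * misjudged_count n t z x / (real n)\<^sup>2"
proof -
  define W where "W = weight_mat n (TLS_hyperedges n t x)"
  define e where "e i j = W $$ (i, j) - ideal_weight n z i j" for i j
  define F where "F = (\<Sum>i<n. \<Sum>j<n. (e i j)\<^sup>2)"
  have F0: "F \<ge> 0" by (simp add: F_def sum_nonneg)
  have FM: "F \<le> real n * misjudged_count n t z x"
    unfolding F_def e_def W_def by (rule weight_perturbation_bound)
  have npos: "real n > 0" using n by simp
  have suff: ?thesis if "real (Ham_star n y z) \<le> (32 + 16 * \<epsilon>) * 128\<^sup>2 * F / (real n)^3"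
  proof -
    have "(32 + 16 * \<epsilon>) * 128\<^sup>2 * F / (real n)^3
        \<le> (32 + 16 * \<epsilon>) * 128\<^sup>2 * (real n * misjudged_count n t z x) / (real n)^3"
      using FM \<epsilon> npos by (intro divide_right_mono mult_left_mono) auto
    also have "\<dots> = (32 + 16 * \<epsilon>) * 128\<^sup>2 * misjudged_count n t z x / (real n)\<^sup>2"
      using npos by (simp add: power3_eq_cube power2_eq_square)
    finally show ?thesis using that by linarith
  qed
  show ?thesis
  proof (cases "sqrt F \<le> (real n)\<^sup>2 / 128")
    case False
    then have "((real n)\<^sup>2 / 128)\<^sup>2 < (sqrt F)\<^sup>2" by (intro power_strict_mono) auto
    then have "(real n)^4 < 128\<^sup>2 * F" using F0 by (simp add: power_divide field_simps flip: power_mult)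
    then have "real n * (real n)^3 \<le> 128\<^sup>2 * F" by (simp add: power4_eq_xxxx power3_eq_cube)
    then have "real n \<le> 128\<^sup>2 * F / (real n)^3" using npos by (simp add: field_simps)
    also have "\<dots> \<le> (32 + 16 * \<epsilon>) * (128\<^sup>2 * F / (real n)^3)"
      using \<epsilon> F0 mult_right_mono[of 1 "32 + 16 * \<epsilon>" "128\<^sup>2 * F / (real n)^3"] by simp
    finally have "real n \<le> (32 + 16 * \<epsilon>) * 128\<^sup>2 * F / (real n)^3"
      by (simp only: mult.assoc times_divide_eq_right)
    then show ?thesis
      using Ham_star_le_half[of n y z] by (intro suff) linarith
  next
    case True
    obtain U Ahat Bhat where top: "top2_eigenvectors n W U" and km: "approx_2_means n \<epsilon> U Ahat Bhat"
      and y: "\<forall>i<n. y i < 2 \<and> (\<forall>k<2. y i = k \<longleftrightarrow> Ahat $$ (i, k) = 1)"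
      using out unfolding spectral_output_def W_def by blast
    obtain es where U: "U \<in> carrier_mat n 2" and UU: "U\<^sup>T * U = 1\<^sub>m 2" and es: "length es = n" "sorted_wrt (\<ge>) es"
      "char_poly W = (\<Prod>e\<leftarrow>es. [:- e, 1:])"
      and ev: "eigenvector W (col U 0) (es ! 0)" "eigenvector W (col U 1) (es ! 1)"
      using top unfolding top2_eigenvectors_def by blast
    define u where "u c i = U $$ (i, c)" for c i
    have W: "W \<in> carrier_mat n n" by (simp add: W_def weight_mat_def)
    have Wsym: "W $$ (i, j) = W $$ (j, i)" if "i < n" "j < n" for i j
      unfolding W_def using that by (rule weight_mat_sym)
    have orth: "(\<Sum>i<n. u c i * u d i) = (if c = d then 1 else 0)" if "c < 2" "d < 2" for c d
    proof -
      have "(U\<^sup>T * U) $$ (c, d) = 1\<^sub>m 2 $$ (c, d)" by (simp add: UU)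
      then show ?thesis using that U by (simp add: scalar_prod_def lessThan_atLeast0 u_def)
    qed
    have u: "(\<Sum>i<n. (u 0 i)\<^sup>2) = 1" "(\<Sum>i<n. (u 1 i)\<^sup>2) = 1" "(\<Sum>i<n. u 0 i * u 1 i) = 0"
      using orth[of 0 0] orth[of 1 1] orth[of 0 1] by (simp_all add: power2_eq_square)
    have eig: "(\<Sum>j<n. W $$ (i, j) * u c j) = es ! c * u c i" if c: "c < 2" and i: "i < n" for c i
    proof -
      have "eigenvector W (col U c) (es ! c)" using ev c by (cases "c = 0") (auto simp: less_2_cases_iff)
      then have "vec_index (W *\<^sub>v col U c) i = vec_index (es ! c \<cdot>\<^sub>v col U c) i" by (simp add: eigenvector_def)
      then show ?thesis using W U c i by (simp add: scalar_prod_def lessThan_atLeast0 u_def)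
    qed
    have we: "W $$ (i, j) = ideal_weight n z i j + e i j" for i j by (simp add: e_def)
    have size2: "2 \<le> class_size n z k" if "k < 2" for k using bal[OF that] n by linarith
    define s where "s = real n / 4"
    have s4: "s \<ge> 4" using n by (simp add: s_def)
    define f g where "f i = (if z i = 0 then 1 else 0::real)" and "g i = (if z i = 1 then 1 else 0::real)" for i
    have "(s - 1) * (s - 2) - sqrt F \<le> es ! 1"
    proof (rule second_eigenvalue_ge[OF W _ Wsym es(3,1,2), where f = f and g = g])
      show "2 \<le> n" using n by simp
      fix a b
      show "a = 0 \<and> b = 0" if *: "\<And>i. i < n \<Longrightarrow> a * f i + b * g i = 0"
      proof -
        have "label_class n z 0 \<noteq> {}" "label_class n z 1 \<noteq> {}" using size2[of 0] size2[of 1] by auto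
        then obtain i j where "i < n" "z i = 0" "j < n" "z j = 1" by (auto simp: label_class_def)
        then show ?thesis using *[of i] *[of j] by (simp add: f_def g_def)
      qed
      show "((s - 1) * (s - 2) - sqrt F) * (\<Sum>i<n. (a * f i + b * g i)\<^sup>2)
          \<le> quad_form n (\<lambda>i j. W $$ (i, j)) (\<lambda>i. a * f i + b * g i)"
        unfolding F_def
        by (rule quad_form_ideal_perturbed_ge[OF z, where g = "\<lambda>k. a * (if k = 0 then 1 else 0) + b * (if k = 1 then 1 else 0)"])
          (use bal s4 in \<open>auto simp: s_def we f_def g_def\<close>)
    qed
    moreover have "(real n)\<^sup>2 / 64 \<le> (s - 1) * (s - 2)"
    proof -
      have "s\<^sup>2 / 4 \<le> (s - 1) * (s - 2)"
      proof -
        have "(s - 1) * (s - 2) = s\<^sup>2 / 4 + (3 / 4 * (s * (s - 4)) + 2)"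
          by (simp add: power2_eq_square algebra_simps)
        moreover have "s * (s - 4) \<ge> 0" using s4 by simp
        ultimately show ?thesis by linarith
      qed
      then show ?thesis by (simp add: s_def power_divide)
    qed
    ultimately have l1: "(real n)\<^sup>2 / 128 \<le> es ! 1" using True by linarith
    have "es ! 1 \<le> es ! 0" using sorted_wrt_nth_less[OF es(2), of 0 1] es(1) n by simp
    then have lc: "(real n)\<^sup>2 / 128 \<le> es ! c" if "c < 2" for c
      using l1 that by (auto simp: less_2_cases_iff)
    have pos: "(real n)\<^sup>2 / 128 > 0" using npos by simp
    have res: "((real n)\<^sup>2 / 128)\<^sup>2 * (\<Sum>i<n. (resid n z (u c) i)\<^sup>2) \<le> F" if c: "c < 2" for c
    proof -
      have "((real n)\<^sup>2 / 128)\<^sup>2 * (\<Sum>i<n. (resid n z (u c) i)\<^sup>2) \<le> (es ! c)\<^sup>2 * (\<Sum>i<n. (resid n z (u c) i)\<^sup>2)"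
        using lc[OF c] pos by (intro mult_right_mono power_mono) (auto simp: sum_nonneg)
      also have "\<dots> \<le> F" unfolding F_def
        by (rule eigenvector_resid_bound[OF z size2 we eig[OF c]])
          (use order.strict_trans2[OF pos lc[OF c]] u c in \<open>auto simp: less_2_cases_iff\<close>)
      finally show ?thesis .
    qed
    define \<delta> where "\<delta> = (\<Sum>c<2. \<Sum>i<n. (resid n z (u c) i)\<^sup>2)"
    have "((real n)\<^sup>2 / 128)\<^sup>2 * \<delta> \<le> 2 * F"
      using res[of 0] res[of 1] by (simp add: \<delta>_def lessThan_2_eq distrib_left)
    then have \<delta>: "\<delta> \<le> 2 * 128\<^sup>2 * F / (real n)^4"
      using npos by (simp add: field_simps power_divide flip: power_mult)
    have "real (Ham_star n y z) \<le> (16 + 8 * \<epsilon>) * real n * \<delta>"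
      unfolding \<delta>_def
    proof (rule kmeans_error[OF z bal _ u])
      show "(\<Sum>i<n. \<Sum>c<2. (Bhat $$ (y i, c) - u c i)\<^sup>2)
          \<le> (1 + \<epsilon>) * (\<Sum>c<2. \<Sum>i<n. (resid n z (u c) i)\<^sup>2)"
        using approx_2_means_fit[OF z U km \<epsilon> y] by (simp add: u_def[abs_def])
    qed (use n y \<epsilon> in auto)
    also have "\<dots> \<le> (16 + 8 * \<epsilon>) * real n * (2 * 128\<^sup>2 * F / (real n)^4)"
      using \<delta> \<epsilon> by (intro mult_left_mono) auto
    also have "\<dots> = (32 + 16 * \<epsilon>) * 128\<^sup>2 * F / (real n)^3"
      using npos by (simp add: field_simps power4_eq_xxxx power3_eq_cube)
    finally show ?thesis by (rule suff)
  qed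
qed

section \<open>Gaussian tails, small products and class sizes\<close>

lemma prod_Basis_plane: "(\<Prod>b\<in>Basis. f ((x::plane) \<bullet> b)) = (\<Prod>j\<in>UNIV. f (x $ j))"
proof -
  have B: "Basis = range (\<lambda>j. axis j (1::real) :: plane)" by (auto simp: Basis_vec_def)
  have inj: "inj (\<lambda>j. axis j (1::real) :: plane)" by (auto simp: inj_def axis_eq_axis)
  have "(\<Prod>b\<in>Basis. f (x \<bullet> b)) = (\<Prod>j\<in>UNIV. f (x \<bullet> axis j 1))"
    unfolding B by (subst prod.reindex[OF inj]) (simp add: o_def)
  then show ?thesis by (simp add: inner_axis)
qed

lemma nn_integral_lborel_plane_prod:
  assumes [measurable]: "f \<in> borel_measurable borel" and f: "\<And>x. 0 \<le> f x"
  shows "(\<integral>\<^sup>+y. ennreal (\<Prod>j\<in>UNIV. f ((y::plane) $ j)) \<partial>lborel) = (\<integral>\<^sup>+x. ennreal (f x) \<partial>lborel)\<^sup>2"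
proof -
  have "(\<integral>\<^sup>+y. ennreal (\<Prod>j\<in>UNIV. f ((y::plane) $ j)) \<partial>lborel)
      = (\<integral>\<^sup>+y. (\<Prod>b\<in>Basis. ennreal (f ((y::plane) \<bullet> b))) \<partial>lborel)"
    by (simp add: prod_ennreal f flip: prod_Basis_plane)
  also have "\<dots> = (\<Prod>b\<in>(Basis :: plane set). \<integral>\<^sup>+x. ennreal (f x) \<partial>lborel)"
    by (rule nn_integral_lborel_prod) auto
  also have "\<dots> = (\<integral>\<^sup>+x. ennreal (f x) \<partial>lborel) ^ DIM(plane)" by (simp only: prod_constant)
  finally show ?thesis by simp
qed

lemma nn_integral_normal_density:
  assumes "0 < s"
  shows "(\<integral>\<^sup>+x. ennreal (normal_density m s x) \<partial>lborel) = 1"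
proof -
  interpret prob_space "density lborel (normal_density m s)"
    using assms by (rule prob_space_normal_density)
  show ?thesis using emeasure_space_1 by (simp add: emeasure_density)
qed

lemma measurable_vec_nth_plane [measurable]: "(\<lambda>y::plane. y $ j) \<in> borel_measurable borel"
  by (intro borel_measurable_continuous_onI continuous_intros)

lemma measurable_gauss_density [measurable]:
  "(\<lambda>y::plane. \<Prod>j\<in>UNIV. std_normal_density (y $ j)) \<in> borel_measurable borel"
  by measurable

lemma sets_std_gauss_plane [simp, measurable_cong]: "sets std_gauss_plane = sets borel"
  by (simp add: std_gauss_plane_def)

lemma space_std_gauss_plane [simp]: "space std_gauss_plane = UNIV"
  by (simp add: std_gauss_plane_def)

lemma prob_space_std_gauss_plane: "prob_space std_gauss_plane"
proof
  show "emeasure std_gauss_plane (space std_gauss_plane) = 1"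
    unfolding std_gauss_plane_def
    by (simp add: emeasure_density nn_integral_lborel_plane_prod nn_integral_normal_density)
qed

text \<open>
  Tilting by exp(x^2/4) turns the standard normal density into sqrt 2 times the density of variance 2,
  so each of the two coordinates contributes a factor sqrt 2.
\<close>

lemma std_gauss_plane_exp_moment:
  "(\<integral>\<^sup>+y. ennreal (exp ((norm y)\<^sup>2 / 4)) \<partial>std_gauss_plane) = 2"
proof -
  have std: "std_normal_density x * exp (x\<^sup>2 / 4) = sqrt 2 * normal_density 0 (sqrt 2) x" for x
  proof -
    have "exp (- x\<^sup>2 / 2) * exp (x\<^sup>2 / 4) = exp (- x\<^sup>2 / 4)"
      by (simp flip: exp_add)
    then show ?thesis
      by (simp add: normal_density_def real_sqrt_mult field_simps)
  qed
  have "(\<integral>\<^sup>+y. ennreal (exp ((norm y)\<^sup>2 / 4)) \<partial>std_gauss_plane)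
      = (\<integral>\<^sup>+y. ennreal (\<Prod>j\<in>UNIV. std_normal_density (y $ j)) * ennreal (exp ((norm (y::plane))\<^sup>2 / 4)) \<partial>lborel)"
    unfolding std_gauss_plane_def by (subst nn_integral_density) auto
  also have "\<dots> = (\<integral>\<^sup>+y. ennreal (\<Prod>j\<in>UNIV. sqrt 2 * normal_density 0 (sqrt 2) ((y::plane) $ j)) \<partial>lborel)"
  proof (intro nn_integral_cong)
    fix y :: plane
    have "(norm y)\<^sup>2 / 4 = (\<Sum>j\<in>UNIV. (y $ j)\<^sup>2 / 4)"
      unfolding power2_norm_eq_inner inner_vec_def by (simp add: power2_eq_square sum_divide_distrib)
    then have "(\<Prod>j\<in>UNIV. std_normal_density (y $ j)) * exp ((norm y)\<^sup>2 / 4)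
        = (\<Prod>j\<in>UNIV. sqrt 2 * normal_density 0 (sqrt 2) (y $ j))"
      by (simp only: exp_sum[OF finite] prod.distrib[symmetric] std)
    then show "ennreal (\<Prod>j\<in>UNIV. std_normal_density (y $ j)) * ennreal (exp ((norm y)\<^sup>2 / 4))
        = ennreal (\<Prod>j\<in>UNIV. sqrt 2 * normal_density 0 (sqrt 2) (y $ j))"
      by (simp add: prod_nonneg flip: ennreal_mult)
  qed
  also have "\<dots> = (\<integral>\<^sup>+x. ennreal (sqrt 2 * normal_density 0 (sqrt 2) x) \<partial>lborel)\<^sup>2"
    by (rule nn_integral_lborel_plane_prod) auto
  also have "(\<integral>\<^sup>+x. ennreal (sqrt 2 * normal_density 0 (sqrt 2) x) \<partial>lborel) = ennreal (sqrt 2)"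
    by (simp add: ennreal_mult nn_integral_cmult nn_integral_normal_density)
  also have "(ennreal (sqrt 2))\<^sup>2 = 2"
    by (simp add: ennreal_power)
  finally show ?thesis .
qed

lemma std_gauss_plane_tail:
  assumes "r \<ge> 0"
  shows "emeasure std_gauss_plane {y. r < norm y} \<le> ennreal (2 * exp (- r\<^sup>2 / 4))"
proof -
  have [measurable]: "{y::plane. r < norm y} \<in> sets borel" by measurable
  have "emeasure std_gauss_plane {y. r < norm y} = (\<integral>\<^sup>+y. indicator {y. r < norm y} y \<partial>std_gauss_plane)"
    by simp
  also have "\<dots> \<le> (\<integral>\<^sup>+y. ennreal (exp (- r\<^sup>2 / 4)) * ennreal (exp ((norm y)\<^sup>2 / 4)) \<partial>std_gauss_plane)"
  proof (intro nn_integral_mono)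
    fix y :: plane
    have "1 \<le> exp (- r\<^sup>2 / 4) * exp ((norm y)\<^sup>2 / 4)" if "r < norm y"
      using power_mono[of r "norm y" 2] that assms by (simp flip: exp_add)
    then show "(indicator {y. r < norm y} y :: ennreal) \<le> ennreal (exp (- r\<^sup>2 / 4)) * ennreal (exp ((norm y)\<^sup>2 / 4))"
      by (auto simp: indicator_def ennreal_leI simp flip: ennreal_mult ennreal_1)
  qed
  also have "\<dots> = ennreal (exp (- r\<^sup>2 / 4)) * 2"
    by (subst nn_integral_cmult) (auto simp: std_gauss_plane_exp_moment)
  also have "\<dots> = ennreal (2 * exp (- r\<^sup>2 / 4))"
    by (simp add: ennreal_mult mult.commute)
  finally show ?thesis .
qed

lemma interval_mass_bound:
  assumes "bdd_above (interval_ratios \<nu> \<rho>)"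
  obtains M where "M \<ge> 0" and "\<And>x r. r > 0 \<Longrightarrow> measure \<nu> {y. \<bar>y - x\<bar> \<le> r} \<le> M * (2 * r) powr \<rho>"
proof -
  obtain B where B: "\<And>q. q \<in> interval_ratios \<nu> \<rho> \<Longrightarrow> q \<le> B"
    using assms by (auto simp: bdd_above_def)
  show thesis
  proof (rule that[of "max 0 B"])
    fix x r :: real assume r: "r > 0"
    have I: "{y. \<bar>y - x\<bar> \<le> r} = {x - r..x + r}" by auto
    have len: "measure lborel {x - r..x + r} = 2 * r" using r by simp
    have "measure \<nu> {x - r..x + r} / (2 * r) powr \<rho> \<in> interval_ratios \<nu> \<rho>"
      unfolding interval_ratios_def using r len
      by (intro CollectI exI[of _ "{x - r..x + r}"]) (auto simp: is_interval_cc)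
    then have "measure \<nu> {x - r..x + r} / (2 * r) powr \<rho> \<le> max 0 B" using B by fastforce
    then show "measure \<nu> {y. \<bar>y - x\<bar> \<le> r} \<le> max 0 B * (2 * r) powr \<rho>"
      unfolding I using r by (simp add: divide_le_eq)
  qed simp
qed

lemma emeasure_PiM_component:
  assumes "\<And>i. i \<in> I \<Longrightarrow> prob_space (M i)" and "m \<in> I" and [measurable]: "A \<in> sets (M m)"
  shows "emeasure (PiM I M) {w \<in> space (PiM I M). w m \<in> A} = emeasure (M m) A"
proof -
  have "emeasure (PiM I M) {w \<in> space (PiM I M). w m \<in> A} = emeasure (distr (PiM I M) (M m) (\<lambda>w. w m)) A"
    using assms(2) by (subst emeasure_distr) (auto intro!: arg_cong2[where f = emeasure])
  then show ?thesis using assms by (simp add: distr_PiM_component)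
qed

text \<open>
  Integrating out coordinate a first, with b fixed, replaces the constraint on the difference by its
  worst-case probability H; the constraint on c is then a statement about a single coordinate.
\<close>

lemma PiM_two_constraints:
  fixes \<nu> :: "real measure" and G H :: real
  assumes \<nu>: "prob_space \<nu>" and sets_\<nu> [measurable_cong, simp]: "sets \<nu> = sets borel"
    and I: "finite I" "a \<in> I" "b \<in> I" "c \<in> I" "a \<noteq> b" "a \<noteq> c"
    and G: "measure \<nu> {y. \<bar>y\<bar> \<le> r} \<le> G" and H: "\<And>x. measure \<nu> {y. \<bar>y - x\<bar> \<le> q} \<le> H"
  shows "emeasure (PiM I (\<lambda>_. \<nu>)) {V \<in> space (PiM I (\<lambda>_. \<nu>)). \<bar>V c\<bar> \<le> r \<and> \<bar>V a - V b\<bar> \<le> q} \<le> ennreal (G * H)"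
proof -
  interpret \<nu>: prob_space \<nu> by (rule \<nu>)
  interpret P: product_sigma_finite "\<lambda>_. \<nu>" by standard
  have H0: "H \<ge> 0" using H[of 0] measure_nonneg[of \<nu>] order_trans by blast
  have G0: "G \<ge> 0" using G measure_nonneg[of \<nu>] order_trans by blast
  define I' where "I' = I - {a}"
  have I': "I = insert a I'" "finite I'" "a \<notin> I'" "b \<in> I'" "c \<in> I'" using I by (auto simp: I'_def)
  let ?E = "{V \<in> space (PiM I (\<lambda>_. \<nu>)). \<bar>V c\<bar> \<le> r \<and> \<bar>V a - V b\<bar> \<le> q}"
  have [measurable]: "?E \<in> sets (PiM I (\<lambda>_. \<nu>))" using I by measurable
  have "emeasure (PiM I (\<lambda>_. \<nu>)) ?E = (\<integral>\<^sup>+V. indicator ?E V \<partial>PiM I (\<lambda>_. \<nu>))" by simp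
  also have "\<dots> = (\<integral>\<^sup>+w. \<integral>\<^sup>+y. indicator ?E (w(a := y)) \<partial>\<nu> \<partial>PiM I' (\<lambda>_. \<nu>))"
  proof -
    have "(indicator ?E :: _ \<Rightarrow> ennreal) \<in> borel_measurable (PiM I (\<lambda>_. \<nu>))" by measurable
    then show ?thesis
      using P.product_nn_integral_insert[OF I'(2,3), of "indicator ?E"]
      unfolding I'(1)[symmetric] by simp
  qed
  also have "\<dots> \<le> (\<integral>\<^sup>+w. ennreal H * indicator {w \<in> space (PiM I' (\<lambda>_. \<nu>)). \<bar>w c\<bar> \<le> r} w \<partial>PiM I' (\<lambda>_. \<nu>))"
  proof (intro nn_integral_mono)
    fix w assume w: "w \<in> space (PiM I' (\<lambda>_. \<nu>))"
    have "(\<integral>\<^sup>+y. indicator ?E (w(a := y)) \<partial>\<nu>)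
        \<le> (\<integral>\<^sup>+y. indicator {w \<in> space (PiM I' (\<lambda>_. \<nu>)). \<bar>w c\<bar> \<le> r} w * indicator {y. \<bar>y - w b\<bar> \<le> q} y \<partial>\<nu>)"
      using w I I' by (intro nn_integral_mono) (auto simp: indicator_def)
    also have "\<dots> = indicator {w \<in> space (PiM I' (\<lambda>_. \<nu>)). \<bar>w c\<bar> \<le> r} w * emeasure \<nu> {y. \<bar>y - w b\<bar> \<le> q}"
      by (subst nn_integral_cmult) auto
    also have "\<dots> \<le> indicator {w \<in> space (PiM I' (\<lambda>_. \<nu>)). \<bar>w c\<bar> \<le> r} w * ennreal H"
      by (intro mult_left_mono) (auto simp: \<nu>.emeasure_eq_measure H ennreal_leI)
    finally show "(\<integral>\<^sup>+y. indicator ?E (w(a := y)) \<partial>\<nu>)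
        \<le> ennreal H * indicator {w \<in> space (PiM I' (\<lambda>_. \<nu>)). \<bar>w c\<bar> \<le> r} w"
      by (simp add: mult.commute)
  qed
  also have "\<dots> = ennreal H * emeasure (PiM I' (\<lambda>_. \<nu>)) {w \<in> space (PiM I' (\<lambda>_. \<nu>)). \<bar>w c\<bar> \<le> r}"
    using I' by (subst nn_integral_cmult) auto
  also have "\<dots> \<le> ennreal H * ennreal G"
  proof (intro mult_left_mono)
    have "emeasure (PiM I' (\<lambda>_. \<nu>)) {w \<in> space (PiM I' (\<lambda>_. \<nu>)). \<bar>w c\<bar> \<le> r} = emeasure \<nu> {y. \<bar>y\<bar> \<le> r}"
      using emeasure_PiM_component[of I' "\<lambda>_. \<nu>" c "{y. \<bar>y\<bar> \<le> r}"] I' \<nu> by simp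
    also have "\<dots> \<le> ennreal G" using G by (simp add: \<nu>.emeasure_eq_measure ennreal_leI)
    finally show "emeasure (PiM I' (\<lambda>_. \<nu>)) {w \<in> space (PiM I' (\<lambda>_. \<nu>)). \<bar>w c\<bar> \<le> r} \<le> ennreal G" .
  qed simp
  also have "\<dots> = ennreal (G * H)" using G0 H0 by (simp add: ennreal_mult mult.commute)
  finally show ?thesis .
qed

text \<open>
  If |V c| lies in the shell between K / 2^(m+1) and K / 2^m, the product can be at most s only if the
  difference is at most 2^(m+1) s / K. A trivial bound is used once |V c| is below K / 2^J. Cutting at a
  finite J, rather than summing all shells, leaves the choice of J to the application.
\<close>

lemma PiM_product_small:
  fixes \<nu> :: "real measure" and h :: "real \<Rightarrow> real"
  assumes \<nu>: "prob_space \<nu>" and sets_\<nu> [measurable_cong, simp]: "sets \<nu> = sets borel"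
    and I: "finite I" "a \<in> I" "b \<in> I" "c \<in> I" "a \<noteq> b" "a \<noteq> c"
    and h: "\<And>x r. r > 0 \<Longrightarrow> measure \<nu> {y. \<bar>y - x\<bar> \<le> r} \<le> h r"
    and K: "K > 0" and s: "s > 0"
  shows "emeasure (PiM I (\<lambda>_. \<nu>)) {V \<in> space (PiM I (\<lambda>_. \<nu>)). \<bar>V c\<bar> \<le> K \<and> \<bar>V c\<bar> * \<bar>V a - V b\<bar> \<le> s}
    \<le> ennreal ((\<Sum>m<J. h (K / 2 ^ m) * h (s * 2 ^ Suc m / K)) + h (K / 2 ^ J))"
proof -
  let ?P = "PiM I (\<lambda>_. \<nu>)"
  interpret \<nu>: prob_space \<nu> by (rule \<nu>)
  have h0: "h r \<ge> 0" if "r > 0" for r using h[OF that, of 0] measure_nonneg[of \<nu>] order_trans by blast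
  define A where "A r q = {V \<in> space ?P. \<bar>V c\<bar> \<le> r \<and> \<bar>V a - V b\<bar> \<le> q}" for r q
  define B where "B = {V \<in> space ?P. \<bar>V c\<bar> \<le> K / 2 ^ J}"
  have [measurable]: "A r q \<in> sets ?P" for r q unfolding A_def using I by measurable
  have [measurable]: "B \<in> sets ?P" unfolding B_def using I by measurable
  have "{V \<in> space ?P. \<bar>V c\<bar> \<le> K \<and> \<bar>V c\<bar> * \<bar>V a - V b\<bar> \<le> s}
      \<subseteq> (\<Union>m<J. A (K / 2 ^ m) (s * 2 ^ Suc m / K)) \<union> B"
  proof
    fix V assume "V \<in> {V \<in> space ?P. \<bar>V c\<bar> \<le> K \<and> \<bar>V c\<bar> * \<bar>V a - V b\<bar> \<le> s}"
    then have V: "V \<in> space ?P" "\<bar>V c\<bar> \<le> K" "\<bar>V c\<bar> * \<bar>V a - V b\<bar> \<le> s" by auto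
    show "V \<in> (\<Union>m<J. A (K / 2 ^ m) (s * 2 ^ Suc m / K)) \<union> B"
    proof (cases "V \<in> B")
      case False
      then have J: "\<not> \<bar>V c\<bar> \<le> K / 2 ^ J" using V by (simp add: B_def)
      \<comment> \<open>the dyadic shell that contains V c\<close>
      obtain m where m: "m < J" "\<bar>V c\<bar> \<le> K / 2 ^ m" "\<not> \<bar>V c\<bar> \<le> K / 2 ^ Suc m"
        using ex_least_nat_less[of "\<lambda>m. \<not> \<bar>V c\<bar> \<le> K / 2 ^ m" J] J V(2) by auto
      have "K / 2 ^ Suc m * \<bar>V a - V b\<bar> \<le> \<bar>V c\<bar> * \<bar>V a - V b\<bar>"
        using m(3) by (intro mult_right_mono) auto
      then have "K / 2 ^ Suc m * \<bar>V a - V b\<bar> \<le> s" using V(3) by linarith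
      then have "\<bar>V a - V b\<bar> \<le> s * 2 ^ Suc m / K" using K by (simp add: field_simps)
      then show ?thesis using m V by (auto simp: A_def)
    qed simp
  qed
  then have "emeasure ?P {V \<in> space ?P. \<bar>V c\<bar> \<le> K \<and> \<bar>V c\<bar> * \<bar>V a - V b\<bar> \<le> s}
      \<le> emeasure ?P ((\<Union>m<J. A (K / 2 ^ m) (s * 2 ^ Suc m / K)) \<union> B)"
    by (intro emeasure_mono) auto
  also have "\<dots> \<le> emeasure ?P (\<Union>m<J. A (K / 2 ^ m) (s * 2 ^ Suc m / K)) + emeasure ?P B"
    by (intro emeasure_subadditive) auto
  also have "\<dots> \<le> (\<Sum>m<J. ennreal (h (K / 2 ^ m) * h (s * 2 ^ Suc m / K))) + ennreal (h (K / 2 ^ J))"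
  proof (intro add_mono)
    have "emeasure ?P (\<Union>m<J. A (K / 2 ^ m) (s * 2 ^ Suc m / K))
        \<le> (\<Sum>m<J. emeasure ?P (A (K / 2 ^ m) (s * 2 ^ Suc m / K)))"
      by (intro emeasure_subadditive_finite) auto
    also have "\<dots> \<le> (\<Sum>m<J. ennreal (h (K / 2 ^ m) * h (s * 2 ^ Suc m / K)))"
      unfolding A_def using K s h[of _ 0]
      by (intro sum_mono PiM_two_constraints[OF \<nu> sets_\<nu> I] h) auto
    finally show "emeasure ?P (\<Union>m<J. A (K / 2 ^ m) (s * 2 ^ Suc m / K))
        \<le> (\<Sum>m<J. ennreal (h (K / 2 ^ m) * h (s * 2 ^ Suc m / K)))" .
    have "emeasure ?P B = emeasure \<nu> {y. \<bar>y\<bar> \<le> K / 2 ^ J}"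
      unfolding B_def using emeasure_PiM_component[of I "\<lambda>_. \<nu>" c "{y. \<bar>y\<bar> \<le> K / 2 ^ J}"] I \<nu> by simp
    also have "\<dots> \<le> ennreal (h (K / 2 ^ J))"
      using h[of "K / 2 ^ J" 0] K by (simp add: \<nu>.emeasure_eq_measure ennreal_leI)
    finally show "emeasure ?P B \<le> ennreal (h (K / 2 ^ J))" .
  qed
  also have "\<dots> = ennreal ((\<Sum>m<J. h (K / 2 ^ m) * h (s * 2 ^ Suc m / K)) + h (K / 2 ^ J))"
    using h0 K s by (simp add: sum_nonneg)
  finally show ?thesis .
qed

text \<open>
  For a power bound the factors 2^m cancel, so every shell contributes the same amount; this is where
  the logarithm in the upper assumption on the threshold comes from.
\<close>

lemma PiM_product_small_powr:
  fixes \<nu> :: "real measure"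
  assumes \<nu>: "prob_space \<nu>" and sets_\<nu>: "sets \<nu> = sets borel"
    and I: "finite I" "a \<in> I" "b \<in> I" "c \<in> I" "a \<noteq> b" "a \<noteq> c"
    and M: "M \<ge> 0" "\<And>x r. r > 0 \<Longrightarrow> measure \<nu> {y. \<bar>y - x\<bar> \<le> r} \<le> M * (2 * r) powr \<rho>"
    and K: "K > 0" and s: "s > 0"
  shows "emeasure (PiM I (\<lambda>_. \<nu>)) {V \<in> space (PiM I (\<lambda>_. \<nu>)). \<bar>V c\<bar> \<le> K \<and> \<bar>V c\<bar> * \<bar>V a - V b\<bar> \<le> s}
    \<le> ennreal (real J * (M\<^sup>2 * (8 * s) powr \<rho>) + M * (2 * K / 2 ^ J) powr \<rho>)"
proof -
  have "M * (2 * (K / 2 ^ m)) powr \<rho> * (M * (2 * (s * 2 ^ Suc m / K)) powr \<rho>) = M\<^sup>2 * (8 * s) powr \<rho>" for m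
  proof -
    have "(2 * (K / 2 ^ m)) powr \<rho> * (2 * (s * 2 ^ Suc m / K)) powr \<rho>
        = (2 * (K / 2 ^ m) * (2 * (s * 2 ^ Suc m / K))) powr \<rho>"
      by (rule powr_mult[symmetric])
    also have "2 * (K / 2 ^ m) * (2 * (s * 2 ^ Suc m / K)) = 8 * s" using K by simp
    finally show ?thesis by (simp add: power2_eq_square mult_ac)
  qed
  then show ?thesis
    using PiM_product_small[OF \<nu> sets_\<nu> I M(2) K s, where J = J] by simp
qed

lemma class_size_eq_sum: "class_size n z k = (\<Sum>i<n. if z i = k then 1 else 0)"
  by (simp add: label_class_def sum.If_cases Int_def conj_commute)

text \<open>
  Chernoff's bound: weighting each member of the class by 1/4 gives a mean of (5/8)^n, whereas a class
  with fewer than n/4 members has weight at least (1/4)^(n/4) = (sqrt 2)^(- n), and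
  sqrt 2 * 5/8 < 9/10.
\<close>

lemma PiM_uniform_label_class_small:
  assumes n: "n > 0" and k: "k < 2"
  shows "emeasure (\<Pi>\<^sub>M i\<in>{..<n}. measure_pmf (pmf_of_set {0, 1::nat}))
     {z \<in> space (\<Pi>\<^sub>M i\<in>{..<n}. measure_pmf (pmf_of_set {0, 1::nat})). class_size n z k < real n / 4}
     \<le> ennreal ((9 / 10) ^ n)"
proof -
  let ?L = "measure_pmf (pmf_of_set {0, 1::nat})"
  let ?P = "\<Pi>\<^sub>M i\<in>{..<n}. ?L"
  interpret product_sigma_finite "\<lambda>_. ?L" by standard
  let ?f = "\<lambda>m. if m = k then 1 / 4 else 1 :: real"
  have prod: "(\<Prod>i<n. ?f (z i)) = (1 / 4) ^ card (label_class n z k)" for z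
    by (simp add: prod.If_cases label_class_def Int_def conj_commute)
  have ge1: "1 \<le> sqrt 2 ^ n * (1 / 4) ^ card (label_class n z k)" if "class_size n z k < real n / 4" for z
  proof -
    have "4 * card (label_class n z k) \<le> n" using that by linarith
    have "(4::real) ^ card (label_class n z k) = sqrt 2 ^ (4 * card (label_class n z k))"
    proof -
      have "sqrt 2 ^ (2 * 2) = ((sqrt 2)\<^sup>2)\<^sup>2" by (rule power_mult)
      then show ?thesis by (simp add: power_mult)
    qed
    also have "\<dots> \<le> sqrt 2 ^ n" using \<open>4 * card (label_class n z k) \<le> n\<close> by (intro power_increasing) auto
    finally show ?thesis by (simp add: field_simps)
  qed
  let ?E = "{z \<in> space ?P. class_size n z k < real n / 4}"
  have "(\<integral>m. ?f m \<partial>?L) = 5 / 8"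
    using k by (subst integral_pmf_of_set) (auto simp: less_2_cases_iff)
  then have int1: "(\<integral>\<^sup>+m. ennreal (?f m) \<partial>?L) = ennreal (5 / 8)"
    by (subst nn_integral_eq_integral) (auto intro: integrable_measure_pmf_finite)
  have "emeasure ?P ?E \<le> (\<integral>\<^sup>+z. ennreal (sqrt 2 ^ n) * (\<Prod>i<n. ennreal (?f (z i))) \<partial>?P)"
  proof -
    have [measurable]: "?E \<in> sets ?P" unfolding class_size_eq_sum by measurable
    have "emeasure ?P ?E = (\<integral>\<^sup>+z. indicator ?E z \<partial>?P)"
      by (rule nn_integral_indicator[symmetric]) fact
    also have "\<dots> \<le> (\<integral>\<^sup>+z. ennreal (sqrt 2 ^ n) * (\<Prod>i<n. ennreal (?f (z i))) \<partial>?P)"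
    proof (intro nn_integral_mono)
      fix z
      have "ennreal (sqrt 2 ^ n) * (\<Prod>i<n. ennreal (?f (z i))) = ennreal (sqrt 2 ^ n * (1 / 4) ^ card (label_class n z k))"
        by (subst prod_ennreal) (simp_all only: prod, simp_all add: ennreal_mult)
      then show "indicator ?E z \<le> ennreal (sqrt 2 ^ n) * (\<Prod>i<n. ennreal (?f (z i)))"
        using ge1[of z] by (auto simp: indicator_def ennreal_leI simp flip: ennreal_1)
    qed
    finally show ?thesis .
  qed
  also have "\<dots> = ennreal (sqrt 2 ^ n) * (\<Prod>i<n. \<integral>\<^sup>+m. ennreal (?f m) \<partial>?L)"
    by (subst nn_integral_cmult, measurable) (subst product_nn_integral_prod, auto)
  also have "\<dots> = ennreal ((sqrt 2 * (5 / 8)) ^ n)"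
    unfolding int1 power_mult_distrib by (simp add: ennreal_power ennreal_mult)
  also have "\<dots> \<le> ennreal ((9 / 10) ^ n)"
  proof (intro ennreal_leI power_mono)
    have "sqrt 2 \<le> 72 / 50" by (rule real_le_lsqrt) (auto simp: power2_eq_square)
    then show "sqrt 2 * (5 / 8) \<le> 9 / 10" by simp
  qed simp
  finally show ?thesis .
qed

section \<open>Expected error under the line mixture model\<close>

lemma emeasure_pair_fst:
  assumes "prob_space A" "prob_space B" "E \<in> sets A"
  shows "emeasure (A \<Otimes>\<^sub>M B) {q \<in> space (A \<Otimes>\<^sub>M B). fst q \<in> E} = emeasure A E"
proof -
  interpret B: prob_space B by fact
  have "{q \<in> space (A \<Otimes>\<^sub>M B). fst q \<in> E} = E \<times> space B"
    using sets.sets_into_space[OF assms(3)] by (auto simp: space_pair_measure)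
  then show ?thesis using assms by (simp add: B.emeasure_pair_measure_Times B.emeasure_space_1)
qed

lemma emeasure_pair_snd:
  assumes "prob_space A" "prob_space B" "E \<in> sets B"
  shows "emeasure (A \<Otimes>\<^sub>M B) {q \<in> space (A \<Otimes>\<^sub>M B). snd q \<in> E} = emeasure B E"
proof -
  interpret A: prob_space A by fact
  interpret B: prob_space B by fact
  have "{q \<in> space (A \<Otimes>\<^sub>M B). snd q \<in> E} = space A \<times> E"
    using sets.sets_into_space[OF assms(3)] by (auto simp: space_pair_measure)
  then show ?thesis using assms by (simp add: B.emeasure_pair_measure_Times A.emeasure_space_1)
qed

definition label_law :: "nat \<Rightarrow> (nat \<Rightarrow> nat) measure" where
  "label_law N = (\<Pi>\<^sub>M i\<in>{..<N}. measure_pmf (pmf_of_set {0, 1}))"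

text \<open>
  The independent labels, positions on the lines and noise vectors from which the samples are formed.
\<close>

definition latent_law :: "nat \<Rightarrow> real measure \<Rightarrow> ((nat \<Rightarrow> nat) \<times> (nat \<Rightarrow> real) \<times> (nat \<Rightarrow> plane)) measure" where
  "latent_law N \<nu> = label_law N \<Otimes>\<^sub>M ((\<Pi>\<^sub>M i\<in>{..<N}. \<nu>) \<Otimes>\<^sub>M (\<Pi>\<^sub>M i\<in>{..<N}. std_gauss_plane))"

definition samples :: "nat \<Rightarrow> (nat \<Rightarrow> plane) \<Rightarrow> real \<Rightarrow> (nat \<Rightarrow> nat) \<times> (nat \<Rightarrow> real) \<times> (nat \<Rightarrow> plane)
    \<Rightarrow> (nat \<Rightarrow> nat) \<times> (nat \<Rightarrow> plane)" where
  "samples N v \<sigma> = (\<lambda>(z, V, Y). (z, \<lambda>i\<in>{..<N}. V i *\<^sub>R v (z i) + \<sigma> *\<^sub>R Y i))"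

lemma GLMM_eq_distr:
  "GLMM N v \<nu> \<sigma> = distr (latent_law N \<nu>) (label_space N \<Otimes>\<^sub>M sample_space N) (samples N v \<sigma>)"
  by (simp add: GLMM_def latent_law_def label_law_def samples_def)

lemma sets_label_law: "sets (label_law N) = sets (label_space N)"
  unfolding label_law_def label_space_def by (rule sets_PiM_cong) auto

lemma prob_space_label_law: "prob_space (label_law N)"
  unfolding label_law_def by (rule prob_space_PiM) (rule prob_space_measure_pmf)

lemma sets_PiM_component:
  assumes "m \<in> I" "A \<in> sets (M m)"
  shows "{w \<in> space (PiM I M). w m \<in> A} \<in> sets (PiM I M)"
proof -
  have "(\<lambda>w. w m) -` A \<inter> space (PiM I M) \<in> sets (PiM I M)"
    using measurable_component_singleton[OF assms(1)] assms(2) by (rule measurable_sets)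
  then show ?thesis by (simp add: vimage_def Int_def conj_commute)
qed

lemma label_law_null:
  assumes "m < N"
  shows "{z \<in> space (label_law N). z m \<in> - {..<2}} \<in> null_sets (label_law N)"
proof -
  have "emeasure (label_law N) {z \<in> space (label_law N). z m \<in> - {..<2}}
      = emeasure (measure_pmf (pmf_of_set {0, 1::nat})) (- {..<2})"
    unfolding label_law_def using assms
    by (intro emeasure_PiM_component prob_space_measure_pmf) auto
  also have "\<dots> = 0" by (auto simp: emeasure_pmf_of_set)
  finally have "emeasure (label_law N) {z \<in> space (label_law N). z m \<in> - {..<2}} = 0" .
  moreover have "{z \<in> space (label_law N). z m \<in> - {..<2}} \<in> sets (label_law N)"
    unfolding label_law_def using assms by (intro sets_PiM_component) auto
  ultimately show ?thesis by (simp only: null_sets_def mem_Collect_eq)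
qed

lemma measurable_label [measurable]:
  "i < N \<Longrightarrow> (\<lambda>z. z i) \<in> label_space N \<rightarrow>\<^sub>M count_space UNIV"
  unfolding label_space_def by measurable

lemma measurable_sample [measurable]:
  "i < N \<Longrightarrow> (\<lambda>x. x i) \<in> sample_space N \<rightarrow>\<^sub>M borel"
  unfolding sample_space_def by measurable

lemma measurable_samples:
  assumes [measurable_cong, simp]: "sets \<nu> = sets borel"
  shows "samples N v \<sigma> \<in> latent_law N \<nu> \<rightarrow>\<^sub>M label_space N \<Otimes>\<^sub>M sample_space N"
proof -
  note sets_label_law [measurable_cong]
  have [measurable]: "(\<lambda>q. V q i *\<^sub>R v (z q i) + \<sigma> *\<^sub>R Y q i) \<in> borel_measurable M"
    if "i < N" "z \<in> M \<rightarrow>\<^sub>M label_law N" "V \<in> M \<rightarrow>\<^sub>M (\<Pi>\<^sub>M i\<in>{..<N}. \<nu>)"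
      "Y \<in> M \<rightarrow>\<^sub>M (\<Pi>\<^sub>M i\<in>{..<N}. std_gauss_plane)" for i z V Y and M :: "'c measure"
  proof -
    have "(\<lambda>q. z q i) \<in> M \<rightarrow>\<^sub>M count_space UNIV"
      using measurable_compose[OF that(2), of "\<lambda>z. z i"] that(1) by simp
    then have "(\<lambda>q. v (z q i)) \<in> borel_measurable M"
      by (rule measurable_compose) simp
    moreover have "(\<lambda>q. V q i) \<in> borel_measurable M"
      using measurable_compose[OF that(3), of "\<lambda>V. V i" borel] that(1) by simp
    moreover have "(\<lambda>q. Y q i) \<in> borel_measurable M"
      using measurable_compose[OF that(4) measurable_component_singleton[of i]] that(1)
      by (simp add: measurable_cong_sets[OF refl sets_std_gauss_plane])
    ultimately show ?thesis by simp
  qed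
  show ?thesis
    unfolding samples_def latent_law_def sample_space_def case_prod_unfold
  proof (intro measurable_Pair measurable_restrict)
    show "fst \<in> label_law N \<Otimes>\<^sub>M ((\<Pi>\<^sub>M i\<in>{..<N}. \<nu>) \<Otimes>\<^sub>M (\<Pi>\<^sub>M i\<in>{..<N}. std_gauss_plane)) \<rightarrow>\<^sub>M label_space N"
      by measurable
  qed auto
qed

lemma measurable_misjudged:
  assumes "i < N" "j < N" "k < N"
  shows "{w \<in> space (label_space N \<Otimes>\<^sub>M sample_space N). misjudged t (fst w) (snd w) i j k}
    \<in> sets (label_space N \<Otimes>\<^sub>M sample_space N)"
proof -
  let ?S = "label_space N \<Otimes>\<^sub>M sample_space N"
  have z: "(\<lambda>w. fst w m) \<in> borel_measurable ?S" if "m < N" for m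
    using measurable_compose[OF measurable_compose[OF measurable_fst measurable_label[OF that]], of id borel] by simp
  have x: "(\<lambda>w. snd w m) \<in> borel_measurable ?S" if "m < N" for m
    by (rule measurable_compose[OF measurable_snd measurable_sample[OF that]])
  note [measurable] = z[OF assms(1)] z[OF assms(2)] z[OF assms(3)] x[OF assms(1)] x[OF assms(2)] x[OF assms(3)]
  show ?thesis unfolding misjudged_def by measurable
qed

text \<open>
  Up to the null event that a label or a position is out of range, a misjudged triple has a long noise
  vector or one of three small products. These six events do not involve the labels, so that the
  independent components of the latent law can be treated one at a time.
\<close>

lemma emeasure_GLMM_misjudged:
  fixes v :: "nat \<Rightarrow> plane" and \<nu> :: "real measure"
  assumes v: "norm (v 0) = 1" "norm (v 1) = 1" "cross_det (v 0) (v 1) \<noteq> 0"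
    and \<nu>: "prob_space \<nu>" "sets \<nu> = sets borel"
    and M: "M \<ge> 0" "\<And>x r. r > 0 \<Longrightarrow> measure \<nu> {y. \<bar>y - x\<bar> \<le> r} \<le> M * (2 * r) powr \<rho>"
    and K: "K > 0" "emeasure \<nu> {x. K < \<bar>x\<bar>} = 0"
    and pos: "0 < \<sigma>" "0 < t"
    and ijk: "i < N" "j < N" "k < N" "distinct [i, j, k]"
  defines "s \<equiv> 24 * K * t / \<bar>cross_det (v 0) (v 1)\<bar>"
  shows "emeasure (GLMM N v \<nu> \<sigma>)
      {w \<in> space (label_space N \<Otimes>\<^sub>M sample_space N). misjudged t (fst w) (snd w) i j k}
    \<le> ennreal (6 * exp (- (t / (2 * \<sigma>))\<^sup>2 / 4)
        + 3 * (real J * (M\<^sup>2 * (8 * s) powr \<rho>) + M * (2 * K / 2 ^ J) powr \<rho>))"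
proof -
  note \<nu>(2) [measurable_cong, simp]
  note sets_label_law [measurable_cong]
  let ?PV = "\<Pi>\<^sub>M i\<in>{..<N}. \<nu>" and ?PY = "\<Pi>\<^sub>M i\<in>{..<N}. std_gauss_plane"
  let ?Q = "latent_law N \<nu>" and ?S = "label_space N \<Otimes>\<^sub>M sample_space N"
  have PV: "prob_space ?PV" by (rule prob_space_PiM) (rule \<nu>)
  have PY: "prob_space ?PY" by (rule prob_space_PiM) (rule prob_space_std_gauss_plane)
  have PVY: "prob_space (?PV \<Otimes>\<^sub>M ?PY)" using PV PY by (rule prob_space_pair)
  have s: "s > 0" using K pos v by (simp add: s_def)
  let ?I = "{i, j, k}"
  have I: "m < N" if "m \<in> ?I" for m using that ijk by auto
  define tail where "tail = 2 * exp (- (t / (2 * \<sigma>))\<^sup>2 / 4)"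
  define d where "d = real J * (M\<^sup>2 * (8 * s) powr \<rho>) + M * (2 * K / 2 ^ J) powr \<rho>"
  have d0: "d \<ge> 0" using M by (simp add: d_def)
  have law_Z: "emeasure ?Q {q \<in> space ?Q. fst q \<in> E} = emeasure (label_law N) E" if "E \<in> sets (label_law N)" for E
    unfolding latent_law_def using prob_space_label_law PVY that by (rule emeasure_pair_fst)
  have law_V: "emeasure ?Q {q \<in> space ?Q. fst (snd q) \<in> E} = emeasure ?PV E" if "E \<in> sets ?PV" for E
  proof -
    have "{w \<in> space (?PV \<Otimes>\<^sub>M ?PY). fst w \<in> E} \<in> sets (?PV \<Otimes>\<^sub>M ?PY)" using that by measurable
    from emeasure_pair_snd[OF prob_space_label_law[of N] PVY this] emeasure_pair_fst[OF PV PY that]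
    show ?thesis unfolding latent_law_def
      by (simp add: space_pair_measure mem_Times_iff conj_ac cong: conj_cong)
  qed
  have law_Y: "emeasure ?Q {q \<in> space ?Q. snd (snd q) \<in> E} = emeasure ?PY E" if "E \<in> sets ?PY" for E
  proof -
    have "{w \<in> space (?PV \<Otimes>\<^sub>M ?PY). snd w \<in> E} \<in> sets (?PV \<Otimes>\<^sub>M ?PY)" using that by measurable
    from emeasure_pair_snd[OF prob_space_label_law[of N] PVY this] emeasure_pair_snd[OF PV PY that]
    show ?thesis unfolding latent_law_def
      by (simp add: space_pair_measure mem_Times_iff conj_ac cong: conj_cong)
  qed
  have [measurable]: "(\<lambda>q. fst q) \<in> ?Q \<rightarrow>\<^sub>M label_law N" "(\<lambda>q. fst (snd q)) \<in> ?Q \<rightarrow>\<^sub>M ?PV"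
    "(\<lambda>q. snd (snd q)) \<in> ?Q \<rightarrow>\<^sub>M ?PY"
    unfolding latent_law_def by measurable
  define BZ where "BZ m = {q \<in> space ?Q. fst q \<in> {z \<in> space (label_law N). z m \<in> - {..<2}}}" for m
  define BV where "BV m = {q \<in> space ?Q. fst (snd q) \<in> {V \<in> space ?PV. V m \<in> {x. K < \<bar>x\<bar>}}}" for m
  define BY where "BY m = {q \<in> space ?Q. snd (snd q) \<in> {Y \<in> space ?PY. Y m \<in> {y. t / (2 * \<sigma>) < norm y}}}" for m
  define BP where "BP c a b = {q \<in> space ?Q. fst (snd q) \<in>
      {V \<in> space ?PV. \<bar>V c\<bar> \<le> K \<and> \<bar>V c\<bar> * \<bar>V a - V b\<bar> \<le> s}}" for c a b
  have BZ: "BZ m \<in> sets ?Q \<and> emeasure ?Q (BZ m) = 0" if "m \<in> ?I" for m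
  proof -
    note null = label_law_null[OF I[OF that]]
    note [measurable] = null_setsD2[OF null]
    have "emeasure ?Q (BZ m) = 0"
      unfolding BZ_def law_Z[OF null_setsD2[OF null]] by (rule null_setsD1[OF null])
    moreover have "BZ m \<in> sets ?Q" unfolding BZ_def by measurable
    ultimately show ?thesis by simp
  qed
  have BV: "BV m \<in> sets ?Q \<and> emeasure ?Q (BV m) = 0" if "m \<in> ?I" for m
  proof -
    have *[measurable]: "{V \<in> space ?PV. V m \<in> {x. K < \<bar>x\<bar>}} \<in> sets ?PV"
      using I[OF that] by (intro sets_PiM_component) auto
    have "emeasure ?Q (BV m) = 0"
      unfolding BV_def using I[OF that] K \<nu>
      by (subst law_V[OF *], subst emeasure_PiM_component) auto
    moreover have "BV m \<in> sets ?Q" unfolding BV_def by measurable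
    ultimately show ?thesis by simp
  qed
  have BY: "BY m \<in> sets ?Q \<and> emeasure ?Q (BY m) \<le> ennreal tail" if "m \<in> ?I" for m
  proof -
    have *[measurable]: "{Y \<in> space ?PY. Y m \<in> {y. t / (2 * \<sigma>) < norm y}} \<in> sets ?PY"
      using I[OF that] by (intro sets_PiM_component) auto
    have "emeasure ?Q (BY m) \<le> ennreal tail"
      unfolding BY_def tail_def using I[OF that] pos std_gauss_plane_tail[of "t / (2 * \<sigma>)"]
      by (subst law_Y[OF *], subst emeasure_PiM_component) (auto simp: prob_space_std_gauss_plane)
    moreover have "BY m \<in> sets ?Q" unfolding BY_def by measurable
    ultimately show ?thesis by simp
  qed
  have BP: "BP c a b \<in> sets ?Q \<and> emeasure ?Q (BP c a b) \<le> ennreal d"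
    if "a \<in> ?I" "b \<in> ?I" "c \<in> ?I" "a \<noteq> b" "a \<noteq> c" for a b c
  proof -
    have *[measurable]: "{V \<in> space ?PV. \<bar>V c\<bar> \<le> K \<and> \<bar>V c\<bar> * \<bar>V a - V b\<bar> \<le> s} \<in> sets ?PV"
    proof -
      have "a \<in> {..<N}" "b \<in> {..<N}" "c \<in> {..<N}"
        using I[OF that(1)] I[OF that(2)] I[OF that(3)] by auto
      then show ?thesis by measurable
    qed
    have "emeasure ?Q (BP c a b) \<le> ennreal d"
      unfolding BP_def d_def law_V[OF *]
      using I that by (intro PiM_product_small_powr[OF \<nu> _ _ _ _ _ _ M K(1) s]) auto
    moreover have "BP c a b \<in> sets ?Q" unfolding BP_def by measurable
    ultimately show ?thesis by simp
  qed
  let ?E = "{w \<in> space ?S. misjudged t (fst w) (snd w) i j k}"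
  let ?nul = "\<Union>m\<in>?I. BZ m \<union> BV m"
  have nul: "?nul \<in> null_sets ?Q"
    using BZ BV by (intro null_sets.finite_UN null_sets.Un) (auto simp: null_sets_def)
  let ?B = "(BY i \<union> BY j \<union> BY k) \<union> (BP i j k \<union> BP j i k \<union> BP k i j)"
  have sub: "samples N v \<sigma> -` ?E \<inter> space ?Q \<subseteq> ?B \<union> ?nul"
  proof
    fix q assume q: "q \<in> samples N v \<sigma> -` ?E \<inter> space ?Q"
    obtain z V Y where q_eq: "q = (z, V, Y)" by (cases q) auto
    define x where "x = (\<lambda>i\<in>{..<N}. V i *\<^sub>R v (z i) + \<sigma> *\<^sub>R Y i)"
    have mis: "misjudged t z x i j k" using q by (simp add: q_eq samples_def x_def)
    have sp: "q \<in> space ?Q" "z \<in> space (label_law N)" "V \<in> space ?PV" "Y \<in> space ?PY"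
      using q by (auto simp: q_eq latent_law_def space_pair_measure)
    show "q \<in> ?B \<union> ?nul"
    proof (rule ccontr)
      assume "q \<notin> ?B \<union> ?nul"
      then have nB: "q \<notin> ?B" and "\<forall>m\<in>?I. q \<notin> BZ m \<and> q \<notin> BV m" by auto
      then have zm: "z m < 2" and Vm: "\<bar>V m\<bar> \<le> K" if "m \<in> ?I" for m
        using that sp by (force simp: BZ_def BV_def q_eq)+
      have "q \<notin> BY m" if "m \<in> ?I" for m using nB that by auto
      then have Ym: "norm (Y m) \<le> t / (2 * \<sigma>)" if "m \<in> ?I" for m
        using that sp by (force simp: BY_def q_eq)
      have noise: "norm (x m - V m *\<^sub>R v (z m)) \<le> t / 2" if "m \<in> ?I" for m
      proof -
        have "norm (x m - V m *\<^sub>R v (z m)) = \<sigma> * norm (Y m)" using I[OF that] pos by (simp add: x_def)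
        also have "\<dots> \<le> \<sigma> * (t / (2 * \<sigma>))" using Ym[OF that] pos by (intro mult_left_mono) auto
        finally show ?thesis using pos by simp
      qed
      have "\<bar>V i\<bar> * \<bar>V j - V k\<bar> \<le> s \<or> \<bar>V j\<bar> * \<bar>V i - V k\<bar> \<le> s \<or> \<bar>V k\<bar> * \<bar>V i - V j\<bar> \<le> s"
        unfolding s_def by (rule misjudged_cover[OF pos(2) v zm zm zm Vm Vm Vm noise noise noise mis]) auto
      then show False using nB sp Vm[of i] Vm[of j] Vm[of k] by (auto simp: BP_def q_eq)
    qed
  qed
  have Bi: "BP i j k \<in> sets ?Q \<and> emeasure ?Q (BP i j k) \<le> ennreal d"
    and Bj: "BP j i k \<in> sets ?Q \<and> emeasure ?Q (BP j i k) \<le> ennreal d"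
    and Bk: "BP k i j \<in> sets ?Q \<and> emeasure ?Q (BP k i j) \<le> ennreal d"
    using ijk(4) by (intro BP; simp)+
  have union3: "A \<union> B \<union> C \<in> sets ?Q \<and> emeasure ?Q (A \<union> B \<union> C) \<le> ennreal (3 * e)"
    if "A \<in> sets ?Q \<and> emeasure ?Q A \<le> ennreal e" "B \<in> sets ?Q \<and> emeasure ?Q B \<le> ennreal e"
      "C \<in> sets ?Q \<and> emeasure ?Q C \<le> ennreal e" "e \<ge> 0" for A B C e
  proof -
    have "emeasure ?Q (A \<union> B \<union> C) \<le> emeasure ?Q (A \<union> B) + emeasure ?Q C"
      using that by (intro emeasure_subadditive) auto
    also have "\<dots> \<le> emeasure ?Q A + emeasure ?Q B + emeasure ?Q C"
      using that by (intro add_right_mono emeasure_subadditive) auto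
    also have "\<dots> \<le> ennreal e + ennreal e + ennreal e" using that by (intro add_mono) auto
    also have "\<dots> = ennreal (3 * e)" using that(4) by (simp flip: ennreal_plus)
    finally show ?thesis using that by auto
  qed
  have uY: "BY i \<union> BY j \<union> BY k \<in> sets ?Q \<and> emeasure ?Q (BY i \<union> BY j \<union> BY k) \<le> ennreal (3 * tail)"
    by (rule union3) (use BY in \<open>auto simp: tail_def\<close>)
  have uP: "BP i j k \<union> BP j i k \<union> BP k i j \<in> sets ?Q \<and>
      emeasure ?Q (BP i j k \<union> BP j i k \<union> BP k i j) \<le> ennreal (3 * d)"
    by (rule union3[OF Bi Bj Bk d0])
  have "emeasure (GLMM N v \<nu> \<sigma>) ?E = emeasure ?Q (samples N v \<sigma> -` ?E \<inter> space ?Q)"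
    unfolding GLMM_eq_distr using measurable_samples[OF \<nu>(2)] measurable_misjudged[OF ijk(1,2,3)]
    by (rule emeasure_distr)
  also have "\<dots> \<le> emeasure ?Q (?B \<union> ?nul)"
    using sub uY uP nul by (intro emeasure_mono) auto
  also have "\<dots> = emeasure ?Q ?B"
    using nul uY uP by (intro emeasure_Un_null_set) auto
  also have "\<dots> \<le> emeasure ?Q (BY i \<union> BY j \<union> BY k) + emeasure ?Q (BP i j k \<union> BP j i k \<union> BP k i j)"
    using uY uP by (intro emeasure_subadditive) auto
  also have "\<dots> \<le> ennreal (3 * tail) + ennreal (3 * d)" using uY uP by (intro add_mono) auto
  also have "\<dots> = ennreal (3 * tail + 3 * d)" using d0 by (simp add: tail_def flip: ennreal_plus)
  finally show ?thesis by (simp add: tail_def d_def)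
qed

definition balanced :: "nat \<Rightarrow> (nat \<Rightarrow> nat) \<Rightarrow> bool" where
  "balanced n z \<longleftrightarrow> (\<forall>i<n. z i < 2) \<and> (\<forall>k<2. real n / 4 \<le> class_size n z k)"

lemma measurable_unbalanced:
  "{w \<in> space (label_space N \<Otimes>\<^sub>M sample_space N). \<not> balanced N (fst w)}
    \<in> sets (label_space N \<Otimes>\<^sub>M sample_space N)"
proof -
  have "{w \<in> space (label_space N \<Otimes>\<^sub>M sample_space N). \<not> balanced N (fst w)} =
     (\<Union>i<N. {w \<in> space (label_space N \<Otimes>\<^sub>M sample_space N). \<not> fst w i < 2}) \<union>
     (\<Union>k<2. {w \<in> space (label_space N \<Otimes>\<^sub>M sample_space N). \<not> real N / 4 \<le> class_size N (fst w) k})"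
    by (auto simp: balanced_def)
  also have "\<dots> \<in> sets (label_space N \<Otimes>\<^sub>M sample_space N)"
    unfolding class_size_eq_sum by (intro sets.Un sets.finite_UN) (simp_all, measurable)
  finally show ?thesis .
qed

lemma emeasure_GLMM_unbalanced:
  assumes N: "N > 0" and \<nu>: "prob_space \<nu>" "sets \<nu> = sets borel"
  shows "emeasure (GLMM N v \<nu> \<sigma>) {w \<in> space (label_space N \<Otimes>\<^sub>M sample_space N). \<not> balanced N (fst w)}
    \<le> ennreal (2 * (9 / 10) ^ N)"
proof -
  let ?S = "label_space N \<Otimes>\<^sub>M sample_space N" and ?Q = "latent_law N \<nu>" and ?L = "label_law N"
  have PVY: "prob_space ((\<Pi>\<^sub>M i\<in>{..<N}. \<nu>) \<Otimes>\<^sub>M (\<Pi>\<^sub>M i\<in>{..<N}. std_gauss_plane))"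
    by (intro prob_space_pair prob_space_PiM \<nu> prob_space_std_gauss_plane)
  define C where "C k = {z \<in> space ?L. class_size N z k < real N / 4}" for k
  define D where "D i = {z \<in> space ?L. z i \<in> - {..<2}}" for i
  have C: "C k \<in> sets ?L" for k unfolding C_def class_size_eq_sum label_law_def by measurable
  let ?n = "\<Union>i<N. D i"
  have n: "?n \<in> null_sets ?L" unfolding D_def by (intro null_sets.finite_UN label_law_null) auto
  have E: "{z \<in> space ?L. \<not> balanced N z} = (C 0 \<union> C 1) \<union> ?n"
    by (auto simp: balanced_def C_def D_def not_le less_2_cases_iff)
  have Es: "{z \<in> space ?L. \<not> balanced N z} \<in> sets ?L"
    unfolding E using C n by auto
  have "samples N v \<sigma> -` {w \<in> space ?S. \<not> balanced N (fst w)} \<inter> space ?Q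
      = {q \<in> space ?Q. fst q \<in> {z \<in> space ?L. \<not> balanced N z}}"
    using measurable_space[OF measurable_samples[OF \<nu>(2)], of _ N v \<sigma>]
    by (auto simp: samples_def latent_law_def space_pair_measure)
  then have "emeasure (GLMM N v \<nu> \<sigma>) {w \<in> space ?S. \<not> balanced N (fst w)}
      = emeasure ?Q {q \<in> space ?Q. fst q \<in> {z \<in> space ?L. \<not> balanced N z}}"
    unfolding GLMM_eq_distr using emeasure_distr[OF measurable_samples[OF \<nu>(2)] measurable_unbalanced]
    by simp
  also have "\<dots> = emeasure ?L {z \<in> space ?L. \<not> balanced N z}"
    unfolding latent_law_def using prob_space_label_law PVY Es by (rule emeasure_pair_fst)
  also have "\<dots> = emeasure ?L (C 0 \<union> C 1)"
    unfolding E using n C by (intro emeasure_Un_null_set) auto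
  also have "\<dots> \<le> emeasure ?L (C 0) + emeasure ?L (C 1)" using C by (intro emeasure_subadditive) auto
  also have "\<dots> \<le> ennreal ((9 / 10) ^ N) + ennreal ((9 / 10) ^ N)"
    unfolding C_def label_law_def by (intro add_mono PiM_uniform_label_class_small N) auto
  also have "\<dots> = ennreal (2 * (9 / 10) ^ N)" by (simp flip: ennreal_plus)
  finally show ?thesis .
qed

text \<open>
  On the event that the classes are balanced the error is at most a multiple of the number of misjudged
  triples, and there are at most N^3 ordered triples; otherwise it is at most N.
\<close>

lemma expected_error_bound:
  assumes N: "N \<ge> 16" and MM: "prob_space MM" and \<nu>: "prob_space \<nu>" "sets \<nu> = sets borel" and \<epsilon>: "\<epsilon> > 0"
    and sam: "sampled_from_GLMM MM N v \<nu> \<sigma> Z X"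
    and out: "\<And>\<omega>. \<omega> \<in> space MM \<Longrightarrow> spectral_output N t \<epsilon> (X \<omega>) (Zhat \<omega>)"
    and p: "p \<ge> 0" "\<And>i j k. \<lbrakk>i < N; j < N; k < N; distinct [i, j, k]\<rbrakk> \<Longrightarrow>
      emeasure (GLMM N v \<nu> \<sigma>)
        {w \<in> space (label_space N \<Otimes>\<^sub>M sample_space N). misjudged t (fst w) (snd w) i j k} \<le> ennreal p"
  shows "(\<integral>\<omega>. real (Ham_star N (Zhat \<omega>) (Z \<omega>)) \<partial>MM)
    \<le> 2 * real N * (9 / 10) ^ N + (32 + 16 * \<epsilon>) * 128\<^sup>2 * (real N * p)"
proof -
  interpret prob_space MM by (rule MM)
  let ?S = "label_space N \<Otimes>\<^sub>M sample_space N"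
  let ?C = "(32 + 16 * \<epsilon>) * 128\<^sup>2"
  have C0: "?C \<ge> 0" using \<epsilon> by simp
  have ZX: "(\<lambda>\<omega>. (Z \<omega>, X \<omega>)) \<in> MM \<rightarrow>\<^sub>M ?S" and law: "distr MM ?S (\<lambda>\<omega>. (Z \<omega>, X \<omega>)) = GLMM N v \<nu> \<sigma>"
    using sam by (auto simp: sampled_from_GLMM_def)
  have pull: "{\<omega> \<in> space MM. P (Z \<omega>) (X \<omega>)} \<in> events"
      "emeasure MM {\<omega> \<in> space MM. P (Z \<omega>) (X \<omega>)} = emeasure (GLMM N v \<nu> \<sigma>) {w \<in> space ?S. P (fst w) (snd w)}"
    if "{w \<in> space ?S. P (fst w) (snd w)} \<in> sets ?S" for P
  proof -
    have eq: "{\<omega> \<in> space MM. P (Z \<omega>) (X \<omega>)} = (\<lambda>\<omega>. (Z \<omega>, X \<omega>)) -` {w \<in> space ?S. P (fst w) (snd w)} \<inter> space MM"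
      using measurable_space[OF ZX] by auto
    show "{\<omega> \<in> space MM. P (Z \<omega>) (X \<omega>)} \<in> events"
      unfolding eq using ZX that by (rule measurable_sets)
    show "emeasure MM {\<omega> \<in> space MM. P (Z \<omega>) (X \<omega>)} = emeasure (GLMM N v \<nu> \<sigma>) {w \<in> space ?S. P (fst w) (snd w)}"
      unfolding eq law[symmetric] using ZX that by (rule emeasure_distr[symmetric])
  qed
  define Bad where "Bad = {\<omega> \<in> space MM. \<not> balanced N (Z \<omega>)}"
  define Mis where "Mis i j k = {\<omega> \<in> space MM. distinct [i, j, k] \<and> misjudged t (Z \<omega>) (X \<omega>) i j k}" for i j k
  have Bad: "Bad \<in> events" "prob Bad \<le> 2 * (9 / 10) ^ N"
  proof -
    show "Bad \<in> events" unfolding Bad_def by (rule pull(1)[OF measurable_unbalanced])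
    have "emeasure MM Bad \<le> ennreal (2 * (9 / 10) ^ N)"
      unfolding Bad_def pull(2)[OF measurable_unbalanced]
      using N \<nu> by (intro emeasure_GLMM_unbalanced) auto
    then show "prob Bad \<le> 2 * (9 / 10) ^ N" by (simp add: emeasure_eq_measure)
  qed
  have Mis: "Mis i j k \<in> events" "prob (Mis i j k) \<le> p" if ijk: "i < N" "j < N" "k < N" for i j k
  proof -
    have "Mis i j k \<in> events \<and> prob (Mis i j k) \<le> p"
    proof (cases "distinct [i, j, k]")
      case True
      then have eq: "Mis i j k = {\<omega> \<in> space MM. misjudged t (Z \<omega>) (X \<omega>) i j k}" by (simp add: Mis_def)
      have "emeasure MM (Mis i j k) \<le> ennreal p"
        unfolding eq pull(2)[OF measurable_misjudged[OF ijk]] by (rule p(2)[OF ijk True])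
      then show ?thesis
        using pull(1)[OF measurable_misjudged[OF ijk]] p(1) by (simp add: eq emeasure_eq_measure)
    next
      case False
      then have "Mis i j k = {}" by (auto simp: Mis_def)
      then show ?thesis using p(1) by simp
    qed
    then show "Mis i j k \<in> events" "prob (Mis i j k) \<le> p" by auto
  qed
  define cnt where "cnt \<omega> = (\<Sum>i<N. \<Sum>j<N. \<Sum>k<N. indicat_real (Mis i j k) \<omega>)" for \<omega>
  have cnt_int: "integrable MM cnt" unfolding cnt_def using Mis(1)
    by (intro Bochner_Integration.integrable_sum integrable_real_indicator) (auto simp: emeasure_eq_measure)
  have "(\<integral>\<omega>. cnt \<omega> \<partial>MM) = (\<Sum>i<N. \<Sum>j<N. \<Sum>k<N. prob (Mis i j k))"
    unfolding cnt_def using Mis(1)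
    by (subst Bochner_Integration.integral_sum,
        (intro Bochner_Integration.integrable_sum integrable_real_indicator; simp add: emeasure_eq_measure), intro sum.cong refl)+
      (simp add: Int_absorb2 sets.sets_into_space)
  also have "\<dots> \<le> (\<Sum>i<N. \<Sum>j<N. \<Sum>k<N. p)" using Mis(2) by (intro sum_mono) auto
  finally have cnt_le: "(\<integral>\<omega>. cnt \<omega> \<partial>MM) \<le> real N * (real N * (real N * p))" by simp
  \<comment> \<open>a measurable majorant of the error\<close>
  define g where "g \<omega> = real N * indicat_real Bad \<omega> + ?C / (real N)\<^sup>2 * cnt \<omega>" for \<omega>
  have g_int: "integrable MM g"
    unfolding g_def using Bad(1) cnt_int by (simp add: emeasure_eq_measure)
  have cnt0: "cnt \<omega> \<ge> 0" for \<omega> by (simp add: cnt_def sum_nonneg)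
  have g0: "g \<omega> \<ge> 0" for \<omega> using C0 cnt0 by (simp add: g_def)
  have le: "real (Ham_star N (Zhat \<omega>) (Z \<omega>)) \<le> g \<omega>" if \<omega>: "\<omega> \<in> space MM" for \<omega>
  proof (cases "balanced N (Z \<omega>)")
    case True
    have "cnt \<omega> = misjudged_count N t (Z \<omega>) (X \<omega>)"
      unfolding cnt_def misjudged_count_def using \<omega>
      by (intro sum.cong refl) (auto simp: Mis_def indicator_def)
    then have "real (Ham_star N (Zhat \<omega>) (Z \<omega>)) \<le> ?C * cnt \<omega> / (real N)\<^sup>2"
      using spectral_output_error[OF _ _ N \<epsilon> out[OF \<omega>], of "Z \<omega>"] True by (simp add: balanced_def)
    also have "\<dots> \<le> g \<omega>" by (simp add: g_def)
    finally show ?thesis .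
  next
    case False
    have "real (Ham_star N (Zhat \<omega>) (Z \<omega>)) \<le> real N"
      using Ham_star_le_half[of N "Zhat \<omega>" "Z \<omega>"] by linarith
    also have "\<dots> \<le> g \<omega>" using False \<omega> C0 cnt0 by (simp add: g_def Bad_def)
    finally show ?thesis .
  qed
  have "(\<integral>\<omega>. real (Ham_star N (Zhat \<omega>) (Z \<omega>)) \<partial>MM) \<le> (\<integral>\<omega>. g \<omega> \<partial>MM)"
    using g_int le g0 by (intro integral_mono') auto
  also have "\<dots> = real N * prob Bad + ?C / (real N)\<^sup>2 * (\<integral>\<omega>. cnt \<omega> \<partial>MM)"
    unfolding g_def using Bad(1) cnt_int by (simp add: emeasure_eq_measure)
  also have "\<dots> \<le> real N * (2 * (9 / 10) ^ N) + ?C / (real N)\<^sup>2 * (real N * (real N * (real N * p)))"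
    using Bad(2) cnt_le C0 by (intro add_mono mult_left_mono) auto
  also have "\<dots> = 2 * real N * (9 / 10) ^ N + ?C * (real N * p)"
    using N by (simp add: power2_eq_square)
  finally show ?thesis .
qed

section \<open>Limits in both regimes\<close>

text \<open>
  The bound on the probability that a triple is misjudged. M and \<rho> bound the mass of intervals, K bounds
  the support, c depends on K and on the angle, and J is the number of dyadic shells.
\<close>

definition triple_bound :: "real \<Rightarrow> real \<Rightarrow> real \<Rightarrow> real \<Rightarrow> real \<Rightarrow> real \<Rightarrow> nat \<Rightarrow> real" where
  "triple_bound \<rho> M K c \<sigma> t J = 6 * exp (- (t / (2 * \<sigma>))\<^sup>2 / 4)
     + 3 * (real J * (M\<^sup>2 * (8 * (c * t)) powr \<rho>) + M * (2 * K / 2 ^ J) powr \<rho>)"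

lemma gauss_tail_tendsto_0:
  assumes "\<And>N. 0 < \<sigma> N" "\<And>N. 0 < t N" "\<sigma> \<lless> t"
  shows "(\<lambda>N. exp (- (t N / (2 * \<sigma> N))\<^sup>2 / 4)) \<longlonglongrightarrow> 0"
proof -
  have "filterlim (\<lambda>N. inverse (\<sigma> N / t N)) at_top sequentially"
    using assms by (intro filterlim_inverse_at_top) (auto simp: much_less_def)
  then have "filterlim (\<lambda>N. t N / \<sigma> N) at_top sequentially" by simp
  moreover have "((\<lambda>x. exp (- (x / 2)\<^sup>2 / 4)) \<longlongrightarrow> (0::real)) at_top" by real_asymp
  ultimately have "(\<lambda>N. exp (- (t N / \<sigma> N / 2)\<^sup>2 / 4)) \<longlonglongrightarrow> 0"
    by (rule filterlim_compose[rotated])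
  then show ?thesis by (simp add: mult.commute)
qed

lemma geometric_powr_tendsto_0:
  fixes M K \<rho> :: real
  assumes "0 < \<rho>" "0 < K"
  shows "(\<lambda>J. M * (2 * K / 2 ^ J) powr \<rho>) \<longlonglongrightarrow> 0"
proof -
  have "(\<lambda>J. 2 * K / 2 ^ J :: real) \<longlonglongrightarrow> 0" by real_asymp
  then have "(\<lambda>J. (2 * K / 2 ^ J) powr \<rho>) \<longlonglongrightarrow> 0"
    using assms by (intro tendsto_zero_powrI[where b = \<rho>]) auto
  then show ?thesis using tendsto_mult_right_zero by blast
qed

text \<open>
  A diagonal argument without a diagonal sequence: first J makes b small, then N makes g small.
\<close>

lemma tendsto_0_two_scales:
  fixes f :: "nat \<Rightarrow> real"
  assumes nn: "\<And>N. 0 \<le> f N" and bound: "\<And>J. \<forall>\<^sub>F N in sequentially. f N \<le> g J N + b J"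
    and g: "\<And>J. g J \<longlonglongrightarrow> 0" and b: "b \<longlonglongrightarrow> (0::real)"
  shows "f \<longlonglongrightarrow> 0"
proof (rule order_tendstoI)
  fix e :: real assume e: "0 < e"
  then have "\<forall>\<^sub>F J in sequentially. b J < e / 2" using b by (intro order_tendstoD) auto
  then obtain J where J: "b J < e / 2" using eventually_happens sequentially_bot by blast
  have "\<forall>\<^sub>F N in sequentially. g J N < e / 2" using e g by (intro order_tendstoD) auto
  with bound[of J] show "\<forall>\<^sub>F N in sequentially. f N < e"
    by eventually_elim (use J in linarith)
next
  fix e :: real assume "e < 0"
  then show "\<forall>\<^sub>F N in sequentially. e < f N" using nn order_less_le_trans by (auto intro!: always_eventually)
qed

lemma triple_bound_shells_tendsto_0:
  assumes pos: "\<And>N. 0 < \<sigma> N" "\<And>N. 0 < t N" and \<rho>: "0 < \<rho>" and c: "0 < c"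
    and small: "\<sigma> \<lless> t" "t \<lless> (\<lambda>N. 1)"
  shows "(\<lambda>N. triple_bound \<rho> M K c (\<sigma> N) (t N) J - 3 * (M * (2 * K / 2 ^ J) powr \<rho>)) \<longlonglongrightarrow> 0"
proof -
  have "t \<longlonglongrightarrow> 0" using small(2) by (simp add: much_less_def)
  then have "(\<lambda>N. 8 * (c * t N)) \<longlonglongrightarrow> 8 * (c * 0)" by (intro tendsto_intros)
  then have "(\<lambda>N. (8 * (c * t N)) powr \<rho>) \<longlonglongrightarrow> 0"
    using \<rho> c less_imp_le[OF pos(2)] by (intro tendsto_zero_powrI[where b = \<rho>]) auto
  then have "(\<lambda>N. 6 * exp (- (t N / (2 * \<sigma> N))\<^sup>2 / 4) + 3 * (real J * (M\<^sup>2 * (8 * (c * t N)) powr \<rho>)))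
      \<longlonglongrightarrow> 6 * 0 + 3 * (real J * (M\<^sup>2 * 0))"
    by (intro tendsto_intros gauss_tail_tendsto_0 pos small(1))
  then show ?thesis by (simp add: triple_bound_def algebra_simps)
qed

text \<open>
  With J about (2/\<rho>) log N shells the remainder is of order N^(-2), and the shells cost a factor
  log N.
\<close>

lemma triple_bound_log_shells:
  assumes pos: "\<And>N. 0 < \<sigma> N" "\<And>N. 0 < t N" and \<rho>: "0 < \<rho>" and c: "0 < c" and M: "0 \<le> M" and K: "0 < K"
    and lo: "(\<lambda>N. \<sigma> N * sqrt (ln (real N))) \<lless> t"
    and hi: "t \<lless> (\<lambda>N. (real N * ln (real N)) powr (- 1 / \<rho>))"
  shows "(\<lambda>N. real N * triple_bound \<rho> M K c (\<sigma> N) (t N) (nat \<lceil>2 / \<rho> * log 2 (real N)\<rceil>)) \<longlonglongrightarrow> 0"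
proof -
  define J where "J N = nat \<lceil>2 / \<rho> * log 2 (real N)\<rceil>" for N
  define B where "B = 2 / (\<rho> * ln 2) + 1"
  define h where "h N = 6 / real N + 3 * (B * (M\<^sup>2 * (8 * c) powr \<rho>)) * (t N / (real N * ln (real N)) powr (- 1 / \<rho>)) powr \<rho>
    + 3 * (M * (2 * K) powr \<rho>) / real N" for N
  have "(\<lambda>N. (t N / (real N * ln (real N)) powr (- 1 / \<rho>)) powr \<rho>) \<longlonglongrightarrow> 0"
    using \<rho> less_imp_le[OF pos(2)] hi unfolding much_less_def
    by (intro tendsto_zero_powrI[where b = \<rho>]) auto
  then have "h \<longlonglongrightarrow> 0 + 3 * (B * (M\<^sup>2 * (8 * c) powr \<rho>)) * 0 + 0"
    unfolding h_def
    by (intro tendsto_intros lim_const_over_n)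
  then have h: "h \<longlonglongrightarrow> 0" by simp
  have "filterlim (\<lambda>N. ln (real N)) at_top sequentially" by real_asymp
  then have ln1: "\<forall>\<^sub>F N in sequentially. 1 \<le> ln (real N)" by (simp add: filterlim_at_top)
  have small: "\<forall>\<^sub>F N in sequentially. \<sigma> N * sqrt (ln (real N)) / t N < 1 / 8"
    using lo unfolding much_less_def by (rule order_tendstoD) simp
  have le: "\<forall>\<^sub>F N in sequentially. real N * triple_bound \<rho> M K c (\<sigma> N) (t N) (J N) \<le> h N"
    using ln1 small eventually_gt_at_top[of 1]
  proof eventually_elim
    case (elim N)
    define L where "L = ln (real N)"
    have L: "L \<ge> 1" and N: "real N > 1" using elim by (auto simp: L_def)
    have expL: "exp (- (2 * L)) = 1 / (real N)\<^sup>2"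
      using N by (simp add: L_def exp_minus exp_double inverse_eq_divide)
    have 1: "exp (- (t N / (2 * \<sigma> N))\<^sup>2 / 4) \<le> 1 / (real N)\<^sup>2"
    proof -
      \<comment> \<open>any ratio below 1/8 makes the Gaussian tail at most 1 / N^2\<close>
      have "8 * (\<sigma> N * sqrt L) < t N" using elim pos[of N] by (simp add: L_def field_simps)
      then have "4 * sqrt L \<le> t N / (2 * \<sigma> N)" using pos(1)[of N] by (simp add: field_simps)
      then have "(4 * sqrt L)\<^sup>2 \<le> (t N / (2 * \<sigma> N))\<^sup>2" using L by (intro power_mono) auto
      then have "16 * L \<le> (t N / (2 * \<sigma> N))\<^sup>2" using L by (simp add: power_mult_distrib)
      then have "- (t N / (2 * \<sigma> N))\<^sup>2 / 4 \<le> - (2 * L)" using L by linarith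
      then have "exp (- (t N / (2 * \<sigma> N))\<^sup>2 / 4) \<le> exp (- (2 * L))" by (simp only: exp_le_cancel_iff)
      then show ?thesis unfolding expL .
    qed
    have J_lower: "2 / \<rho> * log 2 (real N) \<le> real (J N)" unfolding J_def by linarith
    have J_upper: "real (J N) \<le> B * L"
    proof -
      have "0 \<le> 2 / \<rho> * log 2 (real N)" using N \<rho> by simp
      then have "real (J N) \<le> 2 / \<rho> * log 2 (real N) + 1" unfolding J_def by linarith
      also have "\<dots> \<le> 2 / \<rho> * (L / ln 2) + L" using L by (simp add: log_def L_def)
      also have "\<dots> = B * L" by (simp add: B_def field_simps)
      finally show ?thesis .
    qed
    have scale: "real N * L * t N powr \<rho> = (t N / (real N * L) powr (- 1 / \<rho>)) powr \<rho>"
    proof -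
      have "real N * L > 0" using N L by simp
      have "- 1 / \<rho> * \<rho> = - 1" using \<rho> by simp
      then have "((real N * L) powr (- 1 / \<rho>)) powr \<rho> = (real N * L) powr (- 1)"
        by (simp only: powr_powr)
      also have "\<dots> = 1 / (real N * L)" using \<open>real N * L > 0\<close> by (simp add: powr_minus_divide)
      finally have "((real N * L) powr (- 1 / \<rho>)) powr \<rho> = 1 / (real N * L)" .
      then show ?thesis using pos(2)[of N] by (simp only: powr_divide) simp
    qed
    have 2: "real N * (real (J N) * (M\<^sup>2 * (8 * (c * t N)) powr \<rho>))
        \<le> B * (M\<^sup>2 * (8 * c) powr \<rho>) * (t N / (real N * L) powr (- 1 / \<rho>)) powr \<rho>"
    proof -
      have "(8 * (c * t N)) powr \<rho> = (8 * c) powr \<rho> * t N powr \<rho>"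
        using c pos(2)[of N] by (simp add: powr_mult mult.assoc)
      then have "real N * (real (J N) * (M\<^sup>2 * (8 * (c * t N)) powr \<rho>))
          = real (J N) * (real N * (M\<^sup>2 * ((8 * c) powr \<rho> * t N powr \<rho>)))" by simp
      also have "\<dots> \<le> B * L * (real N * (M\<^sup>2 * ((8 * c) powr \<rho> * t N powr \<rho>)))"
        using J_upper by (intro mult_right_mono) auto
      also have "\<dots> = B * (M\<^sup>2 * (8 * c) powr \<rho>) * (real N * L * t N powr \<rho>)" by simp
      finally show ?thesis unfolding scale .
    qed
    have 3: "(2 * K / 2 ^ J N) powr \<rho> \<le> (2 * K) powr \<rho> / (real N)\<^sup>2"
    proof -
      have "(real N)\<^sup>2 = (2 powr (2 / \<rho> * log 2 (real N))) powr \<rho>"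
      proof -
        have "(2 powr (2 / \<rho> * log 2 (real N))) powr \<rho> = (2 powr log 2 (real N)) powr 2"
          using \<rho> by (simp add: powr_powr mult.commute)
        also have "\<dots> = (real N)\<^sup>2" using N by simp
        finally show ?thesis ..
      qed
      also have "\<dots> \<le> (2 powr real (J N)) powr \<rho>"
        using J_lower \<rho> by (intro powr_mono2 powr_mono) auto
      finally have "(real N)\<^sup>2 \<le> (2 ^ J N) powr \<rho>" by (simp add: powr_realpow)
      then show ?thesis using K N by (simp add: powr_divide divide_left_mono)
    qed
    have "real N * triple_bound \<rho> M K c (\<sigma> N) (t N) (J N)
      = 6 * (real N * exp (- (t N / (2 * \<sigma> N))\<^sup>2 / 4))
        + 3 * (real N * (real (J N) * (M\<^sup>2 * (8 * (c * t N)) powr \<rho>)))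
        + 3 * (M * (real N * (2 * K / 2 ^ J N) powr \<rho>))"
      by (simp add: triple_bound_def algebra_simps)
    also have "\<dots> \<le> 6 * (real N * (1 / (real N)\<^sup>2))
        + 3 * (B * (M\<^sup>2 * (8 * c) powr \<rho>) * (t N / (real N * L) powr (- 1 / \<rho>)) powr \<rho>)
        + 3 * (M * (real N * ((2 * K) powr \<rho> / (real N)\<^sup>2)))"
      using 1 2 3 M by (intro add_mono mult_left_mono) auto
    also have "\<dots> = h N" using N by (simp add: h_def L_def power2_eq_square)
    finally show ?case .
  qed
  have nonneg: "0 \<le> real N * triple_bound \<rho> M K c (\<sigma> N) (t N) (J N)" for N
    using M by (simp add: triple_bound_def)
  have "(\<lambda>N. real N * triple_bound \<rho> M K c (\<sigma> N) (t N) (J N)) \<longlonglongrightarrow> 0"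
    by (rule tendsto_sandwich[OF always_eventually le tendsto_const h]) (simp add: nonneg)
  then show ?thesis by (simp add: J_def)
qed

lemma compact_support_bound:
  assumes "compactly_supported \<nu>" "sets \<nu> = sets borel"
  obtains K where "K > 0" "emeasure \<nu> {x. K < \<bar>x\<bar>} = 0"
proof -
  obtain S where S: "compact S" "emeasure \<nu> (- S) = 0"
    using assms(1) by (auto simp: compactly_supported_def)
  obtain b where b: "b > 0" "\<And>x. x \<in> S \<Longrightarrow> norm x \<le> b"
    using compact_imp_bounded[OF S(1)] by (auto simp: bounded_pos)
  have "{x. b < \<bar>x\<bar>} \<subseteq> - S" using b(2) by force
  moreover have "- S \<in> sets \<nu>" using S(1) assms(2) by (simp add: borel_closed compact_imp_closed)
  ultimately have "emeasure \<nu> {x. b < \<bar>x\<bar>} \<le> emeasure \<nu> (- S)" by (intro emeasure_mono) auto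
  then show thesis using that b(1) S(2) by simp
qed

theorem theorem2:
  fixes \<alpha> \<rho> \<epsilon> :: real
    and L1 L2 :: "plane set" and v :: "nat \<Rightarrow> plane"
    and \<nu> :: "real measure"
    and \<sigma> t :: "nat \<Rightarrow> real"
    and M :: "nat \<Rightarrow> 'a measure"
    and Z :: "nat \<Rightarrow> 'a \<Rightarrow> nat \<Rightarrow> nat"
    and X :: "nat \<Rightarrow> 'a \<Rightarrow> nat \<Rightarrow> plane"
    and Zhat :: "nat \<Rightarrow> 'a \<Rightarrow> nat \<Rightarrow> nat"
  assumes "0 < \<alpha>" and "\<alpha> < pi"
    and "meet_at_angle L1 L2 \<alpha>"
    and "norm (v 0) = 1" and "span {v 0} = L1"
    and "norm (v 1) = 1" and "span {v 1} = L2"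
    and "prob_space \<nu>" and "sets \<nu> = sets borel"
    and "compactly_supported \<nu>" and "symmetric_about_0 \<nu>"
    and "0 < \<rho>" and "\<rho> \<le> 1" and "bdd_above (interval_ratios \<nu> \<rho>)"
    and "\<And>N. 0 < \<sigma> N" and "\<And>N. 0 < t N"
    and "0 < \<epsilon>"
    and "\<And>N. prob_space (M N)"
    and "\<And>N. sampled_from_GLMM (M N) N v \<nu> (\<sigma> N) (Z N) (X N)"
    and "\<And>N. Zhat N \<in> M N \<rightarrow>\<^sub>M label_space N"
    and "\<And>N \<omega>. 2 \<le> N \<Longrightarrow> \<omega> \<in> space (M N) \<Longrightarrow> spectral_output N (t N) \<epsilon> (X N \<omega>) (Zhat N \<omega>)"
  shows "((\<lambda>N. \<sigma> N * sqrt (ln (real N))) \<lless> t \<and>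
          t \<lless> (\<lambda>N. (real N * ln (real N)) powr (- 1 / \<rho>)) \<longrightarrow> exact_recovery M Zhat Z) \<and>
         (\<sigma> \<lless> t \<and> t \<lless> (\<lambda>N. 1) \<longrightarrow> almost_exact_recovery M Zhat Z)"
proof -
  note v = assms(4) assms(6) and \<nu> = assms(8) assms(9) and pos = assms(15) assms(16)
  have det: "cross_det (v 0) (v 1) \<noteq> 0"
    using assms(1-7) by (intro cross_det_nonzero[of \<alpha>]) auto
  obtain M0 where M0: "M0 \<ge> 0" "\<And>x r. r > 0 \<Longrightarrow> measure \<nu> {y. \<bar>y - x\<bar> \<le> r} \<le> M0 * (2 * r) powr \<rho>"
    using interval_mass_bound[OF assms(14)] by blast
  obtain K where K: "K > 0" "emeasure \<nu> {x. K < \<bar>x\<bar>} = 0"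
    using compact_support_bound[OF assms(10,9)] by blast
  define c where "c = 24 * K / \<bar>cross_det (v 0) (v 1)\<bar>"
  have c: "c > 0" using K det by (simp add: c_def)
  define C where "C = (32 + 16 * \<epsilon>) * 128\<^sup>2"
  have C: "C > 0" using assms(17) by (simp add: C_def)
  let ?p = "\<lambda>N J. triple_bound \<rho> M0 K c (\<sigma> N) (t N) J"
  define R where "R N = (\<integral>\<omega>. real (Ham_star N (Zhat N \<omega>) (Z N \<omega>)) \<partial>M N)" for N
  have R0: "R N \<ge> 0" for N by (simp add: R_def)
  have bound: "R N \<le> 2 * real N * (9 / 10) ^ N + C * (real N * ?p N J)" if N: "N \<ge> 16" for N J
    unfolding R_def C_def
  proof (rule expected_error_bound[OF N assms(18) \<nu> assms(17) assms(19)])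
    show "spectral_output N (t N) \<epsilon> (X N \<omega>) (Zhat N \<omega>)" if "\<omega> \<in> space (M N)" for \<omega>
      using assms(21) N that by simp
    show "0 \<le> ?p N J" using M0(1) by (simp add: triple_bound_def)
    show "emeasure (GLMM N v \<nu> (\<sigma> N))
        {w \<in> space (label_space N \<Otimes>\<^sub>M sample_space N). misjudged (t N) (fst w) (snd w) i j k} \<le> ennreal (?p N J)"
      if "i < N" "j < N" "k < N" "distinct [i, j, k]" for i j k
      using emeasure_GLMM_misjudged[OF v det \<nu> M0 K pos(1)[of N] pos(2)[of N] that, of J]
      by (simp add: triple_bound_def c_def)
  qed
  have unb: "(\<lambda>N. 2 * real N * (9 / 10) ^ N) \<longlonglongrightarrow> 0"
    by real_asymp
  have "exact_recovery M Zhat Z"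
    if lo: "(\<lambda>N. \<sigma> N * sqrt (ln (real N))) \<lless> t"
      and hi: "t \<lless> (\<lambda>N. (real N * ln (real N)) powr (- 1 / \<rho>))"
  proof -
    let ?J = "\<lambda>N. nat \<lceil>2 / \<rho> * log 2 (real N)\<rceil>"
    have "(\<lambda>N. 2 * real N * (9 / 10) ^ N + C * (real N * ?p N (?J N))) \<longlonglongrightarrow> 0 + C * 0"
      by (intro tendsto_add tendsto_mult tendsto_const unb
          triple_bound_log_shells[OF pos assms(12) c M0(1) K(1) lo hi])
    then have lim: "(\<lambda>N. 2 * real N * (9 / 10) ^ N + C * (real N * ?p N (?J N))) \<longlonglongrightarrow> 0" by simp
    have le: "\<forall>\<^sub>F N in sequentially. R N \<le> 2 * real N * (9 / 10) ^ N + C * (real N * ?p N (?J N))"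
      using eventually_ge_at_top[of 16] by eventually_elim (rule bound)
    have "R \<longlonglongrightarrow> 0"
      by (rule tendsto_sandwich[OF always_eventually le tendsto_const lim]) (simp add: R0)
    then show ?thesis by (simp add: exact_recovery_def R_def[abs_def])
  qed
  moreover have "almost_exact_recovery M Zhat Z" if small: "\<sigma> \<lless> t" "t \<lless> (\<lambda>N. 1)"
  proof -
    have "(\<lambda>N. R N / real N) \<longlonglongrightarrow> 0"
    proof (rule tendsto_0_two_scales)
      let ?rest = "\<lambda>J. 3 * (M0 * (2 * K / 2 ^ J) powr \<rho>)"
      show "0 \<le> R N / real N" for N using R0 by simp
      show "\<forall>\<^sub>F N in sequentially. R N / real N
          \<le> (2 * (9 / 10) ^ N + C * (?p N J - ?rest J)) + C * ?rest J" for J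
        using eventually_ge_at_top[of 16]
      proof eventually_elim
        case (elim N)
        then have "R N / real N \<le> (2 * real N * (9 / 10) ^ N + C * (real N * ?p N J)) / real N"
          by (intro divide_right_mono bound) auto
        also have "\<dots> = 2 * (9 / 10) ^ N + C * ?p N J" using elim by (simp add: add_divide_distrib)
        finally show ?case by (simp add: algebra_simps)
      qed
      show "(\<lambda>N. 2 * (9 / 10) ^ N + C * (?p N J - ?rest J)) \<longlonglongrightarrow> 0" for J
      proof -
        have "(\<lambda>N. 2 * (9 / 10) ^ N + C * (?p N J - ?rest J)) \<longlonglongrightarrow> 2 * 0 + C * 0"
          by (intro tendsto_intros LIMSEQ_power_zero
              triple_bound_shells_tendsto_0[OF pos assms(12) c small]) auto
        then show ?thesis by simp
      qed
      show "(\<lambda>J. C * ?rest J) \<longlonglongrightarrow> 0"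
        using geometric_powr_tendsto_0[OF assms(12) K(1), of "3 * C * M0"] by (simp add: mult_ac)
    qed
    then show ?thesis by (simp add: almost_exact_recovery_def R_def)
  qed
  ultimately show ?thesis by blast
qed

end
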